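(* Let $N=2$, let $T>0$, and let $g:\mathbb{R}^2\to\mathbb{R}$ be bounded and Lipschitz continuous. Let $v:\mathbb{R}^2\times[0,T]\to\mathbb{R}$ be the value function defined in the context and let $u(x,t):=v(x,T-t)$ for $(x,t)\in\mathbb{R}^2\times[0,T]$, which is a bounded viscosity solution of $$u_t(x,t)+\tfrac12 E(x)\nabla u(x,t)\cdot\nabla u(x,t)=0,\quad x\in\mathbb{R}^2,\ t\in(0,T),\qquad u(x,0)=g(x),\quad x\in\mathbb{R}^2 .$$ Then there is $C>0$ such that for all $(y,t),(\tilde y,\tilde t)\in\mathbb{R}^2\times[0,T]$ $$|u(y,t)-u(\tilde y,\tilde t)|\le C\left(|y-\tilde y|^{1/2}+|t-\tilde t|\right).$$ Moreover, $u$ is differentiable almost everywhere in $\mathbb{R}^2\times[0,T]$ and satisfies the Hamilton--Jacobi equation $u_t(x,t)+\tfrac12 E(x)\nabla u(x,t)\cdot\nabla u(x,t)=0$ (posed for $t\in(0,T)$) at all points of differentiability.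
   Context: For $x=(x_1,x_2)\in\mathbb{R}^2$, $E(x)$ is the symmetric positive semi-definite $2\times2$ matrix with entries $E(x)_{i,j}=e^{-|x_i-x_j|}$, $i,j=1,2$, and $\sqrt{E(x)}$ is its unique symmetric positive semi-definite square root. $|\cdot|$ is the Euclidean norm, and $\nabla$ is the gradient in $x$. The value function is $$v(y,t):=\inf\left\{\frac12\int_t^T|\alpha(s)|^2\,ds+g(x(T))\right\},\qquad y\in\mathbb{R}^2,\ t\in[0,T],$$ where the infimum is taken over all measurable controls $\alpha:[0,T]\to\mathbb{R}^2$ and all (absolutely continuous) solutions $x:[t,T]\to\mathbb{R}^2$ of $x'(s)=\sqrt{E(x(s))}\,\alpha(s)$ for (a.e.) $t<s<T$, $x(t)=y$. (Solutions need not be unique; the infimum does not change if one restricts to square integrable controls, for which solutions exist.) The function $u(x,t)=v(x,T-t)$ is the solution meant by "the viscosity solution constructed" in the authors' earlier work; that it is a bounded continuous viscosity solution is known from that work. *)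

theory Defs
  imports "HOL-Analysis.Analysis"
begin

definition E :: "real^2 \<Rightarrow> real^2^2" where
  "E x = (\<chi> i j. exp (- \<bar>x $ i - x $ j\<bar>))"

definition sym_psd :: "real^'n^'n \<Rightarrow> bool" where
  "sym_psd A \<longleftrightarrow> transpose A = A \<and> (\<forall>v. 0 \<le> v \<bullet> (A *v v))"

definition mat_sqrt :: "real^'n^'n \<Rightarrow> real^'n^'n" where
  "mat_sqrt A = (THE B. sym_psd B \<and> B ** B = A)"

(* The usual epsilon-delta definition: a division of its own union is a finite family of
   non-overlapping nonempty compact intervals K = {Inf K..Sup K}. *)
definition absolutely_continuous_on :: "real set \<Rightarrow> (real \<Rightarrow> 'a::real_normed_vector) \<Rightarrow> bool" where
  "absolutely_continuous_on S f \<longleftrightarrow>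
     (\<forall>\<epsilon>>0. \<exists>\<delta>>0. \<forall>D. D division_of \<Union>D \<and> \<Union>D \<subseteq> S \<and> (\<Sum>K\<in>D. Sup K - Inf K) < \<delta> \<longrightarrow>
        (\<Sum>K\<in>D. norm (f (Sup K) - f (Inf K))) < \<epsilon>)"

(* Only the values of alpha on [0,T] and of x on [t,T] matter. *)
definition admissible ::
  "real \<Rightarrow> real^2 \<Rightarrow> real \<Rightarrow> (real \<Rightarrow> real^2) \<Rightarrow> (real \<Rightarrow> real^2) \<Rightarrow> bool" where
  "admissible T y t \<alpha> x \<longleftrightarrow>
     \<alpha> \<in> borel_measurable (lebesgue_on {0..T}) \<and>
     absolutely_continuous_on {t..T} x \<and>
     x t = y \<and>
     (AE s in lebesgue. s \<in> {t<..<T} \<longrightarrow>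
        (x has_vector_derivative mat_sqrt (E (x s)) *v \<alpha> s) (at s))"

(* Extended real: controls that are not square integrable have infinite cost. *)
definition cost :: "(real^2 \<Rightarrow> real) \<Rightarrow> real \<Rightarrow> real \<Rightarrow> (real \<Rightarrow> real^2) \<Rightarrow> (real \<Rightarrow> real^2) \<Rightarrow> ereal" where
  "cost g T t \<alpha> x =
     ereal (1/2) * enn2ereal (\<integral>\<^sup>+ s. ennreal ((norm (\<alpha> s))\<^sup>2) \<partial>lebesgue_on {t..T}) + ereal (g (x T))"

(* For bounded g the infimum is finite: it is bounded below by inf g, and the zero control with the
   constant path gives the upper bound g y. So real_of_ereal loses nothing. *)
definition value_function :: "(real^2 \<Rightarrow> real) \<Rightarrow> real \<Rightarrow> real^2 \<Rightarrow> real \<Rightarrow> real" where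
  "value_function g T y t =
     real_of_ereal (INF (\<alpha>, x) \<in> {(\<alpha>, x). admissible T y t \<alpha> x}. cost g T t \<alpha> x)"

end

(*
  In the coordinates P = x_1 + x_2, R = x_1 - x_2 the square root of E is diagonal, and R is a function of a
  variable theta in which the dynamics are no longer degenerate. The value function is Lipschitz continuous
  in time: waiting costs nothing, and by the Lipschitz bound on g an extra time h gains at most a constant
  times h. Hence travelling for a time equal to the distance shows that the value function is Lipschitz
  continuous in (P, theta, t). Since theta is a 1/2-Hoelder function of R which is smooth off R = 0, the Hoelder
  estimate follows, and Rademacher's theorem in the coordinates (P, theta, t) gives differentiability almost
  everywhere. At a point of differentiability the equation follows from dynamic programming: the upper
  bound from a smooth path with initial control - sqrt(E) grad u, the lower bound from nearly optimal
  paths and completion of the square.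
*)
theory Submission
  imports Defs
begin

text \<open>The obstacle is the diagonal x_1 = x_2. There sqrt(E) is singular and behaves like the
  square root of |R|, so paths are not unique and comparing two paths driven by the same control
  gives no estimate. The variable \<theta> measures, up to a constant factor, the control effort
  spent in the direction of R: since |R| = 2 ln cosh \<theta> is of order \<theta>^2 near 0, a
  distance d across the diagonal costs an effort of order d^(1/2), which is the source of the
  exponent. Comparison of u at two points is therefore made by steering from one to the other along
  an explicit path, never by stability of the state equation. The constant L^2 in time is an
  optimum: within time h and with energy A a path moves by at most sqrt(2 h A), and L sqrt(2 h A) -
  A/2 is at most L^2 h. Only one direction of the coordinate change has to respect null sets. The
  map from (P, \<theta>, t) to (x, t) is differentiable everywhere, so it carries the exceptional
  null set back to a null set, although its inverse is singular on the diagonal.\<close>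

section \<open>Rademacher's theorem\<close>

lemma lmeasurable_outer_open:
  fixes S :: "'a::euclidean_space set"
  assumes S: "S \<in> lmeasurable" and "e > 0"
  obtains U where "open U" "S \<subseteq> U" "U \<in> lmeasurable" "measure lebesgue (U - S) < e" "U - S \<in> lmeasurable"
proof -
  obtain U where U: "open U" "S \<subseteq> U" "U - S \<in> lmeasurable" "emeasure lebesgue (U - S) < ennreal e"
    using sets_lebesgue_outer_open[of S e] S \<open>e > 0\<close> by (auto simp: fmeasurableD)
  have "U = S \<union> (U - S)" using U by auto
  then have "U \<in> lmeasurable" using S U by (metis fmeasurable.Un)
  moreover have "measure lebesgue (U - S) < e"
    using U \<open>e > 0\<close> by (simp add: emeasure_eq_measure2 ennreal_less_iff)
  ultimately show ?thesis using U that by blast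
qed

text \<open>The intervals with slope at most \<open>p\<close> form a fine cover of \<open>S\<close>,
  so Vitali's theorem selects disjoint ones that exhaust \<open>S\<close> up to a null set.
  Monotonicity keeps their images disjoint, each at most \<open>p\<close> times as long, and the
  Lipschitz bound makes the image of the leftover null. An interval must contain \<open>x\<close>
  but need not be centred there; it is treated as a ball about its own midpoint.\<close>

lemma Vitali_image_measure_le:
  fixes f :: "real \<Rightarrow> real"
  assumes mono: "strict_mono f" and lip: "K-lipschitz_on UNIV f"
    and S: "S \<in> lmeasurable" and fS: "f ` S \<in> lmeasurable" and "p \<ge> 0"
    and cover: "\<And>x d. x \<in> S \<Longrightarrow> d > 0 \<Longrightarrow> \<exists>u v. u \<le> x \<and> x \<le> v \<and> u < v \<and> v < u + d \<and> f v - f u \<le> p * (v - u)"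
  shows "measure lebesgue (f ` S) \<le> p * measure lebesgue S"
proof -
  have "measure lebesgue (f ` S) \<le> p * (measure lebesgue S + e)" if "e > 0" for e
  proof -
    obtain U where U: "open U" "S \<subseteq> U" "U \<in> lmeasurable" "measure lebesgue (U - S) < e" "U - S \<in> lmeasurable"
      by (rule lmeasurable_outer_open[OF S \<open>e > 0\<close>])
    have mU: "measure lebesgue U \<le> measure lebesgue S + e"
      using U S measurable_measure_Diff[of U lebesgue S] by (auto simp: fmeasurableD)
    define Q where "Q = {(u, v). u < v \<and> {u..v} \<subseteq> U \<and> f v - f u \<le> p * (v - u)}"
    have cb: "cball ((u + v) / 2) ((v - u) / 2) = {u..v}" for u v :: real
      by (auto simp: cball_def dist_real_def abs_if field_simps split: if_splits)
    let ?a = "\<lambda>(u, v). (u + v) / 2 :: real" and ?r = "\<lambda>(u, v). (v - u) / 2 :: real"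
    have cov: "\<exists>i. i \<in> Q \<and> x \<in> cball (?a i) (?r i) \<and> ?r i < d" if x: "x \<in> S" and d: "d > 0" for x d
    proof -
      obtain \<epsilon> where \<epsilon>: "\<epsilon> > 0" "ball x \<epsilon> \<subseteq> U"
        using U x by (meson open_contains_ball subsetD)
      obtain u v where uv: "u \<le> x" "x \<le> v" "u < v" "v < u + min d \<epsilon>" "f v - f u \<le> p * (v - u)"
        using cover[OF x, of "min d \<epsilon>"] d \<epsilon> by auto
      have "{u..v} \<subseteq> ball x \<epsilon>"
        using uv by (auto simp: dist_real_def)
      then have "(u, v) \<in> Q"
        using uv \<epsilon> unfolding Q_def by auto
      then show ?thesis
        using uv by (intro exI[of _ "(u, v)"]) (auto simp: cb)
    qed
    obtain C where C: "countable C" "C \<subseteq> Q" 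
      "pairwise (\<lambda>i j. disjnt (cball (?a i) (?r i)) (cball (?a j) (?r j))) C"
      "negligible (S - (\<Union>i\<in>C. cball (?a i) (?r i)))"
    proof (rule Vitali_covering_theorem_cballs[of Q ?r S ?a])
      show "0 < ?r i" if "i \<in> Q" for i
        using that by (auto simp: Q_def)
    qed (rule cov)
    define I where "I = (\<lambda>(u, v). {u..v::real})"
    define J where "J = (\<lambda>(u, v). {f u..f v})"
    have I: "cball (?a i) (?r i) = I i" for i
      by (cases i) (auto simp: I_def cb)
    have disj: "disjoint_family_on I C"
      using C(3) unfolding I pairwise_def disjnt_def disjoint_family_on_def by blast
    have disjJ: "disjoint_family_on J C"
      unfolding disjoint_family_on_def
    proof (intro ballI impI)
      fix i j assume ij: "i \<in> C" "j \<in> C" "i \<noteq> j"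
      obtain u v u' v' where *: "i = (u, v)" "j = (u', v')" "u < v" "u' < v'"
        using ij C(2) by (cases i; cases j) (fastforce simp: Q_def)
      have "{u..v} \<inter> {u'..v'} = {}"
      proof -
        have "I i \<inter> I j = {}"
          using disj ij unfolding disjoint_family_on_def by blast
        then show ?thesis by (simp add: I_def *)
      qed
      then have "v < u' \<or> v' < u" using * by (auto simp: not_less[symmetric] disjoint_iff)
      then have "f v < f u' \<or> f v' < f u" using mono by (auto simp: strict_mono_less)
      then show "J i \<inter> J j = {}" by (auto simp: J_def *)
    qed
    have neg: "negligible (S - (\<Union>i\<in>C. I i))"
      using C(4) unfolding I .
    have fI: "f ` I i \<subseteq> J i" for i
      using mono by (cases i) (auto simp: I_def J_def strict_mono_less_eq)
    have "negligible (f ` (S - (\<Union>i\<in>C. I i)))"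
      using neg lip by (intro negligible_locally_Lipschitz_image[where f=f]) 
         (auto simp: lipschitz_on_def dist_norm intro!: exI[of _ UNIV] )
    then have null: "f ` (S - (\<Union>i\<in>C. I i)) \<in> null_sets lebesgue"
      by (simp add: negligible_iff_null_sets)
    have IU: "(\<Union>i\<in>C. I i) \<subseteq> U"
      using C(2) unfolding Q_def I_def by auto
    have "emeasure lebesgue (f ` S) \<le> emeasure lebesgue ((\<Union>i\<in>C. J i) \<union> f ` (S - (\<Union>i\<in>C. I i)))"
    proof (rule emeasure_mono)
      show "f ` S \<subseteq> (\<Union>i\<in>C. J i) \<union> f ` (S - (\<Union>i\<in>C. I i))"
        using fI by fastforce
      show "(\<Union>i\<in>C. J i) \<union> f ` (S - (\<Union>i\<in>C. I i)) \<in> sets lebesgue"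
        using C(1) null by (intro sets.Un sets.countable_UN'') (auto simp: J_def)
    qed
    also have "\<dots> = emeasure lebesgue (\<Union>i\<in>C. J i)"
      using C(1) null by (intro emeasure_Un_null_set sets.countable_UN'') (auto simp: J_def)
    also have "\<dots> = (\<integral>\<^sup>+ i. emeasure lebesgue (J i) \<partial>count_space C)"
      using C(1) disjJ by (intro emeasure_UN_countable) (auto simp: J_def)
    also have "\<dots> \<le> (\<integral>\<^sup>+ i. ennreal p * emeasure lebesgue (I i) \<partial>count_space C)"
    proof (rule nn_integral_mono)
      fix i assume "i \<in> space (count_space C)"
      then obtain u v where i: "i = (u, v)" "u < v" "f v - f u \<le> p * (v - u)"
        using C(2) by (auto simp: Q_def)
      have "f u < f v" using mono i by (simp add: strict_mono_less)
      then show "emeasure lebesgue (J i) \<le> ennreal p * emeasure lebesgue (I i)"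
        using i \<open>p \<ge> 0\<close> by (simp add: J_def I_def ennreal_mult[symmetric] ennreal_leI)
    qed
    also have "\<dots> = ennreal p * (\<integral>\<^sup>+ i. emeasure lebesgue (I i) \<partial>count_space C)"
      by (rule nn_integral_cmult) auto
    also have "(\<integral>\<^sup>+ i. emeasure lebesgue (I i) \<partial>count_space C) = emeasure lebesgue (\<Union>i\<in>C. I i)"
      using disj C(1) by (intro emeasure_UN_countable[symmetric]) (auto simp: I_def)
    also have "ennreal p * \<dots> \<le> ennreal p * emeasure lebesgue U"
      using IU U by (intro mult_left_mono emeasure_mono) auto
    also have "\<dots> = ennreal (p * measure lebesgue U)"
      using U \<open>p \<ge> 0\<close> by (simp add: emeasure_eq_measure2 ennreal_mult)
    finally have "measure lebesgue (f ` S) \<le> p * measure lebesgue U"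
      using fS \<open>p \<ge> 0\<close> by (simp add: emeasure_eq_measure2)
    also have "\<dots> \<le> p * (measure lebesgue S + e)"
      using mU \<open>p \<ge> 0\<close> by (intro mult_left_mono) auto
    finally show ?thesis .
  qed
  note * = this
  show ?thesis
  proof (rule field_le_epsilon)
    fix e :: real assume "e > 0"
    then have "measure lebesgue (f ` S) \<le> p * (measure lebesgue S + e / (p + 1))"
      using \<open>p \<ge> 0\<close> by (intro *) auto
    also have "\<dots> \<le> p * measure lebesgue S + e"
      using \<open>p \<ge> 0\<close> \<open>e > 0\<close> by (simp add: field_simps)
    finally show "measure lebesgue (f ` S) \<le> p * measure lebesgue S + e" .
  qed
qed

text \<open>The lower bound 1 on all slopes makes \<open>f\<close> a homeomorphism with a
  1-Lipschitz inverse. Steep difference quotients of \<open>f\<close> are flat ones of the inverse,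
  so the covering lemma bounds the measure of an image from both sides.\<close>

lemma bilipschitz_differentiable_AE:
  fixes f :: "real \<Rightarrow> real"
  assumes f1: "\<And>x y. x \<le> y \<Longrightarrow> y - x \<le> f y - f x"
    and fK: "\<And>x y. x \<le> y \<Longrightarrow> f y - f x \<le> K * (y - x)"
  shows "negligible {x. \<not> f differentiable (at x)}"
proof -
  define s where "s x y = (f y - f x) / (y - x)" for x y
  \<comment> \<open>The derived numbers of \<open>f\<close> at points of \<open>S p q\<close> straddle \<open>[p, q]\<close>. Applying the previous lemma to \<open>f\<close>
    and to its inverse gives \<open>q |S p q| \<le> |f (S p q)| \<le> p |S p q|\<close>.\<close>
  define S where "S p q = {x. (\<forall>d>0. \<exists>y. y \<noteq> x \<and> \<bar>y - x\<bar> < d \<and> s x y < p) \<and>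
                              (\<forall>d>0. \<exists>y. y \<noteq> x \<and> \<bar>y - x\<bar> < d \<and> q < s x y)}" for p q
  have K1: "K \<ge> 1" using f1[of 0 1] fK[of 0 1] by simp
  have slope: "1 \<le> s x y \<and> s x y \<le> K" if "x \<noteq> y" for x y
    using f1[of x y] fK[of x y] f1[of y x] fK[of y x] that
    by (cases "x < y") (auto simp: s_def field_simps)
  have absf: "\<bar>f y - f x\<bar> \<le> K * \<bar>y - x\<bar>" "\<bar>y - x\<bar> \<le> \<bar>f y - f x\<bar>" for x y
    using f1[of x y] fK[of x y] f1[of y x] fK[of y x] by (cases "x \<le> y"; simp add: algebra_simps abs_if)+
  have smono: "strict_mono f"
    by (rule strict_monoI) (smt (verit) f1)
  have lipf: "K-lipschitz_on UNIV f"
    using absf K1 by (auto simp: lipschitz_on_def dist_real_def abs_minus_commute)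
  have contf: "continuous_on A f" for A
    using lipf lipschitz_on_continuous_on continuous_on_subset by blast
  have "surj f"
  proof -
    have "\<exists>x. f x = y" for y
    proof -
      define m where "m = \<bar>y - f 0\<bar>"
      have "f (-m) \<le> y" "y \<le> f m"
        using f1[of "-m" 0] f1[of 0 m] by (auto simp: m_def)
      moreover have "-m \<le> m" by (simp add: m_def)
      ultimately show ?thesis
        using IVT'[of f "-m" y m] contf by blast
    qed
    then show ?thesis by (metis surjI)
  qed
  then have bij: "bij f"
    using smono by (simp add: bij_def strict_mono_imp_inj_on)
  define g where "g = inv f"
  have gf[simp]: "g (f x) = x" and fg[simp]: "f (g x) = x" for x
    using bij by (auto simp: g_def bij_def surj_f_inv_f)
  have smonog: "strict_mono g"
    using smono by (metis fg strict_mono_def linorder_neqE_linordered_idom order_less_asym)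
  have lipg: "1-lipschitz_on UNIV g"
    using absf(2)[of "g _" "g _"] by (auto simp: lipschitz_on_def dist_real_def)
  have contg: "continuous_on UNIV g"
    using lipg lipschitz_on_continuous_on by blast
  have Sborel: "S p q \<in> sets borel" for p q
  proof -
    \<comment> \<open>For a fixed increment \<open>h\<close> the quotient is continuous in
      \<open>x\<close>, so the condition is a union of open conditions.\<close>
    have op: "open {x. \<exists>y. y \<noteq> x \<and> \<bar>y - x\<bar> < d \<and> s x y \<in> T}" if "open T" for d T
    proof -
      have "{x. \<exists>y. y \<noteq> x \<and> \<bar>y - x\<bar> < d \<and> s x y \<in> T} =
            (\<Union>h\<in>{h. h \<noteq> 0 \<and> \<bar>h\<bar> < d}. (\<lambda>x. s x (x + h)) -` T)"
        apply auto
        subgoal for x y by (rule exI[of _ "y - x"]) auto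
        subgoal for x h by (rule exI[of _ "x + h"]) auto
        done
      moreover have "open ((\<lambda>x. s x (x + h)) -` T)" if "h \<noteq> 0" for h
        unfolding s_def using that \<open>open T\<close>
        by (intro open_vimage continuous_intros continuous_on_compose2[OF contf[of UNIV]]) auto
      ultimately show ?thesis by auto
    qed
    have all: "(\<forall>d>0. \<exists>y. y \<noteq> x \<and> \<bar>y - x\<bar> < d \<and> s x y \<in> T) \<longleftrightarrow>
          (\<forall>n. \<exists>y. y \<noteq> x \<and> \<bar>y - x\<bar> < 1 / real (Suc n) \<and> s x y \<in> T)" for x T
    proof
      assume L: "\<forall>d>0. \<exists>y. y \<noteq> x \<and> \<bar>y - x\<bar> < d \<and> s x y \<in> T"
      show "\<forall>n. \<exists>y. y \<noteq> x \<and> \<bar>y - x\<bar> < 1 / real (Suc n) \<and> s x y \<in> T"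
      proof
        fix n show "\<exists>y. y \<noteq> x \<and> \<bar>y - x\<bar> < 1 / real (Suc n) \<and> s x y \<in> T"
          using L[rule_format, of "1 / real (Suc n)"] by simp
      qed
    next
      assume R: "\<forall>n. \<exists>y. y \<noteq> x \<and> \<bar>y - x\<bar> < 1 / real (Suc n) \<and> s x y \<in> T"
      show "\<forall>d>0. \<exists>y. y \<noteq> x \<and> \<bar>y - x\<bar> < d \<and> s x y \<in> T"
      proof (intro allI impI)
        fix d :: real assume "d > 0"
        then obtain n where "1 / real (Suc n) < d"
          using nat_approx_posE by blast
        then show "\<exists>y. y \<noteq> x \<and> \<bar>y - x\<bar> < d \<and> s x y \<in> T"
          using R[rule_format, of n] by auto
      qed
    qed
    have "S p q = (\<Inter>n. {x. \<exists>y. y \<noteq> x \<and> \<bar>y - x\<bar> < 1 / real (Suc n) \<and> s x y \<in> {..<p}}) \<inter>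
                  (\<Inter>n. {x. \<exists>y. y \<noteq> x \<and> \<bar>y - x\<bar> < 1 / real (Suc n) \<and> s x y \<in> {q<..}})"
      using all[of _ "{..<p}"] all[of _ "{q<..}"] unfolding S_def by auto
    then show ?thesis
      using op[of "{..<p}"] op[of "{q<..}"] by (auto intro!: sets.Int sets.countable_INT'' borel_open)
  qed
  have Snull: "negligible (S p q)" if pq: "0 < p" "p < q" for p q
  proof -
    have "negligible (S p q \<inter> ball 0 (real n))" for n
    proof -
      define B where "B = S p q \<inter> ball 0 (real n)"
      have "B \<in> sets borel" using Sborel by (auto simp: B_def)
      then have B: "B \<in> lmeasurable"
        by (intro bounded_set_imp_lmeasurable) (auto simp: B_def intro: bounded_subset[of "ball 0 (real n)"])
      have fB: "f ` B \<in> lmeasurable"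
      proof (rule bounded_set_imp_lmeasurable)
        have "f ` B = g -` B \<inter> space borel"
          by (auto intro: image_eqI[of _ f "g _"])
        moreover have "g \<in> borel_measurable borel"
          using contg by (rule borel_measurable_continuous_onI)
        ultimately show "f ` B \<in> sets lebesgue"
          using \<open>B \<in> sets borel\<close> measurable_sets[of g borel borel B] by auto
        have "f ` B \<subseteq> f ` cball 0 (real n)" by (auto simp: B_def)
        moreover have "compact (f ` cball 0 (real n))"
          using contf by (intro compact_continuous_image) auto
        ultimately show "bounded (f ` B)"
          using bounded_subset compact_imp_bounded by blast
      qed
      have "measure lebesgue (f ` B) \<le> p * measure lebesgue B"
      proof (rule Vitali_image_measure_le[OF smono lipf B fB])
        fix x d :: real assume "x \<in> B" "d > 0"
        then obtain y where y: "y \<noteq> x" "\<bar>y - x\<bar> < d" "s x y < p"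
          by (auto simp: B_def S_def)
        then show "\<exists>u v. u \<le> x \<and> x \<le> v \<and> u < v \<and> v < u + d \<and> f v - f u \<le> p * (v - u)"
          by (intro exI[of _ "min x y"] exI[of _ "max x y"]) 
             (auto simp: min_def max_def s_def field_simps split: if_splits)
      qed (use pq in auto)
      moreover have "measure lebesgue (g ` f ` B) \<le> (1 / q) * measure lebesgue (f ` B)"
      proof (rule Vitali_image_measure_le[OF smonog lipg fB])
        show "g ` f ` B \<in> lmeasurable" using B by (simp add: image_image)
        fix z d :: real assume "z \<in> f ` B" "d > 0"
        then obtain x where x: "x \<in> B" "z = f x" by auto
        \<comment> \<open>\<open>f\<close> stretches distances by at most \<open>K\<close>, so
          points closer than \<open>d / K\<close> have values closer than \<open>d\<close>.\<close>
        moreover have "d / K > 0" using \<open>d > 0\<close> K1 by simp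
        ultimately obtain y where y: "y \<noteq> x" "\<bar>y - x\<bar> < d / K" "q < s x y"
          unfolding B_def S_def by blast
        have d: "\<bar>f y - f x\<bar> < d"
          using absf(1)[of y x] y(2) K1 by (smt (verit) pos_less_divide_eq mult.commute)
        have "f x < f y \<longleftrightarrow> x < y" using smono by (simp add: strict_mono_less)
        then show "\<exists>u v. u \<le> z \<and> z \<le> v \<and> u < v \<and> v < u + d \<and> g v - g u \<le> (1 / q) * (v - u)"
          using y d smono pq x
          by (intro exI[of _ "min (f x) (f y)"] exI[of _ "max (f x) (f y)"]) 
             (auto simp: min_def max_def s_def field_simps strict_mono_eq split: if_splits)
      qed (use pq in auto)
      ultimately have "q * measure lebesgue B \<le> p * measure lebesgue B"
        using pq by (simp add: image_image field_simps)
      then have "measure lebesgue B = 0"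
        using pq by (metis linorder_not_less measure_nonneg mult_le_cancel_right order_antisym_conv)
      then show ?thesis
        using B unfolding B_def[symmetric] by (simp add: negligible_iff_measure)
    qed
    then have "negligible (\<Union>n. S p q \<inter> ball 0 (real n))" by (rule negligible_Union_nat)
    moreover have "(\<Union>n. S p q \<inter> ball 0 (real n)) = S p q"
      using reals_Archimedean2 by auto
    ultimately show ?thesis by simp
  qed
  define N where "N = (\<Union>(p, q)\<in>{(p, q). p \<in> \<rat> \<and> q \<in> \<rat> \<and> 0 < p \<and> p < q}. S p q)"
  have "negligible N"
    unfolding N_def
  proof (rule negligible_countable_Union)
    have "{(p::real, q). p \<in> \<rat> \<and> q \<in> \<rat> \<and> 0 < p \<and> p < q} \<subseteq> \<rat> \<times> \<rat>" by auto
    then show "countable ((\<lambda>(p, q). S p q) ` {(p, q). p \<in> \<rat> \<and> q \<in> \<rat> \<and> 0 < p \<and> p < q})"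
      by (meson countable_rat countable_SIGMA countable_image countable_subset)
  qed (use Snull in auto)
  moreover have "f differentiable (at x)" if "x \<notin> N" for x
  proof -
    \<comment> \<open>\<open>Inf Q\<close> is the upper derivative of \<open>f\<close> at
      \<open>x\<close>. If the quotients did not stay above \<open>c - r\<close> near
      \<open>x\<close>, two rationals below \<open>c\<close> would separate lower from upper
      derivative and put \<open>x\<close> into \<open>N\<close>.\<close>
    define Q where "Q = {q. \<exists>d>0. \<forall>y. y \<noteq> x \<and> \<bar>y - x\<bar> < d \<longrightarrow> s x y \<le> q}"
    have KQ: "K \<in> Q" unfolding Q_def using slope by (auto intro!: exI[of _ 1])
    have Q1: "1 \<le> q" if "q \<in> Q" for q
    proof -
      obtain d where d: "d > 0" "\<forall>y. y \<noteq> x \<and> \<bar>y - x\<bar> < d \<longrightarrow> s x y \<le> q"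
        using \<open>q \<in> Q\<close> by (auto simp: Q_def)
      then have "s x (x + d/2) \<le> q" by auto
      then show ?thesis using slope[of x "x + d/2"] d(1) by auto
    qed
    then have bdd: "bdd_below Q" by (auto simp: bdd_below_def)
    define c where "c = Inf Q"
    have c1: "c \<ge> 1" unfolding c_def using KQ Q1 by (intro cInf_greatest) auto
    have "(\<lambda>y. (f y - f x) / (y - x)) \<midarrow>x\<rightarrow> c"
      unfolding LIM_eq
    proof (intro allI impI)
      fix r :: real assume "r > 0"
      obtain q where q: "q \<in> Q" "q < c + r"
        using cInf_lessD[of Q "c + r"] KQ \<open>r > 0\<close> by (auto simp: c_def)
      obtain d1 where d1: "d1 > 0" "\<And>y. y \<noteq> x \<Longrightarrow> \<bar>y - x\<bar> < d1 \<Longrightarrow> s x y \<le> q"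
        using q by (auto simp: Q_def)
      have "\<exists>d>0. \<forall>y. y \<noteq> x \<and> \<bar>y - x\<bar> < d \<longrightarrow> c - r < s x y"
      proof (rule ccontr)
        assume neg: "\<not> ?thesis"
        obtain p where p: "p \<in> \<rat>" "max (c - r) 0 < p" "p < c" 
          using Rats_dense_in_real[of "max (c - r) 0" c] \<open>r > 0\<close> c1 by auto
        obtain q' where q': "q' \<in> \<rat>" "p < q'" "q' < c" 
          using Rats_dense_in_real[of p c] p by auto
        have "x \<notin> S p q'" using \<open>x \<notin> N\<close> p q' by (auto simp: N_def)
        moreover have "\<forall>d>0. \<exists>y. y \<noteq> x \<and> \<bar>y - x\<bar> < d \<and> s x y < p"
          using neg p by (metis max_less_iff_conj linorder_not_less order_le_less_trans)
        ultimately have "\<exists>d>0. \<forall>y. y \<noteq> x \<and> \<bar>y - x\<bar> < d \<longrightarrow> s x y \<le> q'"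
          unfolding S_def mem_Collect_eq by (meson linorder_not_less)
        then have "q' \<in> Q" by (simp add: Q_def)
        then show False using q' bdd cInf_lower[of q' Q] by (simp add: c_def)
      qed
      then obtain d2 where d2: "d2 > 0" "\<And>y. y \<noteq> x \<Longrightarrow> \<bar>y - x\<bar> < d2 \<Longrightarrow> c - r < s x y" by auto
      show "\<exists>e>0. \<forall>y. y \<noteq> x \<and> norm (y - x) < e \<longrightarrow> norm ((f y - f x) / (y - x) - c) < r"
      proof (intro exI[of _ "min d1 d2"] conjI allI impI)
        fix y assume "y \<noteq> x \<and> norm (y - x) < min d1 d2"
        then show "norm ((f y - f x) / (y - x) - c) < r"
          using d1(2)[of y] d2(2)[of y] q(2) by (auto simp: s_def)
      qed (use d1 d2 in auto)
    qed
    then show ?thesis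
      by (auto simp: real_differentiable_def has_field_derivative_iff)
  qed
  ultimately show ?thesis
    by (auto intro: negligible_subset)
qed

lemma lipschitz_real_differentiable_AE:
  fixes f :: "real \<Rightarrow> real"
  assumes lip: "K-lipschitz_on UNIV f"
  shows "negligible {x. \<not> f differentiable (at x)}"
proof -
  \<comment> \<open>The added linear term shifts the slopes from [-K, K] to [1, 2K + 1].\<close>
  define F where "F x = f x + (K + 1) * x" for x
  have b: "\<bar>f y - f x\<bar> \<le> K * \<bar>y - x\<bar>" for x y
    using lip by (auto simp: lipschitz_on_def dist_real_def)
  have "negligible {x. \<not> F differentiable (at x)}"
  proof (rule bilipschitz_differentiable_AE[of _ "2 * K + 1"])
    fix x y :: real assume "x \<le> y"
    then show "y - x \<le> F y - F x" "F y - F x \<le> (2 * K + 1) * (y - x)"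
      using b[of y x] by (auto simp: F_def algebra_simps abs_le_iff)
  qed
  moreover have "f differentiable (at x)" if "F differentiable (at x)" for x
  proof -
    have "(\<lambda>x. F x - (K + 1) * x) differentiable (at x)"
      using that by (intro differentiable_diff differentiable_mult) auto
    then show ?thesis by (simp add: F_def)
  qed
  ultimately show ?thesis by (auto intro: negligible_subset)
qed

section \<open>Null sets in several variables: lines and porosity\<close>

lemma negligible_if_negligible_on_lines:
  fixes B :: "'a::euclidean_space set"
  assumes B: "B \<in> sets borel" and lines: "\<And>x. negligible {s::real. x + s *\<^sub>R v \<in> B}"
  shows "negligible B"
proof -
  have [measurable]: "(\<lambda>p::'a \<times> real. fst p + snd p *\<^sub>R v) \<in> borel \<Otimes>\<^sub>M borel \<rightarrow>\<^sub>M borel"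
    unfolding borel_prod by (intro borel_measurable_continuous_onI continuous_intros)
  have m1: "(\<lambda>x. x + s *\<^sub>R v) \<in> borel \<rightarrow>\<^sub>M borel" for s
    by (intro borel_measurable_continuous_onI continuous_intros)
  have m2: "(\<lambda>s. x + s *\<^sub>R v) \<in> borel \<rightarrow>\<^sub>M borel" for x
    by (intro borel_measurable_continuous_onI continuous_intros)
  have meas: "(\<lambda>(x, s). indicator B (x + s *\<^sub>R v) * indicator {0..1} s :: ennreal) \<in> borel_measurable (lborel \<Otimes>\<^sub>M lborel)"
    using B by (auto simp: case_prod_unfold) measurable
  interpret P: pair_sigma_finite "lborel :: 'a measure" "lborel :: real measure" ..
  have trans: "(\<integral>\<^sup>+ x. indicator B (x + s *\<^sub>R v) \<partial>lborel) = emeasure lborel B" for s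
  proof -
    have "(\<integral>\<^sup>+ x. indicator B x \<partial>lborel) = (\<integral>\<^sup>+ x. indicator B x \<partial>distr lborel borel (\<lambda>x. s *\<^sub>R v + x))"
      using lborel_distr_plus[of "s *\<^sub>R v"] by simp
    also have "\<dots> = (\<integral>\<^sup>+ x. indicator B (s *\<^sub>R v + x) \<partial>lborel)"
      using B by (subst nn_integral_distr) auto
    finally show ?thesis using B by (simp add: add.commute)
  qed
  \<comment> \<open>Average the measure of the translates \<open>B - s v\<close> over \<open>s \<in> [0, 1]\<close> and apply Tonelli.\<close>
  have "emeasure lborel B = (\<integral>\<^sup>+ s. emeasure lborel B * indicator {0..1::real} s \<partial>lborel)"
    by (simp add: nn_integral_cmult_indicator)
  also have "\<dots> = (\<integral>\<^sup>+ s. (\<integral>\<^sup>+ x. indicator B (x + s *\<^sub>R v) \<partial>lborel) * indicator {0..1} s \<partial>lborel)"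
    by (simp add: trans)
  also have "\<dots> = (\<integral>\<^sup>+ s. (\<integral>\<^sup>+ x. indicator B (x + s *\<^sub>R v) * indicator {0..1} s \<partial>lborel) \<partial>lborel)"
    using B m1 by (intro nn_integral_cong nn_integral_multc[symmetric]) auto
  also have "\<dots> = (\<integral>\<^sup>+ x. (\<integral>\<^sup>+ s. indicator B (x + s *\<^sub>R v) * indicator {0..1} s \<partial>lborel) \<partial>lborel)"
    using lborel_pair.Fubini'[OF meas] by simp
  also have "\<dots> = (\<integral>\<^sup>+ x. 0 \<partial>(lborel :: 'a measure))"
  proof (intro nn_integral_cong)
    fix x :: 'a
    have "(\<lambda>s. x + s *\<^sub>R v) -` B \<in> sets borel"
      using measurable_sets[OF m2 B, of x] by simp
    then have "{s. x + s *\<^sub>R v \<in> B} \<in> null_sets lborel"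
      using lines[of x] by (simp add: negligible_iff_null_sets null_sets_completion_iff vimage_def)
    then have "AE s in lborel. s \<notin> {s. x + s *\<^sub>R v \<in> B}" by (rule AE_not_in)
    then have "AE s in lborel. (indicator B (x + s *\<^sub>R v) * indicator {0..1} s :: ennreal) = 0"
      by eventually_elim (auto simp: indicator_def)
    then show "(\<integral>\<^sup>+ s. indicator B (x + s *\<^sub>R v) * indicator {0..1} s \<partial>lborel) = 0"
      using nn_integral_cong_AE[of "\<lambda>s. indicator B (x + s *\<^sub>R v) * indicator {0..1} s :: ennreal" "\<lambda>_. 0" lborel] by simp
  qed
  finally have "emeasure lborel B = 0" by simp
  then have "B \<in> null_sets lborel" using B by (simp add: null_sets_def)
  then show ?thesis using B by (simp add: negligible_iff_null_sets null_sets_completion_iff)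
qed

text \<open>A substitute for the density theorem. Each point of the set has arbitrarily small balls
  of which a fixed fraction \<open>c\<close> misses \<open>A\<close>. Disjoint balls of this kind,
  chosen by Vitali inside an open \<open>U\<close> that barely exceeds \<open>B\<close>, give |B|
  \<le> (1 - c) |U|, and letting |U| tend to |B| forces |B| = 0.\<close>

lemma negligible_porous:
  fixes A :: "'a::euclidean_space set"
  assumes A: "A \<in> sets borel" and \<eta>: "0 < \<eta>" "\<eta> \<le> 1"
  shows "negligible {x \<in> A. \<forall>d>0. \<exists>y. dist y x < d \<and> \<eta> * dist y x < infdist y A}" (is "negligible ?Z")
proof -
  define V where "V d = {x. \<exists>y. dist y x < d \<and> \<eta> * dist y x < infdist y A}" for d
  have "V d = (\<Union>y. {x. dist y x < d} \<inter> {x. \<eta> * dist y x < infdist y A})" for d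
    by (auto simp: V_def)
  moreover have "open ({x. dist y x < d} \<inter> {x. \<eta> * dist y x < infdist y A})" for d y
    by (intro open_Int open_Collect_less continuous_intros)
  ultimately have openV: "open (V d)" for d by auto
  have Zeq: "?Z = A \<inter> (\<Inter>n. V (1 / real (Suc n)))"
  proof (intro equalityI subsetI)
    fix x assume "x \<in> ?Z"
    then show "x \<in> A \<inter> (\<Inter>n. V (1 / real (Suc n)))"
      by (auto simp: V_def)
  next
    fix x assume x: "x \<in> A \<inter> (\<Inter>n. V (1 / real (Suc n)))"
    have "\<exists>y. dist y x < d \<and> \<eta> * dist y x < infdist y A" if "d > 0" for d
    proof -
      obtain n where "1 / real (Suc n) < d"
        using nat_approx_posE[OF \<open>d > 0\<close>] by blast
      moreover have "x \<in> V (1 / real (Suc n))" using x by blast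
      ultimately show ?thesis unfolding V_def by force
    qed
    then show "x \<in> ?Z" using x by blast
  qed
  have Zborel: "?Z \<in> sets borel"
    unfolding Zeq using A openV by (auto intro!: sets.Int sets.countable_INT'' borel_open)
  have "negligible (?Z \<inter> ball 0 (real n))" for n
  proof -
    define B where "B = ?Z \<inter> ball 0 (real n)"
    have "B \<in> sets borel" using Zborel by (auto simp: B_def)
    then have B: "B \<in> lmeasurable"
      by (intro bounded_set_imp_lmeasurable) (auto simp: B_def intro: bounded_subset[of "ball 0 (real n)"])
    \<comment> \<open>The share of a ball of radius \<open>r\<close> taken by a hole of radius
      \<open>\<eta> * r / 2\<close>.\<close>
    define c where "c = (\<eta> / 2) ^ DIM('a)"
    have c: "0 < c" "c \<le> 1" using \<eta> by (auto simp: c_def power_le_one)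
    have *: "measure lebesgue B \<le> (1 - c) * (measure lebesgue B + e)" if "e > 0" for e
    proof -
      obtain U where U: "open U" "B \<subseteq> U" "U \<in> lmeasurable" "measure lebesgue (U - B) < e" "U - B \<in> lmeasurable"
        by (rule lmeasurable_outer_open[OF B \<open>e > 0\<close>])
      have mU: "measure lebesgue U \<le> measure lebesgue B + e"
        using U B measurable_measure_Diff[of U lebesgue B] by (auto simp: fmeasurableD)
      define Q where "Q = {(x, r). 0 < r \<and> cball x r \<subseteq> U \<and> (\<exists>y. ball y (\<eta> * r / 2) \<subseteq> cball x r \<and> ball y (\<eta> * r / 2) \<inter> B = {})}"
      have cov: "\<exists>i. i \<in> Q \<and> x \<in> cball (fst i) (snd i) \<and> snd i < d" if x: "x \<in> B" and d: "d > 0" for x d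
      proof -
        obtain \<epsilon> where \<epsilon>: "\<epsilon> > 0" "ball x \<epsilon> \<subseteq> U"
          using U x by (meson open_contains_ball subsetD)
        have "x \<in> A" and "\<forall>d>0. \<exists>y. dist y x < d \<and> \<eta> * dist y x < infdist y A"
          using x by (auto simp: B_def)
        moreover have "min d \<epsilon> / 2 > 0" using d \<epsilon> by auto
        ultimately obtain y where y: "dist y x < min d \<epsilon> / 2" "\<eta> * dist y x < infdist y A"
          by blast
        have "y \<noteq> x" using y \<open>x \<in> A\<close> by auto
        \<comment> \<open>The hole then has radius \<open>\<eta> * dist y x\<close>, which is below
          \<open>infdist y A\<close> and at most \<open>dist y x\<close>. Hence it misses
          \<open>A\<close> and stays within distance \<open>2 * dist y x\<close> of
          \<open>x\<close>.\<close>
        define r where "r = 2 * dist y x"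
        have r: "0 < r" "r < d" "r < \<epsilon>" using y \<open>y \<noteq> x\<close> by (auto simp: r_def)
        have \<eta>y: "\<eta> * dist y x \<le> dist y x" using \<eta> by (simp add: mult_left_le_one_le)
        have "ball y (\<eta> * r / 2) \<subseteq> cball x r"
        proof
          fix z assume "z \<in> ball y (\<eta> * r / 2)"
          then have "dist y z < dist y x" using \<eta>y by (auto simp: r_def)
          then show "z \<in> cball x r"
            using dist_triangle[of x z y] by (auto simp: r_def dist_commute)
        qed
        moreover have "ball y (\<eta> * r / 2) \<inter> B = {}"
        proof -
          have "z \<notin> B" if "z \<in> ball y (\<eta> * r / 2)" for z
          proof
            assume "z \<in> B"
            then have "infdist y A \<le> dist y z" by (intro infdist_le) (auto simp: B_def)
            then show False using that y by (auto simp: r_def)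
          qed
          then show ?thesis by auto
        qed
        moreover have "cball x r \<subseteq> U" using r \<epsilon> by (auto simp: subset_iff)
        ultimately have "(x, r) \<in> Q" using r by (auto simp: Q_def)
        then show ?thesis using r by (intro exI[of _ "(x, r)"]) auto
      qed
      obtain C where C: "countable C" "C \<subseteq> Q" 
        "pairwise (\<lambda>i j. disjnt (cball (fst i) (snd i)) (cball (fst j) (snd j))) C"
        "negligible (B - (\<Union>i\<in>C. cball (fst i) (snd i)))"
      proof (rule Vitali_covering_theorem_cballs[of Q snd B fst])
        show "0 < snd i" if "i \<in> Q" for i
          using that by (auto simp: Q_def)
      qed (rule cov)
      define I where "I i = cball (fst i) (snd i)" for i :: "'a \<times> real"
      have disj: "disjoint_family_on I C"
        using C(3) unfolding I_def pairwise_def disjnt_def disjoint_family_on_def by blast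
      have Ileb: "I i \<in> sets lebesgue" for i
        by (simp add: I_def)
      have disjB: "disjoint_family_on (\<lambda>i. I i \<inter> B) C"
        using disj unfolding disjoint_family_on_def by blast
      have neg: "negligible (B - (\<Union>i\<in>C. I i))"
        using C(4) unfolding I_def .
      then have null: "B - (\<Union>i\<in>C. I i) \<in> null_sets lebesgue"
        by (simp add: negligible_iff_null_sets)
      have IU: "(\<Union>i\<in>C. I i) \<subseteq> U"
      proof
        fix x assume "x \<in> (\<Union>i\<in>C. I i)"
        then obtain i where "i \<in> Q" "x \<in> cball (fst i) (snd i)"
          using C(2) by (auto simp: I_def)
        then show "x \<in> U" by (auto simp: Q_def)
      qed
      have hole: "emeasure lebesgue (I i \<inter> B) \<le> ennreal (1 - c) * emeasure lebesgue (I i)" if iC: "i \<in> C" for i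
      proof -
        obtain x r where i: "i = (x, r)" by (cases i)
        then obtain y where y: "0 < r" "ball y (\<eta> * r / 2) \<subseteq> cball x r" "ball y (\<eta> * r / 2) \<inter> B = {}"
          using iC C(2) by (auto simp: Q_def)
        have "measure lebesgue (cball x r \<inter> B) \<le> measure lebesgue (cball x r - ball y (\<eta> * r / 2))"
          using y B by (intro measure_mono_fmeasurable) (auto simp: fmeasurableD)
        also have "\<dots> = measure lebesgue (cball x r) - measure lebesgue (ball y (\<eta> * r / 2))"
          using y by (intro measurable_measure_Diff) auto
        also have "\<dots> = (1 - c) * measure lebesgue (cball x r)"
          using y \<eta> by (simp add: content_cball_conv_ball content_ball_conv_unit_ball[of "\<eta> * r / 2"] 
              content_ball_conv_unit_ball[of r x] c_def power_mult_distrib power_divide algebra_simps)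
        finally show ?thesis
          using c B by (simp add: i I_def emeasure_eq_measure2 ennreal_mult[symmetric] fmeasurable.Int ennreal_leI)
      qed
      have "emeasure lebesgue B \<le> emeasure lebesgue ((\<Union>i\<in>C. I i \<inter> B) \<union> (B - (\<Union>i\<in>C. I i)))"
        using B null C(1) by (intro emeasure_mono) (auto simp: I_def fmeasurableD intro!: sets.Un sets.countable_UN'')
      also have "\<dots> = emeasure lebesgue (\<Union>i\<in>C. I i \<inter> B)"
        using C(1) null B by (intro emeasure_Un_null_set sets.countable_UN'') (auto simp: I_def fmeasurableD)
      also have "\<dots> = (\<integral>\<^sup>+ i. emeasure lebesgue (I i \<inter> B) \<partial>count_space C)"
        using C(1) disjB B by (intro emeasure_UN_countable) (auto simp: I_def fmeasurableD)
      also have "\<dots> \<le> (\<integral>\<^sup>+ i. ennreal (1 - c) * emeasure lebesgue (I i) \<partial>count_space C)"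
        using hole by (intro nn_integral_mono) auto
      also have "\<dots> = ennreal (1 - c) * (\<integral>\<^sup>+ i. emeasure lebesgue (I i) \<partial>count_space C)"
        by (rule nn_integral_cmult) auto
      also have "(\<integral>\<^sup>+ i. emeasure lebesgue (I i) \<partial>count_space C) = emeasure lebesgue (\<Union>i\<in>C. I i)"
        using disj C(1) Ileb by (intro emeasure_UN_countable[symmetric]) auto
      also have "ennreal (1 - c) * \<dots> \<le> ennreal (1 - c) * emeasure lebesgue U"
        using IU U by (intro mult_left_mono emeasure_mono) auto
      also have "\<dots> = ennreal ((1 - c) * measure lebesgue U)"
        using U c by (simp add: emeasure_eq_measure2 ennreal_mult)
      finally have "measure lebesgue B \<le> (1 - c) * measure lebesgue U"
        using B c by (simp add: emeasure_eq_measure2)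
      also have "\<dots> \<le> (1 - c) * (measure lebesgue B + e)"
        using mU c by (intro mult_left_mono) auto
      finally show ?thesis .
    qed
    have "measure lebesgue B = 0"
    proof (rule ccontr)
      assume "measure lebesgue B \<noteq> 0"
      then have "c * measure lebesgue B > 0" using c by (simp add: zero_less_measure_iff)
      \<comment> \<open>The excess \<open>c\<close> |B| is small enough: (1 - c)(1 + c) = 1 - c^2 <
        1.\<close>
      then have "measure lebesgue B \<le> (1 - c) * (measure lebesgue B + c * measure lebesgue B)"
        by (rule *)
      also have "\<dots> = (1 - c ^ 2) * measure lebesgue B" by (simp add: algebra_simps power2_eq_square)
      finally have "c ^ 2 * measure lebesgue B \<le> 0" by (simp add: algebra_simps)
      then show False using \<open>c * measure lebesgue B > 0\<close> c by (simp add: mult_le_0_iff zero_less_mult_iff)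
    qed
    then show ?thesis
      using B unfolding B_def[symmetric] by (simp add: negligible_iff_measure)
  qed
  then have "negligible (\<Union>n. ?Z \<inter> ball 0 (real n))" by (rule negligible_Union_nat)
  moreover have "(\<Union>n. ?Z \<inter> ball 0 (real n)) = ?Z"
    using reals_Archimedean2 by auto
  ultimately show ?thesis by simp
qed

section \<open>From coordinate directions to the full derivative\<close>

lemma differentiable_if_approx_linear:
  fixes f :: "'a::euclidean_space \<Rightarrow> real"
  assumes approx: "\<And>e. e > 0 \<Longrightarrow> \<exists>w d. d > 0 \<and> (\<forall>h. norm h < d \<longrightarrow> \<bar>f (x + h) - f x - w \<bullet> h\<bar> \<le> e * norm h)"
  shows "f differentiable (at x)"
proof -
  define e where "e k = 1 / real (Suc k)" for k
  have e0: "e k > 0" for k by (simp add: e_def)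
  have "\<forall>k. \<exists>w d. d > 0 \<and> (\<forall>h. norm h < d \<longrightarrow> \<bar>f (x + h) - f x - w \<bullet> h\<bar> \<le> e k * norm h)"
    using approx e0 by blast
  then obtain w d where d: "\<And>k. d k > 0" 
    and w: "\<And>k h. norm h < d k \<Longrightarrow> \<bar>f (x + h) - f x - w k \<bullet> h\<bar> \<le> e k * norm h"
    by metis
  \<comment> \<open>The slope \<open>w k\<close> may change with the accuracy. Testing two of them
    on one short vector along their difference shows that they differ by at most the sum of the
    accuracies; hence they form a Cauchy sequence whose limit is the gradient.\<close>
  have close: "norm (w k - w l) \<le> e k + e l" for k l
  proof (cases "w k = w l")
    case False
    define v where "v = w k - w l"
    define t where "t = min (d k) (d l) / (2 * norm v)"
    have v: "norm v > 0" using False by (simp add: v_def)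
    have t: "t > 0" using d[of k] d[of l] v by (simp add: t_def)
    have n: "norm (t *\<^sub>R v) < d k" "norm (t *\<^sub>R v) < d l"
      using d[of k] d[of l] v by (auto simp: t_def)
    have "t * (norm v * norm v) = w k \<bullet> (t *\<^sub>R v) - w l \<bullet> (t *\<^sub>R v)"
      by (simp add: v_def inner_diff_left[symmetric] right_diff_distrib[symmetric] dot_square_norm power2_eq_square)
    also have "\<dots> \<le> (e k + e l) * norm (t *\<^sub>R v)"
      using w[OF n(1)] w[OF n(2)] by (simp add: distrib_right abs_le_iff)
    also have "\<dots> = t * ((e k + e l) * norm v)" using t by simp
    finally show ?thesis using t v unfolding v_def[symmetric] by simp
  qed (use e0[of k] e0[of l] in simp)
  have e_lim: "e \<longlonglongrightarrow> 0"
    unfolding e_def using LIMSEQ_inverse_real_of_nat by (simp add: inverse_eq_divide)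
  have "Cauchy w"
  proof (rule metric_CauchyI)
    fix r :: real assume "r > 0"
    then obtain M where M: "\<And>n. n \<ge> M \<Longrightarrow> e n < r / 2"
      using order_tendstoD(2)[OF e_lim, of "r/2"] by (auto simp: eventually_sequentially)
    show "\<exists>M. \<forall>m\<ge>M. \<forall>n\<ge>M. dist (w m) (w n) < r"
    proof (intro exI allI impI)
      fix m n assume "M \<le> m" "M \<le> n"
      then show "dist (w m) (w n) < r" using close[of m n] M[of m] M[of n] by (simp add: dist_norm)
    qed
  qed
  then obtain W where W: "w \<longlonglongrightarrow> W"
    using Cauchy_convergent convergent_def by blast
  have cW: "norm (w k - W) \<le> e k" for k
  proof (rule tendsto_le[OF trivial_limit_sequentially])
    show "(\<lambda>l. e k + e l) \<longlonglongrightarrow> e k" using tendsto_add[OF tendsto_const e_lim, of "e k"] by simp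
    show "(\<lambda>l. norm (w k - w l)) \<longlonglongrightarrow> norm (w k - W)" by (intro tendsto_intros W)
  qed (use close in auto)
  have "(f has_derivative (\<lambda>h. W \<bullet> h)) (at x)"
    unfolding has_derivative_at_alt
  proof (intro conjI allI impI bounded_linear_inner_right)
    fix r :: real assume "r > 0"
    then obtain k where k: "e k < r / 2"
      using order_tendstoD(2)[OF e_lim, of "r/2"] by (auto simp: eventually_sequentially)
    show "\<exists>d>0. \<forall>y. norm (y - x) < d \<longrightarrow> norm (f y - f x - W \<bullet> (y - x)) \<le> r * norm (y - x)"
    proof (intro exI[of _ "d k"] conjI d allI impI)
      fix y assume "norm (y - x) < d k"
      then have 1: "\<bar>f y - f x - w k \<bullet> (y - x)\<bar> \<le> e k * norm (y - x)"
        using w[of "y - x" k] by simp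
      have 2: "\<bar>(w k - W) \<bullet> (y - x)\<bar> \<le> e k * norm (y - x)"
        using Cauchy_Schwarz_ineq2[of "w k - W" "y - x"] cW[of k]
        by (meson mult_right_mono norm_ge_zero order_trans)
      have "norm (f y - f x - W \<bullet> (y - x)) \<le> (e k + e k) * norm (y - x)"
        using 1 2 by (simp add: inner_diff_left distrib_right abs_le_iff)
      also have "\<dots> \<le> r * norm (y - x)" using k by (intro mult_right_mono) auto
      finally show "norm (f y - f x - W \<bullet> (y - x)) \<le> r * norm (y - x)" .
    qed
  qed
  then show ?thesis by (auto simp: differentiable_def)
qed

text \<open>Up to a null set, the space is covered by countably many closed sets on which all partial difference
  quotients are within \<open>\<epsilon>\<close> of constants \<open>c b\<close> at a uniform scale. If such a set is not porous at \<open>x\<close>,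
  then the coordinate polygon from \<open>x\<close> to \<open>x + h\<close> stays within \<open>o(\<bar>h\<bar>)\<close> of it, so that
  \<open>f (x + h) - f x\<close> is linear in \<open>h\<close> up to \<open>O(\<epsilon> \<bar>h\<bar>)\<close>.\<close>

theorem Rademacher:
  fixes f :: "'a::euclidean_space \<Rightarrow> real"
  assumes lip: "L-lipschitz_on UNIV f"
  shows "negligible {x. \<not> f differentiable (at x)}"
proof -
  have lipD: "\<bar>f x - f y\<bar> \<le> L * norm (x - y)" for x y
    using lip by (auto simp: lipschitz_on_def dist_norm)
  have L0: "L \<ge> 0" using lip by (auto simp: lipschitz_on_def)
  have contf: "continuous_on A f" for A
    using lip lipschitz_on_continuous_on continuous_on_subset by blast
  define e where "e k = 1 / real (Suc k)" for k
  have e0: "e k > 0" for k by (simp add: e_def)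
  define A where "A b c k n = {x. \<forall>s. \<bar>s\<bar> < e n \<longrightarrow> \<bar>f (x + s *\<^sub>R b) - f x - s * c\<bar> \<le> e k * \<bar>s\<bar>}" for b c k n
  have closedA: "closed (A b c k n)" for b c k n
  proof -
    have "A b c k n = (\<Inter>s\<in>{s. \<bar>s\<bar> < e n}. {x. \<bar>f (x + s *\<^sub>R b) - f x - s * c\<bar> \<le> e k * \<bar>s\<bar>})"
      by (auto simp: A_def)
    moreover have "closed {x. \<bar>f (x + s *\<^sub>R b) - f x - s * c\<bar> \<le> e k * \<bar>s\<bar>}" for s
      by (intro closed_Collect_le continuous_intros continuous_on_compose2[OF contf[of UNIV]]) auto
    ultimately show ?thesis by auto
  qed
  have monoA: "x \<in> A b c k n" if "x \<in> A b c k m" "m \<le> n" for x b c k m n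
  proof -
    have "e n \<le> e m" using that by (auto simp: e_def frac_le)
    then show ?thesis using that by (auto simp: A_def)
  qed
  \<comment> \<open>\<open>G b\<close> contains every point with a derivative along
    \<open>b\<close>; rational slopes keep the union countable, so that \<open>G b\<close> is a
    Borel set.\<close>
  define G where "G b = (\<Inter>k. \<Union>n. \<Union>c\<in>\<rat>. A b c k n)" for b
  have negG: "negligible (- G b)" for b
  proof (rule negligible_if_negligible_on_lines[where v = b])
    have "G b \<in> sets borel"
      unfolding G_def using closedA
      by (intro sets.countable_INT'' sets.countable_UN'' countable_rat) (auto intro: borel_closed)
    then show "- G b \<in> sets borel" by (simp add: borel_comp)
    fix x
    define g where "g s = f (x + s *\<^sub>R b)" for s
    have "(L * norm b)-lipschitz_on UNIV g"
      using lipD[of "x + _ *\<^sub>R b" "x + _ *\<^sub>R b"] L0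
      by (auto simp: lipschitz_on_def g_def dist_norm scaleR_diff_left[symmetric] mult_ac simp del: scaleR_left_diff_distrib)
    then have "negligible {s. \<not> g differentiable (at s)}"
      by (rule lipschitz_real_differentiable_AE)
    moreover have "x + s *\<^sub>R b \<in> G b" if gs: "g differentiable (at s)" for s
      unfolding G_def
    proof
      fix k
      obtain D where "(g has_real_derivative D) (at s)"
        using gs by (auto simp: real_differentiable_def)
      then have "\<exists>d>0. \<forall>y. norm (y - s) < d \<longrightarrow> norm (g y - g s - D * (y - s)) \<le> e k / 2 * norm (y - s)"
        using e0[of k] unfolding has_field_derivative_def has_derivative_at_alt by (meson half_gt_zero)
      then obtain d where d: "d > 0" "\<And>y. \<bar>y - s\<bar> < d \<Longrightarrow> \<bar>g y - g s - D * (y - s)\<bar> \<le> e k / 2 * \<bar>y - s\<bar>"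
        by auto
      obtain c where c: "c \<in> \<rat>" "D - e k / 2 < c" "c < D + e k / 2"
        using Rats_dense_in_real[of "D - e k / 2" "D + e k / 2"] e0[of k] by auto
      obtain n where n: "e n < d"
        using nat_approx_posE[OF d(1)] by (auto simp: e_def)
      have "x + s *\<^sub>R b \<in> A b c k n"
        unfolding A_def
      proof (intro CollectI allI impI)
        fix r assume "\<bar>r\<bar> < e n"
        then have 1: "\<bar>g (s + r) - g s - D * r\<bar> \<le> e k / 2 * \<bar>r\<bar>" using d(2)[of "s + r"] n by simp
        have 2: "\<bar>D * r - r * c\<bar> \<le> e k / 2 * \<bar>r\<bar>"
        proof -
          have "\<bar>D * r - r * c\<bar> = \<bar>D - c\<bar> * \<bar>r\<bar>" by (simp add: abs_mult[symmetric] algebra_simps)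
          also have "\<dots> \<le> e k / 2 * \<bar>r\<bar>" using c by (intro mult_right_mono) (linarith, simp)
          finally show ?thesis .
        qed
        have "\<bar>g (s + r) - g s - r * c\<bar> \<le> e k * \<bar>r\<bar>" using 1 2 by linarith
        then show "\<bar>f (x + s *\<^sub>R b + r *\<^sub>R b) - f (x + s *\<^sub>R b) - r * c\<bar> \<le> e k * \<bar>r\<bar>"
          by (simp add: g_def scaleR_left_distrib add.assoc)
      qed
      then show "x + s *\<^sub>R b \<in> (\<Union>n. \<Union>c\<in>\<rat>. A b c k n)" using c by blast
    qed
    ultimately show "negligible {s. x + s *\<^sub>R b \<in> - G b}"
      by (auto intro: negligible_subset)
  qed
  define AA where "AA c k n = (\<Inter>b\<in>Basis. A b (c b) k n)" for c :: "'a \<Rightarrow> real" and k n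
  have closedAA: "closed (AA c k n)" for c k n unfolding AA_def using closedA by auto
  \<comment> \<open>The porosity level is the accuracy \<open>e k\<close> itself, so that moving a
    vertex of the polygon to the nearest point of \<open>AA\<close> costs no more, in order, than
    the error of the difference quotient.\<close>
  define Z where "Z c k n = {x \<in> AA c k n. \<forall>d>0. \<exists>y. dist y x < d \<and> e k * dist y x < infdist y (AA c k n)}" for c k n
  have negZ: "negligible (Z c k n)" for c k n
    unfolding Z_def using closedAA e0 by (intro negligible_porous) (auto simp: e_def borel_closed)
  define CC where "CC = (PiE Basis (\<lambda>_. \<rat>) :: ('a \<Rightarrow> real) set)"
  have "countable CC" unfolding CC_def by (intro countable_PiE) (auto simp: countable_rat)
  define N where "N = (\<Union>b\<in>Basis. - G b) \<union> (\<Union>(c, k, n)\<in>CC \<times> UNIV \<times> UNIV. Z c k n)"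
  have "negligible N"
    unfolding N_def
  proof (rule negligible_Un)
    show "negligible (\<Union>b\<in>Basis. - G b)" using negG by (intro negligible_Union) auto
    show "negligible (\<Union>(c, k, n)\<in>CC \<times> UNIV \<times> UNIV. Z c k n)"
      using negZ \<open>countable CC\<close> by (intro negligible_countable_Union) auto
  qed
  moreover have "f differentiable (at x)" if "x \<notin> N" for x
  proof (rule differentiable_if_approx_linear)
    fix \<epsilon> :: real assume "\<epsilon> > 0"
    define d where "d = real DIM('a)"
    have d1: "d \<ge> 1" using DIM_positive[where 'a='a] unfolding d_def by linarith
    \<comment> \<open>There are \<open>d\<close> coordinate steps, each with error at most
      \<open>e k * norm h * (1 + 2 * L * d)\<close>: one share for the quotient at a nearest point
      \<open>y\<close> of \<open>AA\<close>, and two Lipschitz errors for moving the endpoints of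
      the step to \<open>y\<close> and its translate, at distance at most
      \<open>e k * (d * norm h)\<close>.\<close>
    define M where "M = d * (1 + 2 * L * d)"
    have M: "M > 0" using d1 L0 by (auto simp: M_def intro!: mult_pos_pos add_pos_nonneg)
    obtain k where k: "e k < \<epsilon> / M"
      using nat_approx_posE[of "\<epsilon> / M"] \<open>\<epsilon> > 0\<close> M by (auto simp: e_def)
    have "\<forall>b\<in>Basis. \<exists>n c. c \<in> \<rat> \<and> x \<in> A b c k n"
    proof
      fix b :: 'a assume "b \<in> Basis"
      then have "x \<in> G b" using \<open>x \<notin> N\<close> by (auto simp: N_def)
      then show "\<exists>n c. c \<in> \<rat> \<and> x \<in> A b c k n" unfolding G_def by blast
    qed
    then obtain nn c where nc: "\<And>b. b \<in> Basis \<Longrightarrow> c b \<in> \<rat>" "\<And>b. b \<in> Basis \<Longrightarrow> x \<in> A b (c b) k (nn b)"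
      by metis
    define n where "n = Max (nn ` Basis)"
    define c' where "c' = restrict c Basis"
    have "c' \<in> CC" using nc by (auto simp: c'_def CC_def)
    have xA: "x \<in> AA c' k n"
    proof -
      have "x \<in> A b (c' b) k n" if "b \<in> Basis" for b
        using monoA[OF nc(2)[OF that], of n] that by (simp add: c'_def n_def)
      then show ?thesis by (simp add: AA_def)
    qed
    have "x \<notin> Z c' k n" using \<open>x \<notin> N\<close> \<open>c' \<in> CC\<close> by (auto simp: N_def)
    then obtain \<delta> where \<delta>: "\<delta> > 0" "\<And>y. dist y x < \<delta> \<Longrightarrow> infdist y (AA c' k n) \<le> e k * dist y x"
      using xA unfolding Z_def mem_Collect_eq by (meson linorder_not_less)
    define w where "w = (\<Sum>b\<in>Basis. c b *\<^sub>R b)"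
    show "\<exists>w d. d > 0 \<and> (\<forall>h. norm h < d \<longrightarrow> \<bar>f (x + h) - f x - w \<bullet> h\<bar> \<le> \<epsilon> * norm h)"
    proof (intro exI[of _ w] exI[of _ "min (e n) (\<delta> / d)"] conjI allI impI)
      show "min (e n) (\<delta> / d) > 0" using e0 \<delta> d1 by auto
      fix h :: 'a assume h: "norm h < min (e n) (\<delta> / d)"
      have hd: "d * norm h < \<delta>" using h d1 by (simp add: pos_less_divide_eq mult.commute)
      have hb: "\<bar>h \<bullet> b\<bar> \<le> norm h" if "b \<in> Basis" for b using that by (rule Basis_le_norm)
      define \<kappa> where "\<kappa> = e k * norm h * (1 + 2 * L * d)"
      have step: "\<bar>f (x + (\<Sum>b\<in>I. (h \<bullet> b) *\<^sub>R b)) - f x - (\<Sum>b\<in>I. (h \<bullet> b) * c b)\<bar> \<le> real (card I) * \<kappa>"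
        if "I \<subseteq> Basis" for I
        using finite_subset[OF that finite_Basis] that
      proof (induction I rule: finite_induct)
        case (insert b I)
        define z where "z = x + (\<Sum>b\<in>I. (h \<bullet> b) *\<^sub>R b)"
        have b: "b \<in> Basis" using insert by auto
        have "norm (\<Sum>b\<in>I. (h \<bullet> b) *\<^sub>R b) \<le> (\<Sum>b\<in>I. norm h)"
          using insert hb by (intro sum_norm_le) auto
        also have "\<dots> \<le> d * norm h"
          using insert by (simp add: d_def card_mono mult_right_mono)
        finally have zx: "dist z x \<le> d * norm h" by (simp add: z_def dist_norm)
        then have "infdist z (AA c' k n) \<le> e k * dist z x" using \<delta>(2) hd by auto
        also have "\<dots> \<le> e k * (d * norm h)" using zx e0[of k] by (intro mult_left_mono) auto
        finally have inf: "infdist z (AA c' k n) \<le> e k * (d * norm h)" .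
        obtain y where y: "y \<in> AA c' k n" "infdist z (AA c' k n) = dist z y"
          using infdist_attains_inf[OF closedAA, of c' k n z] xA by blast
        have zy: "norm (z - y) \<le> e k * (d * norm h)" using inf y by (simp add: dist_norm)
        have yA: "y \<in> A b (c b) k n" using y(1) b by (auto simp: AA_def c'_def)
        have "\<bar>h \<bullet> b\<bar> < e n" using hb[OF b] h by auto
        have 1: "\<bar>f (y + (h \<bullet> b) *\<^sub>R b) - f y - (h \<bullet> b) * c b\<bar> \<le> e k * norm h"
        proof -
          have "\<bar>f (y + (h \<bullet> b) *\<^sub>R b) - f y - (h \<bullet> b) * c b\<bar> \<le> e k * \<bar>h \<bullet> b\<bar>"
            using yA \<open>\<bar>h \<bullet> b\<bar> < e n\<close> by (simp add: A_def)
          also have "\<dots> \<le> e k * norm h"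
            using hb[OF b] e0[of k] by (intro mult_left_mono) auto
          finally show ?thesis .
        qed
        have 2: "\<bar>f z - f y\<bar> \<le> L * (e k * (d * norm h))"
          using lipD[of z y] zy L0 by (meson mult_left_mono order_trans)
        have 3: "\<bar>f (z + (h \<bullet> b) *\<^sub>R b) - f (y + (h \<bullet> b) *\<^sub>R b)\<bar> \<le> L * (e k * (d * norm h))"
          using lipD[of "z + (h \<bullet> b) *\<^sub>R b" "y + (h \<bullet> b) *\<^sub>R b"] zy L0 
          by (simp, meson mult_left_mono order_trans)
        have "\<kappa> = e k * norm h + 2 * (L * (e k * (d * norm h)))" by (simp add: \<kappa>_def algebra_simps)
        then have t1: "\<bar>f (z + (h \<bullet> b) *\<^sub>R b) - f z - (h \<bullet> b) * c b\<bar> \<le> \<kappa>"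
          using 1 2 3 by linarith
        have t2: "\<bar>f z - f x - (\<Sum>b\<in>I. (h \<bullet> b) * c b)\<bar> \<le> real (card I) * \<kappa>"
          using insert by (simp add: z_def)
        have t3: "(\<Sum>b\<in>insert b I. (h \<bullet> b) * c b) = (h \<bullet> b) * c b + (\<Sum>b\<in>I. (h \<bullet> b) * c b)"
          and t4: "real (card (insert b I)) * \<kappa> = \<kappa> + real (card I) * \<kappa>"
          using insert by (simp_all add: distrib_right)
        have t5: "x + (\<Sum>b\<in>insert b I. (h \<bullet> b) *\<^sub>R b) = z + (h \<bullet> b) *\<^sub>R b"
          using insert by (simp add: z_def algebra_simps)
        show ?case unfolding t3 t4 t5 using t1 t2 by linarith
      qed simp
      have "\<bar>f (x + h) - f x - w \<bullet> h\<bar> \<le> d * \<kappa>"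
      proof -
        have "w \<bullet> h = (\<Sum>b\<in>Basis. (h \<bullet> b) * c b)"
          by (simp add: w_def inner_sum_left mult.commute inner_commute[of h])
        then show ?thesis using step[of Basis] by (simp add: euclidean_representation d_def)
      qed
      also have "\<dots> = e k * M * norm h" by (simp add: \<kappa>_def M_def)
      also have "\<dots> \<le> \<epsilon> * norm h"
        using k M by (intro mult_right_mono) (auto simp: field_simps)
      finally show "\<bar>f (x + h) - f x - w \<bullet> h\<bar> \<le> \<epsilon> * norm h" .
    qed
  qed
  ultimately show ?thesis by (auto intro: negligible_subset)
qed

section \<open>Controlled paths\<close>

text \<open>The fundamental theorem of calculus with a derivative known only almost everywhere.
  Working directly with gauges yields the integrability of \<open>f'\<close> along with the value of
  its integral.\<close>

lemma has_integral_absolutely_continuous: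
  fixes f :: "real \<Rightarrow> 'a::euclidean_space"
  assumes "a \<le> b" and ac: "absolutely_continuous_on {a..b} f" and N: "negligible N"
    and deriv: "\<And>s. s \<in> {a<..<b} - N \<Longrightarrow> (f has_vector_derivative f' s) (at s)"
  shows "(f' has_integral (f b - f a)) {a..b}"
proof -
  \<comment> \<open>The endpoints join the exceptional set because \<open>deriv\<close> speaks of
    the open interval. As \<open>F\<close> vanishes on \<open>N'\<close>, intervals tagged there
    contribute only the increments of \<open>f\<close>.\<close>
  define N' where "N' = N \<union> {a, b}"
  define F where "F s = (if s \<in> N' then 0 else f' s)" for s
  have N': "negligible N'" unfolding N'_def using N by (simp add: negligible_Un)
  have derivF: "(f has_vector_derivative F s) (at s)" if "s \<in> {a..b}" "s \<notin> N'" for s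
    using deriv[of s] that by (auto simp: F_def N'_def)
  have "(F has_integral (f b - f a)) (cbox a b)"
    unfolding has_integral
  proof (intro allI impI)
    fix e :: real assume "e > 0"
    define \<epsilon> where "\<epsilon> = e / (4 * (b - a + 1))"
    have \<epsilon>: "\<epsilon> > 0" using \<open>e > 0\<close> \<open>a \<le> b\<close> by (simp add: \<epsilon>_def)
    obtain \<delta> where \<delta>: "\<delta> > 0" "\<And>D. D division_of \<Union>D \<Longrightarrow> \<Union>D \<subseteq> {a..b} \<Longrightarrow> (\<Sum>K\<in>D. Sup K - Inf K) < \<delta> \<Longrightarrow>
        (\<Sum>K\<in>D. norm (f (Sup K) - f (Inf K))) < e / 2"
      using ac \<open>e > 0\<close> unfolding absolutely_continuous_on_def by (meson half_gt_zero)
    obtain W where W: "open W" "N' \<subseteq> W" "W \<in> lmeasurable" "measure lebesgue W < \<delta>"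
    proof -
      have N'm: "N' \<in> lmeasurable" "measure lebesgue N' = 0"
        using N' by (simp_all add: negligible_iff_measure)
      obtain U where U: "open U" "N' \<subseteq> U" "U \<in> lmeasurable" "measure lebesgue (U - N') < \<delta>" "U - N' \<in> lmeasurable"
        by (rule lmeasurable_outer_open[OF N'm(1) \<open>\<delta> > 0\<close>])
      moreover have "measure lebesgue U = measure lebesgue (U - N')"
        using U N'm measurable_measure_Diff[of U lebesgue N'] by (auto simp: fmeasurableD)
      ultimately show ?thesis using that by auto
    qed
    have "\<exists>d>0. \<forall>y. norm (y - s) < d \<longrightarrow> norm (f y - f s - (y - s) *\<^sub>R F s) \<le> \<epsilon> * norm (y - s)"
      if "s \<in> {a..b}" "s \<notin> N'" for s
      using derivF[OF that] \<epsilon> unfolding has_vector_derivative_def has_derivative_at_alt by blast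
    then obtain d where d: "\<And>s. s \<in> {a..b} \<Longrightarrow> s \<notin> N' \<Longrightarrow> d s > 0" 
      "\<And>s y. s \<in> {a..b} \<Longrightarrow> s \<notin> N' \<Longrightarrow> \<bar>y - s\<bar> < d s \<Longrightarrow> norm (f y - f s - (y - s) *\<^sub>R F s) \<le> \<epsilon> * \<bar>y - s\<bar>"
      by (metis real_norm_def)
    have "\<exists>r>0. ball s r \<subseteq> W" if "s \<in> N'" for s
      using W that by (meson open_contains_ball subsetD)
    then obtain r where r: "\<And>s. s \<in> N' \<Longrightarrow> r s > 0" "\<And>s. s \<in> N' \<Longrightarrow> ball s (r s) \<subseteq> W" by metis
  \<comment> \<open>Tags outside \<open>N'\<close> obey the straddle estimate; the intervals tagged in \<open>N'\<close> lie in the small open set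
      \<open>W\<close>, where absolute continuity applies.\<close>
    define \<gamma> where "\<gamma> s = (if s \<in> N' then ball s (r s) else if s \<in> {a..b} then ball s (d s) else ball s 1)" for s
    show "\<exists>\<gamma>. gauge \<gamma> \<and> (\<forall>p. p tagged_division_of cbox a b \<and> \<gamma> fine p \<longrightarrow>
              norm ((\<Sum>(x, k)\<in>p. measure lborel k *\<^sub>R F x) - (f b - f a)) < e)"
    proof (intro exI[of _ \<gamma>] conjI allI impI)
      show "gauge \<gamma>" unfolding gauge_def \<gamma>_def using r d by auto
      fix p assume "p tagged_division_of cbox a b \<and> \<gamma> fine p"
      then have p: "p tagged_division_of {a..b}" and fine: "\<gamma> fine p" by auto
      note pD = tagged_division_ofD[OF p]
      have iv: "\<exists>u v. K = {u..v} \<and> u \<le> s \<and> s \<le> v \<and> a \<le> u \<and> v \<le> b" if sK: "(s, K) \<in> p" for s K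
      proof -
        obtain u v where "K = cbox u v" using pD(4)[OF sK] by blast
        with pD(2,3)[OF sK] show ?thesis by (intro exI[of _ u] exI[of _ v]) auto
      qed
      have tele: "(\<Sum>(x, K)\<in>p. f (Sup K) - f (Inf K)) = f b - f a"
        using additive_tagged_division_1[OF \<open>a \<le> b\<close> p] .
      define p1 where "p1 = {z \<in> p. fst z \<notin> N'}"
      define p2 where "p2 = {z \<in> p. fst z \<in> N'}"
      have fin: "finite p" "finite p1" "finite p2" using pD(1) by (auto simp: p1_def p2_def)
      have pU: "p = p1 \<union> p2" "p1 \<inter> p2 = {}" by (auto simp: p1_def p2_def)
      have b1: "norm (\<Sum>(x, K)\<in>p1. measure lborel K *\<^sub>R F x - (f (Sup K) - f (Inf K))) \<le> e / 4"
      proof -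
        have "norm (\<Sum>(x, K)\<in>p1. measure lborel K *\<^sub>R F x - (f (Sup K) - f (Inf K))) \<le> (\<Sum>(x, K)\<in>p1. \<epsilon> * measure lborel K)"
        proof (rule sum_norm_le, clarify)
          fix s K assume sK: "(s, K) \<in> p1"
          then have s: "(s, K) \<in> p" "s \<notin> N'" by (auto simp: p1_def)
          obtain u v where uv: "K = {u..v}" "u \<le> s" "s \<le> v" "a \<le> u" "v \<le> b" using iv[OF s(1)] by blast
          have sab: "s \<in> {a..b}" using uv by auto
          have "K \<subseteq> ball s (d s)" using fineD[OF fine s(1)] s(2) sab by (simp add: \<gamma>_def)
          moreover have "u \<in> K" "v \<in> K" using uv by auto
          ultimately have "\<bar>u - s\<bar> < d s" "\<bar>v - s\<bar> < d s" by (auto simp: subset_iff dist_real_def abs_minus_commute)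
          then have "norm (f u - f s - (u - s) *\<^sub>R F s) \<le> \<epsilon> * (s - u)" "norm (f v - f s - (v - s) *\<^sub>R F s) \<le> \<epsilon> * (v - s)"
            using d(2)[OF sab s(2), of u] d(2)[OF sab s(2), of v] uv by (simp_all add: abs_of_nonneg abs_of_nonpos)
          then have "norm ((f u - f s - (u - s) *\<^sub>R F s) - (f v - f s - (v - s) *\<^sub>R F s)) \<le> \<epsilon> * (s - u) + \<epsilon> * (v - s)"
            by (meson add_mono norm_triangle_ineq4 order_trans)
          also have "(f u - f s - (u - s) *\<^sub>R F s) - (f v - f s - (v - s) *\<^sub>R F s) = (v - u) *\<^sub>R F s - (f v - f u)"
            by (simp add: algebra_simps)
          finally show "norm (measure lborel K *\<^sub>R F s - (f (Sup K) - f (Inf K))) \<le> \<epsilon> * measure lborel K"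
            using uv by (simp add: algebra_simps)
        qed
        also have "\<dots> \<le> (\<Sum>(x, K)\<in>p. \<epsilon> * measure lborel K)"
          using fin \<epsilon> by (intro sum_mono2) (auto simp: p1_def)
        also have "\<dots> = \<epsilon> * (b - a)"
          using additive_content_tagged_division[of p a b] p \<open>a \<le> b\<close> by (simp add: sum_distrib_left[symmetric] case_prod_unfold)
        also have "\<dots> \<le> e / 4"
        proof -
          have "(b - a) / (b - a + 1) \<le> 1" using \<open>a \<le> b\<close> by simp
          then have "e / 4 * ((b - a) / (b - a + 1)) \<le> e / 4" using \<open>e > 0\<close> by (intro mult_left_le) auto
          then show ?thesis by (simp add: \<epsilon>_def)
        qed
        finally show ?thesis .
      qed
      have b2: "norm (\<Sum>(x, K)\<in>p2. measure lborel K *\<^sub>R F x - (f (Sup K) - f (Inf K))) < e / 2"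
      proof -
        define D where "D = snd ` p2"
        have Dp: "p2 tagged_partial_division_of {a..b}"
          using p by (metis (no_types, lifting) p2_def mem_Collect_eq subsetI tagged_division_of_def tagged_partial_division_subset)
        then have D: "D division_of \<Union>D"
          using partial_division_of_tagged_division[OF Dp] by (simp add: D_def)
        have Dab: "\<Union>D \<subseteq> {a..b}" using pD(3) by (force simp: D_def p2_def)
        have DW: "\<Union>D \<subseteq> W"
          using fine r by (fastforce simp: D_def p2_def fine_def \<gamma>_def)
        have "(\<Sum>K\<in>D. Sup K - Inf K) = (\<Sum>K\<in>D. measure lebesgue K)"
        proof (rule sum.cong[OF refl])
          fix K assume "K \<in> D"
          then obtain s where "(s, K) \<in> p" by (auto simp: D_def p2_def)
          then obtain u v where "K = {u..v}" "u \<le> v" using iv order_trans by blast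
          then show "Sup K - Inf K = measure lebesgue K" by simp
        qed
        also have "\<dots> = measure lebesgue (\<Union>D)"
          using content_division[OF D] by simp
        also have "\<dots> \<le> measure lebesgue W"
          using DW W(3) fmeasurableD[OF lmeasurable_division[OF D]] by (intro measure_mono_fmeasurable)
        also have "\<dots> < \<delta>" using W by simp
        finally have "(\<Sum>K\<in>D. norm (f (Sup K) - f (Inf K))) < e / 2"
          using \<delta>(2)[OF D Dab] by simp
        moreover have "norm (\<Sum>(x, K)\<in>p2. measure lborel K *\<^sub>R F x - (f (Sup K) - f (Inf K))) \<le> (\<Sum>(x, K)\<in>p2. norm (f (Sup K) - f (Inf K)))"
          by (rule sum_norm_le) (auto simp: p2_def F_def norm_minus_commute)
        moreover have "(\<Sum>(x, K)\<in>p2. norm (f (Sup K) - f (Inf K))) = (\<Sum>K\<in>D. norm (f (Sup K) - f (Inf K)))"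
        proof -
          \<comment> \<open>Two tags can share an interval only if it is degenerate, and then the
            increment of \<open>f\<close> is 0; so the sum over tags is a sum over intervals. The
            value 0 at the empty set covers the case \<open>v < u\<close> of
            \<open>cbox u v\<close>.\<close>
          define g where "g K = (if K = {} then 0 else norm (f (Sup K) - f (Inf K)))" for K :: "real set"
          have "(\<Sum>(_, K)\<in>p2. g K) = (\<Sum>K\<in>snd ` p2. g K)"
          proof (rule sum.over_tagged_division_lemma[OF tagged_partial_division_of_Union_self[OF Dp]])
            show "g (cbox u v) = 0" if "box u v = {}" for u v
              using that by (auto simp: g_def box_eq_empty)
          qed
          moreover have ne: "K \<noteq> {}" if "(s, K) \<in> p2" for s K
            using that pD(2) by (auto simp: p2_def)
          have "(\<Sum>(x, K)\<in>p2. norm (f (Sup K) - f (Inf K))) = (\<Sum>(_, K)\<in>p2. g K)"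
            using ne by (intro sum.cong) (auto simp: g_def)
          moreover have "(\<Sum>K\<in>D. norm (f (Sup K) - f (Inf K))) = (\<Sum>K\<in>D. g K)"
            using ne by (intro sum.cong) (auto simp: g_def D_def)
          ultimately show ?thesis unfolding D_def by simp
        qed
        ultimately show ?thesis by simp
      qed
      have "(\<Sum>(x, k)\<in>p. measure lborel k *\<^sub>R F x) - (f b - f a) = (\<Sum>(x, K)\<in>p. measure lborel K *\<^sub>R F x - (f (Sup K) - f (Inf K)))"
        unfolding tele[symmetric] by (simp add: sum_subtractf case_prod_unfold)
      also have "\<dots> = (\<Sum>(x, K)\<in>p1. measure lborel K *\<^sub>R F x - (f (Sup K) - f (Inf K))) + (\<Sum>(x, K)\<in>p2. measure lborel K *\<^sub>R F x - (f (Sup K) - f (Inf K)))"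
        using pU fin by (simp add: sum.union_disjoint)
      finally have "norm ((\<Sum>(x, k)\<in>p. measure lborel k *\<^sub>R F x) - (f b - f a)) \<le> 
          norm (\<Sum>(x, K)\<in>p1. measure lborel K *\<^sub>R F x - (f (Sup K) - f (Inf K))) + norm (\<Sum>(x, K)\<in>p2. measure lborel K *\<^sub>R F x - (f (Sup K) - f (Inf K)))"
        by (simp only: norm_triangle_ineq)
      also have "\<dots> < e / 4 + e / 2" using b1 b2 by (rule add_le_less_mono)
      also have "\<dots> \<le> e" using \<open>e > 0\<close> by simp
      finally show "norm ((\<Sum>(x, k)\<in>p. measure lborel k *\<^sub>R F x) - (f b - f a)) < e" .
    qed
  qed
  then show ?thesis
    using N' by (intro has_integral_spike[OF N', of _ f' F]) (auto simp: F_def)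
qed

section \<open>The matrix \<open>E\<close> and its square root\<close>

lemma sqrt_psd_2x2_unique:
  fixes B :: "real^2^2"
  assumes psd: "sym_psd B" and sq: "B ** B = (\<chi> i j. if i = j then 1 else e)" and e: "0 < e" "e \<le> 1"
  shows "B = (\<chi> i j. if i = j then (sqrt (1 + e) + sqrt (1 - e)) / 2 else (sqrt (1 + e) - sqrt (1 - e)) / 2)"
proof -
  define p r s where "p = B $ 1 $ 1" and "r = B $ 1 $ 2" and "s = B $ 2 $ 2"
  have B21: "B $ 2 $ 1 = r"
    using psd by (auto simp: sym_psd_def transpose_def vec_eq_iff r_def)
  have q: "0 \<le> v $ 1 * (p * v $ 1 + r * v $ 2) + v $ 2 * (r * v $ 1 + s * v $ 2)" for v :: "real^2"
    using psd unfolding sym_psd_def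
    by (simp add: inner_vec_def matrix_vector_mult_def sum_2 B21 p_def[symmetric] r_def[symmetric] s_def[symmetric])
  have eqs: "p * p + r * r = 1" "r * r + s * s = 1" "p * r + r * s = e"
    using arg_cong[OF sq, of "\<lambda>A. A $ 1 $ 1"] arg_cong[OF sq, of "\<lambda>A. A $ 2 $ 2"] arg_cong[OF sq, of "\<lambda>A. A $ 1 $ 2"]
    by (simp_all add: matrix_matrix_mult_def sum_2 B21 p_def[symmetric] r_def[symmetric] s_def[symmetric])
  have "p \<ge> 0" "s \<ge> 0" using q[of "vector [1, 0]"] q[of "vector [0, 1]"] by simp_all
  \<comment> \<open>Equal diagonal entries of the square force \<open>p = s\<close>. Then (1, 1) and
    (1, -1) are eigenvectors of \<open>B\<close>, and the nonnegative eigenvalues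
    \<open>p + r\<close> and \<open>p - r\<close> are determined by their squares.\<close>
  have "p^2 = s^2" using eqs by (simp add: power2_eq_square)
  then have ps: "p = s" using \<open>p \<ge> 0\<close> \<open>s \<ge> 0\<close> by simp
  have pr: "p + r \<ge> 0" "p - r \<ge> 0"
    using q[of "vector [1, 1]"] q[of "vector [1, -1]"] ps by simp_all
  have "(p + r)^2 = 1 + e" "(p - r)^2 = 1 - e"
    using eqs ps by (simp_all add: power2_eq_square algebra_simps)
  then have "p + r = sqrt (1 + e)" "p - r = sqrt (1 - e)"
    using pr by (metis real_sqrt_unique)+
  then have "p = (sqrt (1 + e) + sqrt (1 - e)) / 2" "r = (sqrt (1 + e) - sqrt (1 - e)) / 2"
    by (simp_all add: field_simps)
  then show ?thesis
    using ps B21 by (simp add: vec_eq_iff forall_2 p_def r_def s_def)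
qed

definition offdiag :: "real^2 \<Rightarrow> real" where "offdiag x = exp (- \<bar>x $ 1 - x $ 2\<bar>)"

lemma offdiag: "0 < offdiag x" "offdiag x \<le> 1" by (auto simp: offdiag_def)

lemma E_eq: "E x = (\<chi> i j. if i = j then 1 else offdiag x)"
  by (simp add: E_def offdiag_def vec_eq_iff forall_2 abs_minus_commute)

lemma mat_sqrt_E:
  "mat_sqrt (E x) = (\<chi> i j. if i = j then (sqrt (1 + offdiag x) + sqrt (1 - offdiag x)) / 2 else (sqrt (1 + offdiag x) - sqrt (1 - offdiag x)) / 2)"
  (is "_ = ?B")
  unfolding mat_sqrt_def
proof (rule the_equality)
  define a b where "a = sqrt (1 + offdiag x)" and "b = sqrt (1 - offdiag x)"
  have a: "a * a = 1 + offdiag x" "0 \<le> a" and b: "b * b = 1 - offdiag x" "0 \<le> b"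
    using offdiag[of x] by (auto simp: a_def b_def)
  have "0 \<le> v \<bullet> (?B *v v)" for v
  proof -
    have "v \<bullet> (?B *v v) = (a * (v $ 1 + v $ 2)^2 + b * (v $ 1 - v $ 2)^2) / 2"
      by (simp add: inner_vec_def matrix_vector_mult_def sum_2 a_def[symmetric] b_def[symmetric] field_simps power2_eq_square)
    then show ?thesis using a(2) b(2) by (metis add_nonneg_nonneg divide_nonneg_pos mult_nonneg_nonneg zero_le_power2 zero_less_numeral)
  qed
  moreover have "transpose ?B = ?B" by (auto simp: transpose_def vec_eq_iff)
  moreover have "?B ** ?B = E x"
    unfolding E_eq a_def[symmetric] b_def[symmetric] using a(1) b(1)
    by (simp add: matrix_matrix_mult_def sum_2 vec_eq_iff forall_2 field_simps)
  ultimately show "sym_psd ?B \<and> ?B ** ?B = E x" unfolding sym_psd_def by blast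
next
  fix B assume "sym_psd B \<and> B ** B = E x"
  then show "B = ?B" using sqrt_psd_2x2_unique[of B "offdiag x"] offdiag[of x] by (simp add: E_eq)
qed

abbreviation sqrtE :: "real^2 \<Rightarrow> real^2^2" where "sqrtE x \<equiv> mat_sqrt (E x)"

lemma sqrtE_components:
  "(sqrtE x *v w) $ 1 + (sqrtE x *v w) $ 2 = sqrt (1 + offdiag x) * (w $ 1 + w $ 2)"
  "(sqrtE x *v w) $ 1 - (sqrtE x *v w) $ 2 = sqrt (1 - offdiag x) * (w $ 1 - w $ 2)"
  by (simp_all add: mat_sqrt_E matrix_vector_mult_def sum_2 field_simps)

lemma vec2_eqI:
  fixes v w :: "real^2"
  assumes "v $ 1 + v $ 2 = w $ 1 + w $ 2" "v $ 1 - v $ 2 = w $ 1 - w $ 2"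
  shows "v = w"
  using assms by (simp add: vec_eq_iff forall_2)

lemma inner_sum_diff:
  fixes v w :: "real^2"
  shows "v \<bullet> w = ((v $ 1 + v $ 2) * (w $ 1 + w $ 2) + (v $ 1 - v $ 2) * (w $ 1 - w $ 2)) / 2"
  by (simp add: inner_vec_def sum_2 field_simps)

lemma norm_sum_diff:
  fixes v :: "real^2"
  shows "(norm v)\<^sup>2 = ((v $ 1 + v $ 2)\<^sup>2 + (v $ 1 - v $ 2)\<^sup>2) / 2"
  unfolding dot_square_norm[symmetric] inner_sum_diff by (simp add: power2_eq_square)

lemma E_components:
  "(E x *v w) $ 1 + (E x *v w) $ 2 = (1 + offdiag x) * (w $ 1 + w $ 2)"
  "(E x *v w) $ 1 - (E x *v w) $ 2 = (1 - offdiag x) * (w $ 1 - w $ 2)"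
  by (simp_all add: E_eq matrix_vector_mult_def sum_2 field_simps)

lemma sqrtE_selfadjoint: "(sqrtE x *v w) \<bullet> z = w \<bullet> (sqrtE x *v z)"
  by (simp add: inner_sum_diff sqrtE_components)

lemma sqrtE_sqrtE: "sqrtE x *v (sqrtE x *v w) = E x *v w"
  using offdiag[of x] by (intro vec2_eqI) (simp_all add: sqrtE_components E_components mult.assoc[symmetric])

lemma norm_sqrtE_mult: "(norm (sqrtE x *v w))\<^sup>2 = (E x *v w) \<bullet> w"
  by (simp add: dot_square_norm[symmetric] sqrtE_selfadjoint sqrtE_sqrtE inner_commute)

lemma norm_sqrtE_le: "norm (sqrtE x *v w) \<le> sqrt 2 * norm w"
proof -
  have "(norm (sqrtE x *v w))\<^sup>2 \<le> 2 * (norm w)\<^sup>2"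
  proof -
    have "(1 + offdiag x) * p\<^sup>2 \<le> 2 * p\<^sup>2" "(1 - offdiag x) * p\<^sup>2 \<le> 2 * p\<^sup>2" for p :: real
      using offdiag[of x] by (intro mult_right_mono; simp)+
    from this(1)[of "w $ 1 + w $ 2"] this(2)[of "w $ 1 - w $ 2"] show ?thesis
      unfolding norm_sum_diff sqrtE_components power_mult_distrib using offdiag[of x] by simp
  qed
  then have "norm (sqrtE x *v w) \<le> sqrt (2 * (norm w)\<^sup>2)" by (rule real_le_rsqrt)
  then show ?thesis by (simp add: real_sqrt_mult)
qed

lemma continuous_offdiag: "continuous_on A offdiag"
  unfolding offdiag_def
  by (intro continuous_on_exp continuous_on_minus continuous_on_rabs continuous_on_diff continuous_on_component continuous_on_id)

lemma continuous_E_quadratic: "continuous_on A (\<lambda>x. (E x *v w) \<bullet> w)"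
proof -
  define p q where "p = (w $ 1 + w $ 2)\<^sup>2 / 2" and "q = (w $ 1 - w $ 2)\<^sup>2 / 2"
  have "(E x *v w) \<bullet> w = (1 + offdiag x) * p + (1 - offdiag x) * q" for x
    unfolding inner_sum_diff E_components by (simp add: p_def q_def power2_eq_square field_simps)
  then show ?thesis
    by (simp, intro continuous_on_add continuous_on_mult continuous_on_diff continuous_on_const continuous_offdiag)
qed

section \<open>Trajectories of finite energy\<close>

text \<open>Controlled paths of finite energy. With the state equation in integrated form, restriction, translation
  and concatenation need no argument about absolute continuity.\<close>

definition trajectory :: "real \<Rightarrow> real \<Rightarrow> (real \<Rightarrow> real^2) \<Rightarrow> (real \<Rightarrow> real^2) \<Rightarrow> bool" where
  "trajectory a b \<alpha> x \<longleftrightarrow>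
     \<alpha> integrable_on {a..b} \<and> (\<lambda>s. (norm (\<alpha> s))\<^sup>2) integrable_on {a..b} \<and>
     (\<forall>s\<in>{a..b}. ((\<lambda>r. sqrtE (x r) *v \<alpha> r) has_integral (x s - x a)) {a..s}) \<and>
     (\<exists>N. negligible N \<and> (\<forall>s\<in>{a<..<b} - N. (x has_vector_derivative sqrtE (x s) *v \<alpha> s) (at s)))"

definition energy :: "real \<Rightarrow> real \<Rightarrow> (real \<Rightarrow> real^2) \<Rightarrow> real" where
  "energy a b \<alpha> = integral {a..b} (\<lambda>s. (norm (\<alpha> s))\<^sup>2)"

lemma energy_nonneg: "energy a b \<alpha> \<ge> 0"
proof (cases "(\<lambda>s. (norm (\<alpha> s))\<^sup>2) integrable_on {a..b}")
  case True
  then show ?thesis unfolding energy_def by (rule integral_nonneg) simp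
next
  case False
  then show ?thesis by (simp add: energy_def not_integrable_integral)
qed

lemma energy_combine:
  assumes "trajectory a c \<alpha> x" "a \<le> b" "b \<le> c"
  shows "energy a c \<alpha> = energy a b \<alpha> + energy b c \<alpha>"
  using Henstock_Kurzweil_Integration.integral_combine[OF assms(2,3), of "\<lambda>s. (norm (\<alpha> s))\<^sup>2"] assms(1)
  unfolding energy_def trajectory_def by simp

lemma trajectory_subinterval:
  assumes tr: "trajectory a b \<alpha> x" and "a \<le> c" "c \<le> d" "d \<le> b"
  shows "trajectory c d \<alpha> x"
proof -
  let ?f = "\<lambda>r. sqrtE (x r) *v \<alpha> r"
  have sub: "{c..d} \<subseteq> {a..b}" using assms by auto
  have "(?f has_integral (x s - x c)) {c..s}" if "s \<in> {c..d}" for s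
  proof -
    have 1: "(?f has_integral (x s - x a)) {a..s}" "(?f has_integral (x c - x a)) {a..c}"
      using tr that assms unfolding trajectory_def by auto
    then have int: "?f integrable_on {a..s}" by blast
    then have "integral {a..c} ?f + integral {c..s} ?f = integral {a..s} ?f"
      using that assms by (intro Henstock_Kurzweil_Integration.integral_combine) auto
    then have "integral {c..s} ?f = x s - x c" using 1 by (simp add: integral_unique algebra_simps)
    moreover have "?f integrable_on {c..s}"
      using int that assms by (intro integrable_subinterval_real[OF int]) auto
    ultimately show ?thesis by (metis integrable_integral)
  qed
  moreover have "\<exists>N. negligible N \<and> (\<forall>s\<in>{c<..<d} - N. (x has_vector_derivative ?f s) (at s))"
    using tr assms unfolding trajectory_def by force
  ultimately show ?thesis
    using tr sub unfolding trajectory_def by (auto intro: integrable_subinterval_real)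
qed

lemma has_integral_shift_real:
  fixes f :: "real \<Rightarrow> 'a::real_normed_vector"
  assumes "(f has_integral i) {a..b}"
  shows "((\<lambda>s. f (s - c)) has_integral i) {a + c..b + c}"
  using has_integral_affinity'[of f i a b 1 "-c"] assms by simp

lemma trajectory_shift:
  assumes tr: "trajectory a b \<alpha> x"
  shows "trajectory (a + c) (b + c) (\<lambda>s. \<alpha> (s - c)) (\<lambda>s. x (s - c))"
proof -
  have "((\<lambda>r. sqrtE (x (r - c)) *v \<alpha> (r - c)) has_integral (x (s - c) - x (a + c - c))) {a + c..s}"
    if "s \<in> {a + c..b + c}" for s
  proof -
    have "((\<lambda>r. sqrtE (x r) *v \<alpha> r) has_integral (x (s - c) - x a)) {a..s - c}"
      using tr that unfolding trajectory_def by auto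
    from has_integral_shift_real[OF this, of c] show ?thesis by simp
  qed
  moreover obtain N where N: "negligible N" "\<And>s. s \<in> {a<..<b} - N \<Longrightarrow> (x has_vector_derivative sqrtE (x s) *v \<alpha> s) (at s)"
    using tr unfolding trajectory_def by blast
  have "((\<lambda>s. x (s - c)) has_vector_derivative sqrtE (x (s - c)) *v \<alpha> (s - c)) (at s)" 
    if "s \<in> {a + c<..<b + c} - ((+) c) ` N" for s
  proof -
    have "s - c \<notin> N" using that by (auto simp: image_iff)
    then have "(x has_vector_derivative sqrtE (x (s - c)) *v \<alpha> (s - c)) (at (s - c))"
      using that by (intro N) auto
    then have "((x \<circ> (\<lambda>s. s - c)) has_vector_derivative 1 *\<^sub>R (sqrtE (x (s - c)) *v \<alpha> (s - c))) (at s)"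
      by (intro vector_diff_chain_at) (auto intro!: derivative_eq_intros)
    then show ?thesis by (simp add: o_def)
  qed
  moreover have "negligible (((+) c) ` N)" using N(1) by (rule negligible_translation)
  moreover have "(\<lambda>s. \<alpha> (s - c)) integrable_on {a + c..b + c}" "(\<lambda>s. (norm (\<alpha> (s - c)))\<^sup>2) integrable_on {a + c..b + c}"
  proof -
    show "(\<lambda>s. \<alpha> (s - c)) integrable_on {a + c..b + c}"
      using tr has_integral_shift_real[of \<alpha> _ a b c] unfolding trajectory_def integrable_on_def by metis
    show "(\<lambda>s. (norm (\<alpha> (s - c)))\<^sup>2) integrable_on {a + c..b + c}"
      using tr has_integral_shift_real[of "\<lambda>s. (norm (\<alpha> s))\<^sup>2" _ a b c] unfolding trajectory_def integrable_on_def by metis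
  qed
  ultimately show ?thesis unfolding trajectory_def by blast
qed

lemma energy_shift: "trajectory a b \<alpha> x \<Longrightarrow> energy (a + c) (b + c) (\<lambda>s. \<alpha> (s - c)) = energy a b \<alpha>"
  unfolding energy_def trajectory_def
  by (intro integral_unique has_integral_shift_real integrable_integral) auto

lemma trajectory_concat:
  assumes tr1: "trajectory a b \<alpha> x" and tr2: "trajectory b c \<beta> y" and "x b = y b" "a \<le> b" "b \<le> c"
  shows "trajectory a c (\<lambda>s. if s \<le> b then \<alpha> s else \<beta> s) (\<lambda>s. if s \<le> b then x s else y s)"
    and "energy a c (\<lambda>s. if s \<le> b then \<alpha> s else \<beta> s) = energy a b \<alpha> + energy b c \<beta>"
proof -
  let ?\<gamma> = "\<lambda>s. if s \<le> b then \<alpha> s else \<beta> s" and ?z = "\<lambda>s. if s \<le> b then x s else y s"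
  have glue: "((\<lambda>s. if s \<le> b then f s else g s) has_integral i + j) {a..s}"
    if "(f has_integral i) {a..b}" "(g has_integral j) {b..s}" "b \<le> s" 
    for f g :: "real \<Rightarrow> 'b::banach" and i j s
  proof (rule has_integral_combine[where c = b])
    show "((\<lambda>s. if s \<le> b then f s else g s) has_integral i) {a..b}"
      using that(1) by (rule has_integral_eq[rotated]) auto
    show "((\<lambda>s. if s \<le> b then f s else g s) has_integral j) {b..s}"
      using that(2) by (rule has_integral_spike_finite[of "{b}", rotated 2]) auto
  qed (use that assms in auto)
  have left: "((\<lambda>s. if s \<le> b then f s else g s) has_integral i) {a..s}"
    if "(f has_integral i) {a..s}" "s \<le> b" for f g :: "real \<Rightarrow> 'b::banach" and i s
    using that(2) by (intro has_integral_eq[OF _ that(1)]) simp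
  have i\<gamma>: "(?\<gamma> has_integral (integral {a..b} \<alpha> + integral {b..c} \<beta>)) {a..c}"
    using tr1 tr2 assms unfolding trajectory_def by (intro glue integrable_integral) auto
  have "((\<lambda>s. if s \<le> b then (norm (\<alpha> s))\<^sup>2 else (norm (\<beta> s))\<^sup>2) has_integral energy a b \<alpha> + energy b c \<beta>) {a..c}"
    using tr1 tr2 assms unfolding trajectory_def energy_def by (intro glue integrable_integral) auto
  moreover have "(\<lambda>s. if s \<le> b then (norm (\<alpha> s))\<^sup>2 else (norm (\<beta> s))\<^sup>2) = (\<lambda>s. (norm (?\<gamma> s))\<^sup>2)" by auto
  ultimately have e\<gamma>: "((\<lambda>s. (norm (?\<gamma> s))\<^sup>2) has_integral energy a b \<alpha> + energy b c \<beta>) {a..c}" by simp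
  then show "energy a c ?\<gamma> = energy a b \<alpha> + energy b c \<beta>"
    by (simp add: energy_def integral_unique)
  have feq: "(\<lambda>r. sqrtE (?z r) *v ?\<gamma> r) = (\<lambda>r. if r \<le> b then sqrtE (x r) *v \<alpha> r else sqrtE (y r) *v \<beta> r)" by auto
  have i: "((\<lambda>r. sqrtE (?z r) *v ?\<gamma> r) has_integral (?z s - ?z a)) {a..s}" if s: "s \<in> {a..c}" for s
  proof (cases "s \<le> b")
    case True
    then have "((\<lambda>r. sqrtE (x r) *v \<alpha> r) has_integral (x s - x a)) {a..s}"
      using tr1 s unfolding trajectory_def by auto
    then show ?thesis unfolding feq using True s by (auto intro!: left)
  next
    case False
    have "((\<lambda>r. sqrtE (x r) *v \<alpha> r) has_integral (x b - x a)) {a..b}"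
      using tr1 \<open>a \<le> b\<close> unfolding trajectory_def by auto
    moreover have "((\<lambda>r. sqrtE (y r) *v \<beta> r) has_integral (y s - y b)) {b..s}"
      using tr2 s False unfolding trajectory_def by auto
    ultimately have "((\<lambda>r. sqrtE (?z r) *v ?\<gamma> r) has_integral ((x b - x a) + (y s - y b))) {a..s}"
      unfolding feq using False by (intro glue) auto
    then show ?thesis using False assms by simp
  qed
  obtain N1 where N1: "negligible N1" "\<And>s. s \<in> {a<..<b} - N1 \<Longrightarrow> (x has_vector_derivative sqrtE (x s) *v \<alpha> s) (at s)"
    using tr1 unfolding trajectory_def by blast
  obtain N2 where N2: "negligible N2" "\<And>s. s \<in> {b<..<c} - N2 \<Longrightarrow> (y has_vector_derivative sqrtE (y s) *v \<beta> s) (at s)"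
    using tr2 unfolding trajectory_def by blast
  have "(?z has_vector_derivative sqrtE (?z s) *v ?\<gamma> s) (at s)" if "s \<in> {a<..<c} - (insert b (N1 \<union> N2))" for s
  proof (cases "s < b")
    case True
    then have "(x has_vector_derivative sqrtE (x s) *v \<alpha> s) (at s)" using that by (intro N1) auto
    then have "(?z has_vector_derivative sqrtE (x s) *v \<alpha> s) (at s)"
      using True by (elim has_vector_derivative_transform_within_open[of _ _ _ "{..<b}"]) auto
    then show ?thesis using True by simp
  next
    case False
    then have "s > b" using that by auto
    then have "(y has_vector_derivative sqrtE (y s) *v \<beta> s) (at s)" using that by (intro N2) auto
    then have "(?z has_vector_derivative sqrtE (y s) *v \<beta> s) (at s)"
      using \<open>s > b\<close> by (elim has_vector_derivative_transform_within_open[of _ _ _ "{b<..}"]) auto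
    then show ?thesis using \<open>s > b\<close> by simp
  qed
  moreover have "negligible (insert b (N1 \<union> N2))" using N1 N2 by simp
  ultimately show "trajectory a c ?\<gamma> ?z"
    unfolding trajectory_def
    using i has_integral_integrable[OF i\<gamma>] has_integral_integrable[OF e\<gamma>]
    by (intro conjI ballI exI[of _ "insert b (N1 \<union> N2)"])
qed

lemma trajectory_const: "trajectory a b (\<lambda>_. 0) (\<lambda>_. y)"
  unfolding trajectory_def by (intro conjI exI[of _ "{}"]) (simp_all add: integrable_0 matrix_vector_mult_0_right)

lemma energy_const: "energy a b (\<lambda>_. 0) = 0"
  by (simp add: energy_def)

lemma norm_le_quadratic: 
  fixes v :: "'a::real_normed_vector"
  assumes "\<eta> > 0" shows "norm v \<le> \<eta> / 2 * (norm v)\<^sup>2 + 1 / (2 * \<eta>)"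
proof -
  have "0 \<le> (\<eta> * norm v - 1)\<^sup>2 / (2 * \<eta>)" using assms by simp
  then show ?thesis using assms by (simp add: power2_eq_square field_simps)
qed

text \<open>An AM-GM substitute for the Cauchy-Schwarz bound \<open>sqrt (2 (b - a) energy)\<close>; \<open>\<eta>\<close> is optimised at each use.\<close>

lemma trajectory_displacement:
  assumes tr: "trajectory a b \<alpha> x" and "a \<le> b" "\<eta> > 0"
  shows "norm (x b - x a) \<le> sqrt 2 * (\<eta> / 2 * energy a b \<alpha> + (b - a) / (2 * \<eta>))"
proof -
  let ?f = "\<lambda>r. sqrtE (x r) *v \<alpha> r" and ?g = "\<lambda>r. sqrt 2 * (\<eta> / 2 * (norm (\<alpha> r))\<^sup>2 + 1 / (2 * \<eta>))"
  have f: "(?f has_integral (x b - x a)) {a..b}" using assms unfolding trajectory_def by auto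
  have "((\<lambda>r. \<eta> / 2 * (norm (\<alpha> r))\<^sup>2) has_integral (\<eta> / 2 * energy a b \<alpha>)) {a..b}"
    using tr unfolding trajectory_def energy_def by (intro has_integral_mult_right integrable_integral) auto
  moreover have "((\<lambda>r. 1 / (2 * \<eta>)) has_integral ((b - a) / (2 * \<eta>))) {a..b}"
    using has_integral_const_real[of "1 / (2 * \<eta>)" a b] assms by simp
  ultimately have g: "(?g has_integral (sqrt 2 * (\<eta> / 2 * energy a b \<alpha> + (b - a) / (2 * \<eta>)))) {a..b}"
    by (rule has_integral_mult_right[OF has_integral_add])
  have "norm (?f r) \<le> ?g r" for r
    by (rule order_trans[OF norm_sqrtE_le mult_left_mono[OF norm_le_quadratic[OF \<open>\<eta> > 0\<close>]]]) simp
  then have "norm (integral {a..b} ?f) \<le> integral {a..b} ?g"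
    using f g by (intro integral_norm_bound_integral) auto
  then show ?thesis by (simp only: integral_unique[OF f] integral_unique[OF g])
qed

lemma trajectory_absolutely_continuous:
  assumes tr: "trajectory a b \<alpha> x"
  shows "absolutely_continuous_on {a..b} x"
  unfolding absolutely_continuous_on_def
proof (intro allI impI)
  fix \<epsilon> :: real assume "\<epsilon> > 0"
  define A where "A = energy a b \<alpha>"
  have "A \<ge> 0" by (simp add: A_def energy_nonneg)
  \<comment> \<open>The energies over the intervals of \<open>D\<close> add up to at most
    \<open>A\<close>, so this \<open>\<eta>\<close> keeps their part below \<epsilon>/2 for every
    \<open>D\<close>; \<open>\<delta>\<close> then makes the time part \<epsilon>/2. The summand 1
    covers \<open>A = 0\<close>.\<close>
  define \<eta> where "\<eta> = \<epsilon> / (sqrt 2 * (A + 1))"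
  have \<eta>: "\<eta> > 0" using \<open>\<epsilon> > 0\<close> \<open>A \<ge> 0\<close> by (simp add: \<eta>_def)
  define \<delta> where "\<delta> = \<epsilon> * \<eta> / sqrt 2"
  have "\<delta> > 0" using \<open>\<epsilon> > 0\<close> \<eta> by (simp add: \<delta>_def)
  let ?f = "\<lambda>s. (norm (\<alpha> s))\<^sup>2"
  have int: "?f integrable_on {a..b}" using tr by (simp add: trajectory_def)
  show "\<exists>\<delta>>0. \<forall>D. D division_of \<Union>D \<and> \<Union>D \<subseteq> {a..b} \<and> (\<Sum>K\<in>D. Sup K - Inf K) < \<delta> \<longrightarrow>
          (\<Sum>K\<in>D. norm (x (Sup K) - x (Inf K))) < \<epsilon>"
  proof (intro exI[of _ \<delta>] conjI \<open>\<delta> > 0\<close> allI impI)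
    fix D assume "D division_of \<Union>D \<and> \<Union>D \<subseteq> {a..b} \<and> (\<Sum>K\<in>D. Sup K - Inf K) < \<delta>"
    then have D: "D division_of \<Union>D" "\<Union>D \<subseteq> {a..b}" and m: "(\<Sum>K\<in>D. Sup K - Inf K) < \<delta>" by auto
    have "(\<Sum>K\<in>D. norm (x (Sup K) - x (Inf K))) \<le>
          (\<Sum>K\<in>D. sqrt 2 * (\<eta> / 2 * integral K ?f + (Sup K - Inf K) / (2 * \<eta>)))"
    proof (rule sum_mono)
      fix K assume K: "K \<in> D"
      obtain u v where uv: "K = {u..v}" "u \<le> v"
        using division_ofD(3,4)[OF D(1) K] by auto
      then have "u \<in> K" "v \<in> K" by auto
      then have "u \<in> {a..b}" "v \<in> {a..b}" using K D(2) by blast+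
      then have "a \<le> u" "v \<le> b" by auto
      then have "trajectory u v \<alpha> x" using uv by (intro trajectory_subinterval[OF tr]) auto
      from trajectory_displacement[OF this uv(2) \<eta>]
      show "norm (x (Sup K) - x (Inf K)) \<le> sqrt 2 * (\<eta> / 2 * integral K ?f + (Sup K - Inf K) / (2 * \<eta>))"
        using uv by (simp add: energy_def)
    qed
    also have "\<dots> = sqrt 2 * (\<eta> / 2 * (\<Sum>K\<in>D. integral K ?f) + (\<Sum>K\<in>D. Sup K - Inf K) / (2 * \<eta>))"
      by (simp add: sum.distrib sum_distrib_left sum_divide_distrib distrib_left)
    also have "(\<Sum>K\<in>D. integral K ?f) = integral (\<Union>D) ?f"
      using D int by (intro integral_combine_division_topdown[symmetric] integrable_on_subdivision[OF D(1) int])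
    also have "sqrt 2 * (\<eta> / 2 * integral (\<Union>D) ?f + (\<Sum>K\<in>D. Sup K - Inf K) / (2 * \<eta>))
        < sqrt 2 * (\<eta> / 2 * A + \<delta> / (2 * \<eta>))"
    proof -
      have "integral (\<Union>D) ?f \<le> A"
        unfolding A_def energy_def using D int integrable_on_subdivision[OF D(1) int D(2)] by (intro integral_subset_le) auto
      then have "\<eta> / 2 * integral (\<Union>D) ?f \<le> \<eta> / 2 * A" using \<eta> by simp
      moreover have "(\<Sum>K\<in>D. Sup K - Inf K) / (2 * \<eta>) < \<delta> / (2 * \<eta>)"
        using m \<eta> by (intro divide_strict_right_mono) auto
      ultimately show ?thesis by simp
    qed
    also have "\<dots> \<le> \<epsilon>"
    proof -
      have "sqrt 2 * (\<eta> / 2 * A) = \<epsilon> / 2 * (A / (A + 1))" by (simp add: \<eta>_def)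
      also have "\<dots> \<le> \<epsilon> / 2" using \<open>\<epsilon> > 0\<close> \<open>A \<ge> 0\<close> by (intro mult_left_le) auto
      finally have "sqrt 2 * (\<eta> / 2 * A) \<le> \<epsilon> / 2" .
      moreover have "sqrt 2 * (\<delta> / (2 * \<eta>)) = \<epsilon> / 2" using \<eta> by (simp add: \<delta>_def)
      ultimately show ?thesis by (simp only: distrib_left)
    qed
    finally show "(\<Sum>K\<in>D. norm (x (Sup K) - x (Inf K))) < \<epsilon>" .
  qed
qed

lemma nn_integral_energy:
  assumes "(\<lambda>s. (norm (\<alpha> s))\<^sup>2) integrable_on {a..b}"
  shows "(\<integral>\<^sup>+ s. ennreal ((norm (\<alpha> s))\<^sup>2) \<partial>lebesgue_on {a..b}) = ennreal (energy a b \<alpha>)"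
proof -
  have int: "integrable (lebesgue_on {a..b}) (\<lambda>s. (norm (\<alpha> s))\<^sup>2)"
    using assms by (intro absolutely_integrable_imp_integrable nonnegative_absolutely_integrable_1) auto
  then have "(\<integral>\<^sup>+ s. ennreal ((norm (\<alpha> s))\<^sup>2) \<partial>lebesgue_on {a..b}) = 
      ennreal (integral\<^sup>L (lebesgue_on {a..b}) (\<lambda>s. (norm (\<alpha> s))\<^sup>2))"
    by (intro nn_integral_eq_integral) auto
  also have "integral\<^sup>L (lebesgue_on {a..b}) (\<lambda>s. (norm (\<alpha> s))\<^sup>2) = energy a b \<alpha>"
    unfolding energy_def using int by (intro lebesgue_integral_eq_integral) auto
  finally show ?thesis .
qed

lemma cost_eq:
  assumes "(\<lambda>s. (norm (\<alpha> s))\<^sup>2) integrable_on {t..T}"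
  shows "cost g T t \<alpha> x = ereal (energy t T \<alpha> / 2 + g (x T))"
  unfolding cost_def nn_integral_energy[OF assms] by (simp add: energy_nonneg)

lemma absolutely_continuous_on_subset:
  assumes "absolutely_continuous_on B f" "A \<subseteq> B"
  shows "absolutely_continuous_on A f"
  unfolding absolutely_continuous_on_def
proof (intro allI impI)
  fix \<epsilon> :: real assume "\<epsilon> > 0"
  then obtain \<delta> where "\<delta> > 0" "\<forall>D. D division_of \<Union>D \<and> \<Union>D \<subseteq> B \<and> (\<Sum>K\<in>D. Sup K - Inf K) < \<delta> \<longrightarrow>
      (\<Sum>K\<in>D. norm (f (Sup K) - f (Inf K))) < \<epsilon>"
    using assms(1) unfolding absolutely_continuous_on_def by blast
  then show "\<exists>\<delta>>0. \<forall>D. D division_of \<Union>D \<and> \<Union>D \<subseteq> A \<and> (\<Sum>K\<in>D. Sup K - Inf K) < \<delta> \<longrightarrow>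
      (\<Sum>K\<in>D. norm (f (Sup K) - f (Inf K))) < \<epsilon>"
    using assms(2) by (intro exI[of _ \<delta>]) (blast intro: subset_trans)
qed

text \<open>Finite cost makes the control square integrable, hence integrable on the bounded
  interval, and absolute continuity turns the equation almost everywhere into the integrated one.
  Pairs of infinite cost cannot influence the infimum, so together with the converse below the value
  function becomes an infimum over trajectories.\<close>

lemma admissible_imp_trajectory:
  assumes adm: "admissible T y t \<alpha> x" and t: "0 \<le> t" "t \<le> T" and fin: "cost g T t \<alpha> x \<noteq> \<infinity>"
  shows "trajectory t T \<alpha> x"
proof -
  let ?f = "\<lambda>s. (norm (\<alpha> s))\<^sup>2"
  have meas: "\<alpha> \<in> borel_measurable (lebesgue_on {t..T})"
  proof (rule measurable_restrict_mono)
    show "\<alpha> \<in> borel_measurable (lebesgue_on {0..T})" using adm unfolding admissible_def by blast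
  qed (use t in auto)
  have "(\<integral>\<^sup>+ s. ennreal (?f s) \<partial>lebesgue_on {t..T}) \<noteq> \<infinity>"
  proof
    assume "(\<integral>\<^sup>+ s. ennreal (?f s) \<partial>lebesgue_on {t..T}) = \<infinity>"
    then show False using fin by (simp add: cost_def)
  qed
  then have "integrable (lebesgue_on {t..T}) ?f"
    using meas by (intro integrableI_nonneg) (auto simp: top.not_eq_extremum)
  then have int2: "?f integrable_on {t..T}" by (intro integrable_on_lebesgue_on) auto
  have bound: "norm (\<alpha> s) \<le> 1 / 2 * ?f s + 1 / 2" for s
    using norm_le_quadratic[of 1 "\<alpha> s"] by simp
  have intb: "(\<lambda>s. 1 / 2 * ?f s + 1 / 2) integrable_on {t..T}"
    using int2 by (intro integrable_add integrable_on_mult_right integrable_const_ivl)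
  have int1: "\<alpha> integrable_on {t..T}"
    using meas intb bound by (rule measurable_bounded_by_integrable_imp_integrable) auto
  obtain N where N: "negligible N" "\<And>s. s \<in> {t<..<T} - N \<Longrightarrow> (x has_vector_derivative sqrtE (x s) *v \<alpha> s) (at s)"
  proof -
    have "AE s in lebesgue. s \<in> {t<..<T} \<longrightarrow> (x has_vector_derivative sqrtE (x s) *v \<alpha> s) (at s)"
      using adm by (simp add: admissible_def)
    then obtain N where "N \<in> null_sets lebesgue" 
        "{s \<in> space lebesgue. \<not> (s \<in> {t<..<T} \<longrightarrow> (x has_vector_derivative sqrtE (x s) *v \<alpha> s) (at s))} \<subseteq> N"
      unfolding eventually_ae_filter by blast
    then show ?thesis using that[of N] by (auto simp: negligible_iff_null_sets)
  qed
  have "((\<lambda>r. sqrtE (x r) *v \<alpha> r) has_integral (x s - x t)) {t..s}" if s: "s \<in> {t..T}" for s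
  proof (rule has_integral_absolutely_continuous[OF _ _ N(1)])
    have "absolutely_continuous_on {t..T} x" using adm unfolding admissible_def by blast
    then show "absolutely_continuous_on {t..s} x"
      using s by (rule_tac absolutely_continuous_on_subset) auto
  qed (use N s in auto)
  then show ?thesis
    unfolding trajectory_def using int1 int2 N by blast
qed

lemma trajectory_imp_admissible:
  assumes tr: "trajectory 0 \<tau> \<alpha> x" and \<tau>: "0 \<le> \<tau>" "\<tau> \<le> T"
  shows "\<exists>\<alpha>' x'. admissible T (x 0) (T - \<tau>) \<alpha>' x' \<and> cost g T (T - \<tau>) \<alpha>' x' = ereal (energy 0 \<tau> \<alpha> / 2 + g (x \<tau>))"
proof -
  define c where "c = T - \<tau>"
  define \<alpha>1 where "\<alpha>1 = (\<lambda>s. \<alpha> (s - c))"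
  define z where "z = (\<lambda>s. x (s - c))"
  have tr1: "trajectory c T \<alpha>1 z" and en: "energy c T \<alpha>1 = energy 0 \<tau> \<alpha>"
    using trajectory_shift[OF tr, of c] energy_shift[OF tr, of c] by (simp_all add: \<alpha>1_def z_def c_def)
  \<comment> \<open>Admissibility asks for measurability on all of [0, T], while the shifted control
    is under control only on [c, T]; hence the extension by 0.\<close>
  define \<beta> where "\<beta> s = (if s \<in> {c..T} then \<alpha>1 s else 0)" for s
  have "\<beta> integrable_on UNIV"
    using tr1 unfolding \<beta>_def trajectory_def integrable_restrict_UNIV by blast
  then have "\<beta> integrable_on {0..T}" by (rule integrable_on_subinterval) auto
  then have meas: "\<beta> \<in> borel_measurable (lebesgue_on {0..T})"
    by (rule integrable_imp_measurable)
  obtain N where N: "negligible N" "\<And>s. s \<in> {c<..<T} - N \<Longrightarrow> (z has_vector_derivative sqrtE (z s) *v \<alpha>1 s) (at s)"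
    using tr1 unfolding trajectory_def by blast
  have "AE s in lebesgue. s \<notin> N" using N(1) by (intro AE_not_in) (simp add: negligible_iff_null_sets)
  then have "AE s in lebesgue. s \<in> {c<..<T} \<longrightarrow> (z has_vector_derivative sqrtE (z s) *v \<beta> s) (at s)"
    by eventually_elim (use N in \<open>auto simp: \<beta>_def\<close>)
  then have "admissible T (x 0) c \<beta> z"
    unfolding admissible_def using meas trajectory_absolutely_continuous[OF tr1] by (auto simp: z_def)
  moreover have "energy c T \<beta> = energy c T \<alpha>1"
    unfolding energy_def by (intro Henstock_Kurzweil_Integration.integral_cong) (simp add: \<beta>_def)
  moreover have "(\<lambda>s. (norm (\<beta> s))\<^sup>2) integrable_on {c..T}"
    using tr1 unfolding trajectory_def by (elim conjE integrable_eq) (simp add: \<beta>_def)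
  ultimately show ?thesis
    using en by (intro exI[of _ \<beta>] exI[of _ z]) (simp add: cost_eq c_def[symmetric]; simp add: z_def c_def)
qed

section \<open>The non-degenerate coordinates\<close>

definition sum_diff_vec :: "real \<Rightarrow> real \<Rightarrow> real^2" where
  "sum_diff_vec P R = (P / 2) *\<^sub>R vector [1, 1] + (R / 2) *\<^sub>R vector [1, -1]"

lemma sum_diff_vec_components [simp]: "sum_diff_vec P R $ 1 + sum_diff_vec P R $ 2 = P" "sum_diff_vec P R $ 1 - sum_diff_vec P R $ 2 = R"
  by (simp_all add: sum_diff_vec_def field_simps)

lemma sum_diff_vec_eq: "sum_diff_vec (y $ 1 + y $ 2) (y $ 1 - y $ 2) = y"
  by (intro vec2_eqI) simp_all

lemma sum_diff_vec_diff: "sum_diff_vec P R - sum_diff_vec P' R' = sum_diff_vec (P - P') (R - R')"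
  by (intro vec2_eqI) (simp_all add: sum_diff_vec_def field_simps)

lemma norm_sum_diff_vec: "(norm (sum_diff_vec P R))\<^sup>2 = (P\<^sup>2 + R\<^sup>2) / 2"
  by (simp add: norm_sum_diff)

lemma norm_sum_diff_vec_le: "norm (sum_diff_vec P R) \<le> \<bar>P\<bar> + \<bar>R\<bar>"
proof (rule power2_le_imp_le)
  have "P\<^sup>2 + R\<^sup>2 \<le> 2 * (\<bar>P\<bar> + \<bar>R\<bar>)\<^sup>2" by (simp add: power2_sum)
  then show "(norm (sum_diff_vec P R))\<^sup>2 \<le> (\<bar>P\<bar> + \<bar>R\<bar>)\<^sup>2" by (simp add: norm_sum_diff_vec)
qed simp

lemma has_vector_derivative_sum_diff_vec:
  assumes "(P has_real_derivative P') (at s)" "(R has_real_derivative R') (at s)"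
  shows "((\<lambda>s. sum_diff_vec (P s) (R s)) has_vector_derivative sum_diff_vec P' R') (at s)"
proof -
  have scale: "((\<lambda>s. f s *\<^sub>R v) has_vector_derivative f' *\<^sub>R v) (at s)"
    if "(f has_real_derivative f') (at s)" for f f' and v :: "real^2"
    using that unfolding has_real_derivative_iff_has_vector_derivative
    by (rule bounded_linear.has_vector_derivative[OF bounded_linear_scaleR_left])
  have "((\<lambda>s. P s / 2) has_real_derivative P' / 2) (at s)" "((\<lambda>s. R s / 2) has_real_derivative R' / 2) (at s)"
    using assms by (auto intro!: derivative_eq_intros)
  then show ?thesis
    unfolding sum_diff_vec_def by (intro has_vector_derivative_add scale)
qed

lemma continuous_on_sum_diff_vec:
  assumes "continuous_on A P" "continuous_on A R"
  shows "continuous_on A (\<lambda>s. sum_diff_vec (P s) (R s))"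
  unfolding sum_diff_vec_def
  by (intro continuous_on_add continuous_on_scaleR continuous_on_divide continuous_on_const assms) auto

text \<open>In the coordinates \<open>P = x\<^sub>1 + x\<^sub>2\<close>, \<open>R = x\<^sub>1 - x\<^sub>2\<close> the state equation reads
  \<open>P' = sqrt (1 + exp (- \<bar>R\<bar>)) (\<alpha>\<^sub>1 + \<alpha>\<^sub>2)\<close> and \<open>R' = sqrt (1 - exp (- \<bar>R\<bar>)) (\<alpha>\<^sub>1 - \<alpha>\<^sub>2)\<close>.
  The substitution \<open>R = \<phi> \<theta>\<close> solves \<open>\<phi>' = 2 sqrt (1 - exp (- \<bar>\<phi>\<bar>))\<close>, so that \<open>\<theta>' = (\<alpha>\<^sub>1 - \<alpha>\<^sub>2) / 2\<close> and the
  degeneracy on the diagonal disappears.\<close>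

definition \<phi> :: "real \<Rightarrow> real" where "\<phi> \<theta> = 2 * sgn \<theta> * ln (cosh \<theta>)"

lemma \<phi>_nonneg: "\<theta> \<ge> 0 \<Longrightarrow> \<phi> \<theta> = 2 * ln (cosh \<theta>)" and \<phi>_nonpos: "\<theta> \<le> 0 \<Longrightarrow> \<phi> \<theta> = - 2 * ln (cosh \<theta>)"
  by (auto simp: \<phi>_def sgn_if)

lemma \<phi>_minus: "\<phi> (- \<theta>) = - \<phi> \<theta>"
  by (simp add: \<phi>_def sgn_minus)

lemma abs_\<phi>: "\<bar>\<phi> \<theta>\<bar> = 2 * ln (cosh \<theta>)"
  using cosh_real_ge_1[of \<theta>] by (auto simp: \<phi>_def abs_mult sgn_if)

lemma ln_cosh_deriv: "((\<lambda>x::real. ln (cosh x)) has_real_derivative tanh x) (at x)"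
  by (auto intro!: derivative_eq_intros simp: tanh_def)

lemma \<phi>_deriv: "(\<phi> has_real_derivative 2 * tanh \<bar>\<theta>\<bar>) (at \<theta>)"
proof -
  consider "\<theta> > 0" | "\<theta> < 0" | "\<theta> = 0" by linarith
  then show ?thesis
  proof cases
    case 1
    have "((\<lambda>x. 2 * ln (cosh x)) has_real_derivative 2 * tanh \<theta>) (at \<theta>)"
      by (intro DERIV_cmult ln_cosh_deriv)
    then have "(\<phi> has_real_derivative 2 * tanh \<theta>) (at \<theta>)"
      by (rule has_field_derivative_transform_within_open[of _ _ _ "{0<..}"]) (use 1 in \<open>auto simp: \<phi>_nonneg\<close>)
    then show ?thesis using 1 by simp
  next
    case 2
    have "((\<lambda>x. - 2 * ln (cosh x)) has_real_derivative - 2 * tanh \<theta>) (at \<theta>)"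
      by (intro DERIV_cmult ln_cosh_deriv)
    then have "(\<phi> has_real_derivative - 2 * tanh \<theta>) (at \<theta>)"
      by (rule has_field_derivative_transform_within_open[of _ _ _ "{..<0}"]) (use 2 in \<open>auto simp: \<phi>_nonpos\<close>)
    then show ?thesis using 2 by simp
  next
    \<comment> \<open>The sign jumps at 0, but |\<phi> h / h| = 2 |ln (cosh h) / h|, which tends to
      2 tanh 0 = 0.\<close>
    case 3
    have "(\<lambda>h. ln (cosh h) / h) \<midarrow>0\<rightarrow> (0::real)"
      using ln_cosh_deriv[of 0] by (simp add: has_field_derivative_iff)
    then have "(\<lambda>h. 2 * \<bar>ln (cosh h) / h\<bar>) \<midarrow>0\<rightarrow> 2 * \<bar>0::real\<bar>" by (intro tendsto_intros)
    then have "(\<lambda>h. 2 * \<bar>ln (cosh h) / h\<bar>) \<midarrow>0\<rightarrow> (0::real)" by simp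
    then have "(\<lambda>h. \<phi> h / h) \<midarrow>0\<rightarrow> 0"
      by (rule Lim_null_comparison[rotated]) (auto simp: \<phi>_def abs_mult sgn_if intro!: always_eventually)
    then show ?thesis using 3 by (simp add: has_field_derivative_iff \<phi>_def)
  qed
qed

lemma \<phi>_lipschitz: "\<bar>\<phi> a - \<phi> b\<bar> \<le> 2 * \<bar>a - b\<bar>"
proof -
  have "norm (\<phi> a - \<phi> b) \<le> 2 * norm (a - b)"
  proof (rule field_differentiable_bound[of UNIV \<phi> "\<lambda>\<theta>. 2 * tanh \<bar>\<theta>\<bar>"])
    show "norm (2 * tanh \<bar>z\<bar>) \<le> 2" for z :: real
      using tanh_real_lt_1[of "\<bar>z\<bar>"] tanh_real_nonneg_iff[of "\<bar>z\<bar>"] by simp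
  qed (use \<phi>_deriv in auto)
  then show ?thesis by simp
qed

lemma offdiag_sum_diff_vec_\<phi>: "offdiag (sum_diff_vec P (\<phi> \<theta>)) = 1 / (cosh \<theta>)\<^sup>2"
proof -
  have "exp (2 * ln (cosh \<theta>)) = (cosh \<theta>)\<^sup>2"
    using cosh_real_pos[of \<theta>] by (simp add: exp_double)
  then show ?thesis by (simp add: offdiag_def abs_\<phi> exp_minus inverse_eq_divide)
qed

text \<open>By 1 - 1/cosh^2 = tanh^2 the degenerate factor of the state equation is half the
  derivative of \<open>\<phi>\<close>: this is the differential equation that \<open>\<phi>\<close>
  was chosen to solve.\<close>

lemma sqrt_offdiag_sum_diff_vec_\<phi>: "sqrt (1 - offdiag (sum_diff_vec P (\<phi> \<theta>))) = tanh \<bar>\<theta>\<bar>"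
proof -
  have "1 - offdiag (sum_diff_vec P (\<phi> \<theta>)) = (tanh \<bar>\<theta>\<bar>)\<^sup>2"
  proof -
    have "(tanh \<bar>\<theta>\<bar>)\<^sup>2 = (sinh \<theta>)\<^sup>2 / (cosh \<theta>)\<^sup>2"
      by (simp add: tanh_def power_divide abs_if)
    also have "\<dots> = ((cosh \<theta>)\<^sup>2 - 1) / (cosh \<theta>)\<^sup>2"
      using hyperbolic_pythagoras[of \<theta>] by simp
    also have "\<dots> = 1 - 1 / (cosh \<theta>)\<^sup>2"
      using cosh_real_pos[of \<theta>] by (simp add: diff_divide_distrib)
    finally show ?thesis by (simp add: offdiag_sum_diff_vec_\<phi>)
  qed
  then show ?thesis by (simp add: real_sqrt_unique)
qed

text \<open>The inverse of \<open>\<phi>\<close>, obtained from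
  \<open>\<bar>r\<bar> = 2 * ln (cosh \<theta>)\<close>.\<close>

definition \<Theta> :: "real \<Rightarrow> real" where "\<Theta> r = sgn r * arcosh (exp (\<bar>r\<bar> / 2))"

lemma \<phi>_\<Theta>: "\<phi> (\<Theta> r) = r"
proof -
  have pos: "\<phi> (arcosh (exp (r / 2))) = r" if "r > 0" for r :: real
  proof -
    have "1 \<le> exp (r / 2)" using that by simp
    then show ?thesis by (simp add: \<phi>_nonneg)
  qed
  consider "r > 0" | "r < 0" | "r = 0" by linarith
  then show ?thesis
    by cases (use pos[of r] pos[of "-r"] in \<open>auto simp: \<Theta>_def \<phi>_minus\<close>, simp add: \<phi>_def)
qed

text \<open>The exclusion of 0 is genuine, since \<open>\<phi>\<close> has derivative 0 there. In
  the plane it amounts to the diagonal, a null set.\<close>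

lemma \<Theta>_differentiable:
  assumes "r \<noteq> 0" shows "\<Theta> differentiable (at r)"
proof -
  have pos: "(\<lambda>r. arcosh (exp (r / 2))) differentiable (at r)" if "r > 0" for r :: real
  proof -
    have "exp (r / 2) > 1" using that by simp
    then have "(arcosh has_real_derivative (1 / sqrt ((exp (r / 2))\<^sup>2 - 1))) (at (exp (r / 2)))"
      by (auto intro!: derivative_eq_intros)
    then have "arcosh differentiable (at (exp (r / 2)))" by (auto simp: real_differentiable_def)
    moreover have "(\<lambda>r. exp (r / 2)) differentiable (at r)"
      unfolding real_differentiable_def by (rule exI) (auto intro!: derivative_eq_intros)
    ultimately show ?thesis
      using differentiable_chain_at[of "\<lambda>r. exp (r / 2)" r arcosh] by (simp add: o_def)
  qed
  show ?thesis
  proof (cases "r > 0")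
    case True
    have near: "\<forall>\<^sub>F x in nhds r. arcosh (exp (x / 2)) = \<Theta> x"
      using eventually_nhds_in_open[of "{0<..}" r] True by (auto simp: \<Theta>_def elim!: eventually_mono)
    obtain D where "((\<lambda>r. arcosh (exp (r / 2))) has_real_derivative D) (at r)"
      using pos[OF True] by (auto simp: real_differentiable_def)
    then have "(\<Theta> has_real_derivative D) (at r)"
      using DERIV_cong_ev[OF refl near refl] by blast
    then show ?thesis by (auto simp: real_differentiable_def)
  next
    case False
    then have r: "r < 0" "- r > 0" using assms by auto
    have near: "\<forall>\<^sub>F x in nhds r. - arcosh (exp (- x / 2)) = \<Theta> x"
      using eventually_nhds_in_open[of "{..<0}" r] r by (auto simp: \<Theta>_def elim!: eventually_mono)
    obtain D where D: "((\<lambda>r. arcosh (exp (r / 2))) has_real_derivative D) (at (- r))"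
      using pos[OF r(2)] by (auto simp: real_differentiable_def)
    have "((\<lambda>x. arcosh (exp (- x / 2))) has_real_derivative D * (- 1)) (at r)"
    proof -
      have "((\<lambda>x. - x) has_real_derivative - 1) (at r)" by (auto intro!: derivative_eq_intros)
      then show ?thesis
        by (rule DERIV_chain2[where f = "\<lambda>r. arcosh (exp (r / 2))" and g = "\<lambda>x. - x", OF D])
    qed
    then have "((\<lambda>x. - arcosh (exp (- x / 2))) has_real_derivative - (D * (- 1))) (at r)"
      by (rule DERIV_minus)
    then have "(\<Theta> has_real_derivative - (D * (- 1))) (at r)"
      using DERIV_cong_ev[OF refl near refl] by blast
    then show ?thesis by (auto simp: real_differentiable_def)
  qed
qed

text \<open>From sinh y \<ge> y for y \<ge> 0 and cosh x = 1 + 2 sinh^2 (x/2).\<close>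

lemma cosh_ge_quadratic: "1 + x\<^sup>2 / 2 \<le> cosh (x::real)"
proof -
  have sinh_ge: "y \<le> sinh y" if "y \<ge> 0" for y :: real
  proof -
    \<comment> \<open>The product of 1 + y + y^2/2 and 1 - y + y^2/2 is 1 + y^4/4, so the second
      factor bounds exp (-y) from above, while the first bounds exp y from below. Their difference
      is 2y.\<close>
    define a where "a = 1 + y + y\<^sup>2 / 2"
    have a: "a \<ge> 1" using that by (simp add: a_def)
    have e: "a \<le> exp y" unfolding a_def using that by (rule exp_lower_Taylor_quadratic)
    have "a * (1 - y + y\<^sup>2 / 2) = 1 + (y\<^sup>2 / 2)\<^sup>2"
      by (simp add: a_def field_simps power2_eq_square)
    then have "1 / a \<le> 1 - y + y\<^sup>2 / 2" using a by (simp add: pos_divide_le_eq mult.commute)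
    moreover have "exp (- y) \<le> 1 / a" using e a by (simp add: exp_minus inverse_eq_divide frac_le)
    ultimately show ?thesis using e by (simp add: sinh_field_def a_def)
  qed
  have "\<bar>x / 2\<bar> \<le> sinh \<bar>x / 2\<bar>" by (rule sinh_ge) simp
  then have "\<bar>x / 2\<bar>\<^sup>2 \<le> (sinh \<bar>x / 2\<bar>)\<^sup>2" by (intro power_mono) auto
  moreover have "cosh x = 1 + 2 * (sinh \<bar>x / 2\<bar>)\<^sup>2"
    using cosh_double[of "\<bar>x / 2\<bar>"] hyperbolic_pythagoras[of "\<bar>x / 2\<bar>"] by (simp add: abs_if split: if_splits)
  ultimately show ?thesis by (simp add: power_divide)
qed

text \<open>The source of the Hoelder bound for \<open>\<Theta>\<close>. For equal signs the
  addition formula gives cosh (a - b) \<le> cosh a / cosh b, where a has the larger modulus, and the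
  quotient is an exponential of the difference of \<phi>. For opposite signs that difference belongs
  to the product cosh a cosh b, which dominates only cosh of the larger of |a| and |b|; this case is
  the reason for halving a - b.\<close>

lemma cosh_half_diff_le: "cosh ((a - b) / 2) \<le> exp (\<bar>\<phi> a - \<phi> b\<bar> / 2)"
proof -
  have pos: "cosh ((a - b) / 2) \<le> exp ((\<phi> a - \<phi> b) / 2)" if "0 \<le> b" "b \<le> a" for a b
  proof -
    have "cosh ((a - b) / 2) \<le> cosh (a - b)"
      using that by (subst cosh_real_nonneg_le_iff) auto
    also have "\<dots> * cosh b \<le> cosh ((a - b) + b)"
      using that by (subst cosh_add) simp
    then have "cosh (a - b) \<le> cosh a / cosh b"
      using cosh_real_pos[of b] by (simp add: pos_le_divide_eq)
    also have "cosh a / cosh b = exp ((\<phi> a - \<phi> b) / 2)"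
      using that cosh_real_pos[of a] cosh_real_pos[of b] by (simp add: \<phi>_nonneg exp_diff diff_divide_distrib)
    finally show ?thesis .
  qed
  have main: "cosh ((a - b) / 2) \<le> exp (\<bar>\<phi> a - \<phi> b\<bar> / 2)" if "b \<le> a" for a b
  proof -
    consider "0 \<le> b" | "a \<le> 0" | "b < 0" "0 < a" by linarith
    then show ?thesis
    proof cases
      case 1
      have "(\<phi> a - \<phi> b) / 2 \<le> \<bar>\<phi> a - \<phi> b\<bar> / 2" by (intro divide_right_mono abs_ge_self) simp
      then show ?thesis using pos[OF 1 that] by (meson exp_le_cancel_iff order_trans)
    next
      case 2
      have "\<phi> (- b) - \<phi> (- a) = \<phi> a - \<phi> b" by (simp add: \<phi>_minus)
      then have "(\<phi> (- b) - \<phi> (- a)) / 2 \<le> \<bar>\<phi> a - \<phi> b\<bar> / 2" by (metis divide_right_mono abs_ge_self zero_le_numeral)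
      moreover have "cosh ((a - b) / 2) \<le> exp ((\<phi> (- b) - \<phi> (- a)) / 2)"
        using pos[of "- a" "- b"] 2 that by simp
      ultimately show ?thesis by (meson exp_le_cancel_iff order_trans)
    next
      case 3
      have "(a - b) / 2 \<le> max a (- b)" by (auto simp: max_def)
      then have "cosh ((a - b) / 2) \<le> cosh (max a (- b))"
        using 3 by (subst cosh_real_nonneg_le_iff) auto
      also have "\<dots> \<le> cosh a * cosh b"
        using cosh_real_ge_1[of a] cosh_real_ge_1[of b]
        by (cases "a \<le> - b") (auto simp: max_def mult_le_cancel_left1 mult_le_cancel_right1)
      also have "\<dots> = exp ((\<phi> a - \<phi> b) / 2)"
        using 3 cosh_real_pos[of a] cosh_real_pos[of b] by (simp add: \<phi>_nonneg \<phi>_nonpos exp_add add_divide_distrib)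
      also have "\<dots> \<le> exp (\<bar>\<phi> a - \<phi> b\<bar> / 2)" unfolding exp_le_cancel_iff by (intro divide_right_mono abs_ge_self) simp
      finally show ?thesis .
    qed
  qed
  show ?thesis
  proof (cases "b \<le> a")
    case False
    have "(a - b) / 2 = - ((b - a) / 2)" by (simp add: field_simps)
    then have "cosh ((a - b) / 2) = cosh ((b - a) / 2)" by (metis cosh_minus)
    moreover have "cosh ((b - a) / 2) \<le> exp (\<bar>\<phi> b - \<phi> a\<bar> / 2)" using False by (intro main) simp
    ultimately show ?thesis by (simp only: abs_minus_commute[of "\<phi> b"])
  qed (rule main)
qed

text \<open>With d = |r - r'| / 2 the two preceding estimates give 1 + |\<Theta> r - \<Theta> r'|^2
  / 8 \<le> exp d, and d \<le> 1 allows exp d \<le> 1 + 2d.\<close>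

lemma \<Theta>_holder:
  assumes "\<bar>r - r'\<bar> \<le> 2"
  shows "\<bar>\<Theta> r - \<Theta> r'\<bar>\<^sup>2 \<le> 8 * \<bar>r - r'\<bar>"
proof -
  define d where "d = \<bar>r - r'\<bar> / 2"
  have d: "0 \<le> d" "d \<le> 1" using assms by (auto simp: d_def)
  have "1 + ((\<Theta> r - \<Theta> r') / 2)\<^sup>2 / 2 \<le> exp d"
    using order_trans[OF cosh_ge_quadratic cosh_half_diff_le[of "\<Theta> r" "\<Theta> r'"]] by (simp add: \<phi>_\<Theta> d_def)
  also have "\<dots> \<le> 1 + d + d\<^sup>2" using d by (rule exp_bound)
  also have "\<dots> \<le> 1 + 2 * d" using d by (simp add: power2_eq_square mult_left_le)
  finally show ?thesis by (simp add: d_def power_divide)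
qed

section \<open>Straight lines in the coordinates (P, \<theta>)\<close>

definition ray_path :: "real \<Rightarrow> real \<Rightarrow> real \<Rightarrow> real \<Rightarrow> real \<Rightarrow> real^2" where
  "ray_path P p \<theta> k s = sum_diff_vec (P + p * s) (\<phi> (\<theta> + k * s))"

text \<open>The control that produces the constant velocities \<open>p\<close> of P and
  \<open>k\<close> of \<theta>. Solving for it divides by sqrt (1 + offdiag) only, never by the
  factor that vanishes on the diagonal.\<close>

definition ray_control :: "real \<Rightarrow> real \<Rightarrow> real \<Rightarrow> real \<Rightarrow> real \<Rightarrow> real^2" where
  "ray_control P p \<theta> k s = sum_diff_vec (p / sqrt (1 + offdiag (ray_path P p \<theta> k s))) (2 * k)"

lemma ray_path_derivative:
  "(ray_path P p \<theta> k has_vector_derivative sqrtE (ray_path P p \<theta> k s) *v ray_control P p \<theta> k s) (at s)"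
proof -
  have 1: "((\<lambda>s. P + p * s) has_real_derivative p) (at s)"
    by (auto intro!: derivative_eq_intros)
  have "((\<lambda>s. \<theta> + k * s) has_real_derivative k) (at s)"
    by (auto intro!: derivative_eq_intros)
  from DERIV_chain2[OF \<phi>_deriv this]
  have 2: "((\<lambda>s. \<phi> (\<theta> + k * s)) has_real_derivative 2 * tanh \<bar>\<theta> + k * s\<bar> * k) (at s)" .
  have "sqrtE (ray_path P p \<theta> k s) *v ray_control P p \<theta> k s = sum_diff_vec p (2 * tanh \<bar>\<theta> + k * s\<bar> * k)"
  proof (rule vec2_eqI; unfold sqrtE_components)
    show "sqrt (1 + offdiag (ray_path P p \<theta> k s)) * (ray_control P p \<theta> k s $ 1 + ray_control P p \<theta> k s $ 2) = 
       sum_diff_vec p (2 * tanh \<bar>\<theta> + k * s\<bar> * k) $ 1 + sum_diff_vec p (2 * tanh \<bar>\<theta> + k * s\<bar> * k) $ 2"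
      using offdiag[of "ray_path P p \<theta> k s"] by (simp add: ray_control_def)
    show "sqrt (1 - offdiag (ray_path P p \<theta> k s)) * (ray_control P p \<theta> k s $ 1 - ray_control P p \<theta> k s $ 2) = 
       sum_diff_vec p (2 * tanh \<bar>\<theta> + k * s\<bar> * k) $ 1 - sum_diff_vec p (2 * tanh \<bar>\<theta> + k * s\<bar> * k) $ 2"
      by (simp add: ray_control_def ray_path_def sqrt_offdiag_sum_diff_vec_\<phi>)
  qed
  then show ?thesis using has_vector_derivative_sum_diff_vec[OF 1 2] by (simp add: ray_path_def[abs_def])
qed

lemma continuous_ray_control: "continuous_on A (ray_control P p \<theta> k)"
proof -
  have "continuous_on A (ray_path P p \<theta> k)"
    using ray_path_derivative by (meson continuous_at_imp_continuous_on has_vector_derivative_continuous)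
  then have "continuous_on A (\<lambda>s. offdiag (ray_path P p \<theta> k s))"
    by (rule continuous_on_compose2[OF continuous_offdiag[of UNIV]]) auto
  moreover have "1 + offdiag x \<noteq> 0" for x using offdiag(1)[of x] by linarith
  ultimately show ?thesis
    unfolding ray_control_def
    by (intro continuous_on_sum_diff_vec continuous_on_divide continuous_on_real_sqrt continuous_on_add continuous_on_const) auto
qed

lemma trajectory_ray: "trajectory a b (ray_control P p \<theta> k) (ray_path P p \<theta> k)"
  unfolding trajectory_def
proof (intro conjI ballI exI[of _ "{}"] integrable_continuous_real continuous_ray_control)
  show "continuous_on {a..b} (\<lambda>s. (norm (ray_control P p \<theta> k s))\<^sup>2)"
    by (intro continuous_on_power continuous_on_norm continuous_ray_control)
  fix s assume "s \<in> {a..b}"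
  then show "((\<lambda>r. sqrtE (ray_path P p \<theta> k r) *v ray_control P p \<theta> k r) has_integral
      ray_path P p \<theta> k s - ray_path P p \<theta> k a) {a..s}"
    by (intro fundamental_theorem_of_calculus) (auto intro: has_vector_derivative_at_within ray_path_derivative)
qed (auto intro: ray_path_derivative)

lemma norm_ray_control_le: "(norm (ray_control P p \<theta> k s))\<^sup>2 \<le> (p\<^sup>2 + 4 * k\<^sup>2) / 2"
proof -
  define c where "c = 1 + offdiag (ray_path P p \<theta> k s)"
  have c: "c \<ge> 1" using offdiag by (simp add: c_def less_imp_le)
  have "(norm (ray_control P p \<theta> k s))\<^sup>2 = (p\<^sup>2 / c + 4 * k\<^sup>2) / 2"
    using c by (simp add: ray_control_def norm_sum_diff_vec c_def[symmetric] power_divide power_mult_distrib)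
  moreover have "p\<^sup>2 / c \<le> p\<^sup>2 / 1" using c by (intro divide_left_mono) auto
  ultimately show ?thesis by simp
qed

lemma energy_ray_le: 
  assumes "0 \<le> h" shows "energy 0 h (ray_control P p \<theta> k) \<le> h * ((p\<^sup>2 + 4 * k\<^sup>2) / 2)"
proof -
  have "energy 0 h (ray_control P p \<theta> k) \<le> integral {0..h} (\<lambda>_. (p\<^sup>2 + 4 * k\<^sup>2) / 2)"
    unfolding energy_def
  proof (rule integral_le)
    show "(\<lambda>s. (norm (ray_control P p \<theta> k s))\<^sup>2) integrable_on {0..h}"
      using trajectory_ray[of 0 h P p \<theta> k] by (simp add: trajectory_def)
  qed (rule integrable_const_ivl, rule norm_ray_control_le)
  then show ?thesis using assms by simp
qed

section \<open>The value function\<close>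

lemma linear_functional_inner:
  fixes f :: "'a::euclidean_space \<Rightarrow> real"
  assumes "linear f"
  shows "f h = adjoint f 1 \<bullet> h"
  using adjoint_works[OF assms, of h 1] by (simp add: inner_commute)

text \<open>The second argument of \<open>u\<close> is the time that remains. Outside [0, T] the
  function \<open>u\<close> is arbitrary, which is why the estimates below restrict the times.
  Strict positivity of \<open>L\<close> permits the choice 1 / (sqrt 2 L) in
  \<open>u_time_le\<close>.\<close>

locale bounded_lipschitz_cost =
  fixes T M L :: real and g :: "real^2 \<Rightarrow> real" and u :: "real^2 \<Rightarrow> real \<Rightarrow> real"
  assumes T: "T > 0" and M: "\<And>x. \<bar>g x\<bar> \<le> M" and L: "L > 0" and lip: "\<And>x y. \<bar>g x - g y\<bar> \<le> L * norm (x - y)"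
    and u_eq: "\<And>x t. t \<in> {0..T} \<Longrightarrow> u x t = value_function g T x (T - t)"
begin

lemma value_INF:
  assumes \<tau>: "0 \<le> \<tau>" "\<tau> \<le> T"
  shows "(INF (\<alpha>, x) \<in> {(\<alpha>, x). admissible T y (T - \<tau>) \<alpha> x}. cost g T (T - \<tau>) \<alpha> x) = ereal (u y \<tau>)" (is "?I = _")
proof -
  have "ereal (- M) \<le> ?I"
  proof (rule INF_greatest, clarify)
    fix \<alpha> x
    have "ereal (- M) = 0 + ereal (- M)" by simp
    also have "\<dots> \<le> cost g T (T - \<tau>) \<alpha> x"
      unfolding cost_def using M[of "x T"] by (intro add_mono mult_nonneg_nonneg) (auto simp: abs_le_iff)
    finally show "ereal (- M) \<le> cost g T (T - \<tau>) \<alpha> x" .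
  qed
  moreover have "?I \<le> ereal M"
  proof -
    obtain \<alpha> x where "admissible T y (T - \<tau>) \<alpha> x" "cost g T (T - \<tau>) \<alpha> x = ereal (energy 0 \<tau> (\<lambda>_. 0) / 2 + g y)"
      using trajectory_imp_admissible[OF trajectory_const \<tau>, of y g] by auto
    then have "?I \<le> ereal (g y)" by (auto simp: energy_const intro!: INF_lower2[of "(\<alpha>, x)"])
    also have "\<dots> \<le> ereal M" using M[of y] by (simp add: abs_le_iff)
    finally show ?thesis .
  qed
  ultimately have "\<bar>?I\<bar> \<noteq> \<infinity>" by auto
  then show ?thesis using \<tau> by (simp add: u_eq value_function_def ereal_real)
qed

lemma u_le:
  assumes "0 \<le> \<tau>" "\<tau> \<le> T" and tr: "trajectory 0 \<tau> \<alpha> x"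
  shows "u (x 0) \<tau> \<le> energy 0 \<tau> \<alpha> / 2 + g (x \<tau>)"
proof -
  obtain \<alpha>' x' where *: "admissible T (x 0) (T - \<tau>) \<alpha>' x'" "cost g T (T - \<tau>) \<alpha>' x' = ereal (energy 0 \<tau> \<alpha> / 2 + g (x \<tau>))"
    using trajectory_imp_admissible[OF tr assms(1,2)] by blast
  have "ereal (u (x 0) \<tau>) \<le> cost g T (T - \<tau>) \<alpha>' x'"
    unfolding value_INF[OF assms(1,2), symmetric] using *(1) by (auto intro!: INF_lower2[of "(\<alpha>', x')"])
  then show ?thesis using *(2) by simp
qed

lemma u_approx:
  assumes "0 \<le> \<tau>" "\<tau> \<le> T" and "\<epsilon> > 0"
  shows "\<exists>\<alpha> x. trajectory 0 \<tau> \<alpha> x \<and> x 0 = y \<and> energy 0 \<tau> \<alpha> / 2 + g (x \<tau>) < u y \<tau> + \<epsilon>"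
proof -
  let ?c = "T - \<tau>"
  have "(INF (\<alpha>, x) \<in> {(\<alpha>, x). admissible T y ?c \<alpha> x}. cost g T ?c \<alpha> x) < ereal (u y \<tau> + \<epsilon>)"
    unfolding value_INF[OF assms(1,2)] using \<open>\<epsilon> > 0\<close> by simp
  then obtain \<alpha> x where adm: "admissible T y ?c \<alpha> x" and c: "cost g T ?c \<alpha> x < ereal (u y \<tau> + \<epsilon>)"
    by (auto simp: INF_less_iff)
  have tr: "trajectory ?c T \<alpha> x"
    using adm c assms by (intro admissible_imp_trajectory[where g = g]) auto
  then have "cost g T ?c \<alpha> x = ereal (energy ?c T \<alpha> / 2 + g (x T))"
    by (intro cost_eq) (simp add: trajectory_def)
  then have e: "energy ?c T \<alpha> / 2 + g (x T) < u y \<tau> + \<epsilon>" using c by simp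
  have "trajectory 0 \<tau> (\<lambda>s. \<alpha> (s - - ?c)) (\<lambda>s. x (s - - ?c))" "energy 0 \<tau> (\<lambda>s. \<alpha> (s - - ?c)) = energy ?c T \<alpha>"
    using trajectory_shift[OF tr, of "- ?c"] energy_shift[OF tr, of "- ?c"] by simp_all
  moreover have "x ?c = y" using adm by (simp add: admissible_def)
  ultimately show ?thesis using e by (intro exI[of _ "\<lambda>s. \<alpha> (s - - ?c)"] exI[of _ "\<lambda>s. x (s - - ?c)"]) simp
qed

lemma u_bounded: 
  assumes "0 \<le> \<tau>" "\<tau> \<le> T" shows "\<bar>u y \<tau>\<bar> \<le> M"
proof -
  have "u y \<tau> \<le> M"
    using u_le[OF assms trajectory_const[of _ _ y]] M[of y] by (simp add: energy_const abs_le_iff)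
  moreover have "- M \<le> u y \<tau>"
  proof (rule field_le_epsilon)
    fix e :: real assume "e > 0"
    then obtain \<alpha> x where "energy 0 \<tau> \<alpha> / 2 + g (x \<tau>) < u y \<tau> + e" using u_approx[OF assms] by blast
    then show "- M \<le> u y \<tau> + e" using energy_nonneg[of 0 \<tau> \<alpha>] M[of "x \<tau>"] by (simp add: abs_le_iff)
  qed
  ultimately show ?thesis by (simp add: abs_le_iff)
qed

section \<open>Dynamic programming and Lipschitz continuity in time\<close>

lemma dynamic_programming_le:
  assumes h: "0 \<le> h" "h \<le> \<tau>" "\<tau> \<le> T" and tr: "trajectory 0 h \<alpha> x"
  shows "u (x 0) \<tau> \<le> energy 0 h \<alpha> / 2 + u (x h) (\<tau> - h)"
proof (rule field_le_epsilon)
  fix e :: real assume "e > 0"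
  then obtain \<beta> z where z: "trajectory 0 (\<tau> - h) \<beta> z" "z 0 = x h"
      "energy 0 (\<tau> - h) \<beta> / 2 + g (z (\<tau> - h)) < u (x h) (\<tau> - h) + e" 
    using u_approx[of "\<tau> - h" e "x h"] h by auto
  have tr': "trajectory h \<tau> (\<lambda>s. \<beta> (s - h)) (\<lambda>s. z (s - h))" "energy h \<tau> (\<lambda>s. \<beta> (s - h)) = energy 0 (\<tau> - h) \<beta>"
    using trajectory_shift[OF z(1), of h] energy_shift[OF z(1), of h] by simp_all
  note c = trajectory_concat[OF tr tr'(1) _ h(1,2)]
  have "u (if 0 \<le> h then x 0 else z (0 - h)) \<tau> \<le> (energy 0 h \<alpha> + energy 0 (\<tau> - h) \<beta>) / 2 + g (if \<tau> \<le> h then x \<tau> else z (\<tau> - h))"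
    using u_le[OF _ h(3) c(1)] c(2) tr'(2) h z(2) by simp
  moreover have "(if \<tau> \<le> h then x \<tau> else z (\<tau> - h)) = z (\<tau> - h)" using h z(2) by auto
  ultimately show "u (x 0) \<tau> \<le> energy 0 h \<alpha> / 2 + u (x h) (\<tau> - h) + e"
    using z(3) h by (simp add: add_divide_distrib)
qed

lemma dynamic_programming_approx:
  assumes h: "0 \<le> h" "h \<le> \<tau>" "\<tau> \<le> T" and "\<epsilon> > 0"
  shows "\<exists>\<alpha> x. trajectory 0 h \<alpha> x \<and> x 0 = y \<and> energy 0 h \<alpha> / 2 + u (x h) (\<tau> - h) < u y \<tau> + \<epsilon>"
proof -
  have "0 \<le> \<tau>" using h by simp
  then obtain \<alpha> x where x: "trajectory 0 \<tau> \<alpha> x" "x 0 = y" "energy 0 \<tau> \<alpha> / 2 + g (x \<tau>) < u y \<tau> + \<epsilon>"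
    using u_approx[OF _ h(3) \<open>\<epsilon> > 0\<close>] by blast
  have tr1: "trajectory 0 h \<alpha> x" using x h by (intro trajectory_subinterval[OF x(1)]) auto
  have tr2: "trajectory h \<tau> \<alpha> x" using x h by (intro trajectory_subinterval[OF x(1)]) auto
  have "u (x h) (\<tau> - h) \<le> energy h \<tau> \<alpha> / 2 + g (x \<tau>)"
    using u_le[OF _ _ trajectory_shift[OF tr2, of "- h", simplified]] energy_shift[OF tr2, of "- h"] h by simp
  then show ?thesis
    using x(2,3) tr1 energy_combine[OF x(1) h(1,2)] by (intro exI[of _ \<alpha>] exI[of _ x] conjI) (simp_all add: add_divide_distrib)
qed

lemma u_antimono:
  assumes "0 \<le> \<tau>" "\<tau> \<le> \<tau>'" "\<tau>' \<le> T"
  shows "u y \<tau>' \<le> u y \<tau>"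
  using dynamic_programming_le[OF _ _ assms(3) trajectory_const[of 0 "\<tau>' - \<tau>" y]] assms by (simp add: energy_const)

lemma u_time_le:
  assumes h: "0 \<le> \<tau>" "\<tau> \<le> \<tau>'" "\<tau>' \<le> T"
  shows "u y \<tau> \<le> u y \<tau>' + L\<^sup>2 * (\<tau>' - \<tau>)"
proof (rule field_le_epsilon)
  fix e :: real assume "e > 0"
  have "0 \<le> \<tau>'" using h by simp
  then obtain \<alpha> x where x: "trajectory 0 \<tau>' \<alpha> x" "x 0 = y" "energy 0 \<tau>' \<alpha> / 2 + g (x \<tau>') < u y \<tau>' + e"
    using u_approx[OF _ h(3) \<open>e > 0\<close>] by blast
  have tr1: "trajectory 0 \<tau> \<alpha> x" using x h by (intro trajectory_subinterval[OF x(1)]) auto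
  have tr2: "trajectory \<tau> \<tau>' \<alpha> x" using x h by (intro trajectory_subinterval[OF x(1)]) auto
  \<comment> \<open>A nearly optimal path for the longer time is stopped at \<open>\<tau>\<close>.
    With this \<open>\<eta>\<close> the bound on the change of \<open>g\<close> contains exactly
    half the energy saved by stopping, which is the running cost saved, and L^2 times the time
    difference is left over.\<close>
  define \<eta> where "\<eta> = 1 / (sqrt 2 * L)"
  have "\<eta> > 0" using L by (simp add: \<eta>_def)
  have "L * norm (x \<tau>' - x \<tau>) \<le> L * (sqrt 2 * (\<eta> / 2 * energy \<tau> \<tau>' \<alpha> + (\<tau>' - \<tau>) / (2 * \<eta>)))"
    using trajectory_displacement[OF tr2 h(2) \<open>\<eta> > 0\<close>] L by (intro mult_left_mono) auto
  also have "\<dots> = energy \<tau> \<tau>' \<alpha> / 2 + L\<^sup>2 * (\<tau>' - \<tau>)"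
    using L by (simp add: \<eta>_def field_simps power2_eq_square)
  finally have "g (x \<tau>) \<le> g (x \<tau>') + energy \<tau> \<tau>' \<alpha> / 2 + L\<^sup>2 * (\<tau>' - \<tau>)"
    using lip[of "x \<tau>" "x \<tau>'"] by (simp add: norm_minus_commute abs_le_iff)
  moreover have "u y \<tau> \<le> energy 0 \<tau> \<alpha> / 2 + g (x \<tau>)"
    using u_le[OF h(1) _ tr1] h x(2) by simp
  moreover have "energy 0 \<tau>' \<alpha> = energy 0 \<tau> \<alpha> + energy \<tau> \<tau>' \<alpha>"
    using energy_combine[OF x(1) h(1,2)] .
  ultimately show "u y \<tau> \<le> u y \<tau>' + L\<^sup>2 * (\<tau>' - \<tau>) + e"
    using x(3) by linarith
qed

lemma u_time_lipschitz:
  assumes "t \<in> {0..T}" "t' \<in> {0..T}"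
  shows "\<bar>u y t - u y t'\<bar> \<le> L\<^sup>2 * \<bar>t - t'\<bar>"
  using u_antimono[of t t' y] u_time_le[of t t' y] u_antimono[of t' t y] u_time_le[of t' t y] assms
  by (cases "t \<le> t'") (auto simp: abs_if algebra_simps)

lemma u_0: "u y 0 = g y"
proof (rule antisym)
  show "u y 0 \<le> g y"
    using u_le[OF _ _ trajectory_const[of 0 0 y]] T by (simp add: energy_const)
  show "g y \<le> u y 0"
  proof (rule field_le_epsilon)
    fix e :: real assume "e > 0"
    then obtain \<alpha> x where "x 0 = y" "energy 0 0 \<alpha> / 2 + g (x 0) < u y 0 + e"
      using u_approx[of 0 e y] T by auto
    then show "g y \<le> u y 0 + e" using energy_nonneg[of 0 0 \<alpha>] by simp
  qed
qed

lemma M_nonneg: "M \<ge> 0"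
  using M[of 0] by linarith

section \<open>Lipschitz continuity in (P, \<theta>) and the Hoelder estimate\<close>

text \<open>Move from the first point to the second one during time \<open>D\<close>, at cost at most \<open>D / 4\<close>, and then lose at most
  \<open>L\<^sup>2 D\<close> because only the time \<open>t - D\<close> is left. If \<open>t < D\<close>, compare \<open>u\<close> with \<open>g\<close>.\<close>

lemma u_travel_le:
  assumes t: "t \<in> {0..T}"
  shows "u (sum_diff_vec P (\<phi> \<theta>)) t \<le> u (sum_diff_vec P' (\<phi> \<theta>')) t + (1 + L\<^sup>2 + L) * (\<bar>P - P'\<bar> + 2 * \<bar>\<theta> - \<theta>'\<bar>)"
proof -
  \<comment> \<open>The weight 2 serves twice: velocities with |p| + 2|k| = 1 satisfy p^2 + 4k^2
    \<le> 1, which bounds the energy of the ray, and \<open>\<phi>\<close> is 2-Lipschitz, so that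
    also |y - y'| \<le> D.\<close>
  define D where "D = \<bar>P - P'\<bar> + 2 * \<bar>\<theta> - \<theta>'\<bar>"
  define y y' where "y = sum_diff_vec P (\<phi> \<theta>)" and "y' = sum_diff_vec P' (\<phi> \<theta>')"
  have "D \<ge> 0" by (simp add: D_def)
  have LD: "0 \<le> L * D" "0 \<le> L\<^sup>2 * D" using L \<open>D \<ge> 0\<close> by auto
  consider "D = 0" | "D > 0" "D \<le> t" | "D > t" using \<open>D \<ge> 0\<close> by linarith
  then have "u y t \<le> u y' t + (1 + L\<^sup>2 + L) * D"
  proof cases
    case 1
    have "P = P' \<and> \<theta> = \<theta>'" using 1 by (simp add: D_def add_nonneg_eq_0_iff)
    then show ?thesis using 1 by (simp add: y_def y'_def)
  next
    case 2
    define p k where "p = (P' - P) / D" and "k = (\<theta>' - \<theta>) / D"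
    have "D\<^sup>2 * (p\<^sup>2 + 4 * k\<^sup>2) = (P' - P)\<^sup>2 + 4 * (\<theta>' - \<theta>)\<^sup>2"
      using 2 by (simp add: p_def k_def power_divide distrib_left)
    also have "\<dots> \<le> D\<^sup>2"
      by (simp add: D_def power2_sum power_mult_distrib abs_mult[symmetric] power2_commute[of P'] power2_commute[of \<theta>'])
    finally have pk: "p\<^sup>2 + 4 * k\<^sup>2 \<le> 1" using 2 by simp
    have "energy 0 D (ray_control P p \<theta> k) \<le> D * ((p\<^sup>2 + 4 * k\<^sup>2) / 2)"
      by (rule energy_ray_le[OF \<open>D \<ge> 0\<close>])
    also have "\<dots> \<le> D * 1" using pk 2 by (intro mult_left_mono) auto
    finally have e: "energy 0 D (ray_control P p \<theta> k) \<le> D" by simp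
    have "ray_path P p \<theta> k 0 = y" "ray_path P p \<theta> k D = y'"
      using 2 by (simp_all add: ray_path_def y_def y'_def p_def k_def)
    then have "u y t \<le> energy 0 D (ray_control P p \<theta> k) / 2 + u y' (t - D)"
      using dynamic_programming_le[OF \<open>D \<ge> 0\<close> _ _ trajectory_ray[of 0 D P p \<theta> k]] 2 t by auto
    moreover have "u y' (t - D) \<le> u y' t + L\<^sup>2 * D"
      using u_time_le[of "t - D" t y'] 2 t by auto
    ultimately show ?thesis using e 2 LD by (simp add: distrib_right)
  next
    case 3
    have "u y t \<le> g y" using u_antimono[of 0 t y] t by (simp add: u_0)
    moreover have "g y' \<le> u y' t + L\<^sup>2 * t" using u_time_le[of 0 t y'] t by (simp add: u_0)
    moreover have "L\<^sup>2 * t \<le> L\<^sup>2 * D" using 3 by (intro mult_left_mono) auto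
    moreover have "g y \<le> g y' + L * D"
    proof -
      have "norm (y - y') \<le> D"
        using norm_sum_diff_vec_le[of "P - P'" "\<phi> \<theta> - \<phi> \<theta>'"] \<phi>_lipschitz[of \<theta> \<theta>'] by (simp add: y_def y'_def sum_diff_vec_diff D_def)
      then have "L * norm (y - y') \<le> L * D" using L by simp
      then show ?thesis using lip[of y y'] by (simp add: abs_le_iff)
    qed
    ultimately show ?thesis using \<open>D \<ge> 0\<close> by (simp add: distrib_right)
  qed
  then show ?thesis by (simp add: y_def y'_def D_def)
qed

lemma u_travel:
  assumes "t \<in> {0..T}"
  shows "\<bar>u (sum_diff_vec P (\<phi> \<theta>)) t - u (sum_diff_vec P' (\<phi> \<theta>')) t\<bar> \<le> (1 + L\<^sup>2 + L) * (\<bar>P - P'\<bar> + 2 * \<bar>\<theta> - \<theta>'\<bar>)"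
  using u_travel_le[OF assms, of P \<theta> P' \<theta>'] u_travel_le[OF assms, of P' \<theta>' P \<theta>] 
  by (simp add: abs_le_iff abs_minus_commute)

text \<open>For distances d \<ge> 1 the bound 2M on the oscillation of \<open>u\<close> suffices.
  For d < 1 the variables P and R change by at most 2d, hence \<theta> by at most 4 sqrt d, and 2d +
  2 * 4 sqrt d \<le> 10 sqrt d.\<close>

lemma u_space_holder:
  assumes t: "t \<in> {0..T}"
  shows "\<bar>u y t - u y' t\<bar> \<le> (10 * (1 + L\<^sup>2 + L) + 2 * M) * sqrt (norm (y - y'))"
proof -
  define d where "d = norm (y - y')"
  define K where "K = 1 + L\<^sup>2 + L"
  have K: "K \<ge> 0" using L by (simp add: K_def)
  have d0: "d \<ge> 0" by (simp add: d_def)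
  show ?thesis
  proof (cases "d \<ge> 1")
    case True
    have "\<bar>u y t - u y' t\<bar> \<le> 2 * M"
      using u_bounded[of t y] u_bounded[of t y'] t by auto
    also have "\<dots> \<le> (10 * K + 2 * M) * 1" using K by simp
    also have "\<dots> \<le> (10 * K + 2 * M) * sqrt d"
      using True K M_nonneg by (intro mult_left_mono) auto
    finally show ?thesis by (simp add: K_def d_def)
  next
    case False
    define P R P' R' where "P = y $ 1 + y $ 2" and "R = y $ 1 - y $ 2" and "P' = y' $ 1 + y' $ 2" and "R' = y' $ 1 - y' $ 2"
    have c: "\<bar>y $ i - y' $ i\<bar> \<le> d" for i
      using component_le_norm_cart[of "y - y'" i] by (simp add: d_def)
    have PR: "\<bar>P - P'\<bar> \<le> 2 * d" "\<bar>R - R'\<bar> \<le> 2 * d"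
      using c[of 1] c[of 2] by (auto simp: P_def P'_def R_def R'_def)
    have "\<bar>\<Theta> R - \<Theta> R'\<bar>\<^sup>2 \<le> 8 * \<bar>R - R'\<bar>" using PR False by (intro \<Theta>_holder) auto
    also have "\<dots> \<le> 16 * d" using PR by simp
    finally have "\<bar>\<Theta> R - \<Theta> R'\<bar> \<le> sqrt (16 * d)" by (rule real_le_rsqrt)
    then have \<theta>: "\<bar>\<Theta> R - \<Theta> R'\<bar> \<le> 4 * sqrt d" by (simp add: real_sqrt_mult)
    have "d * d \<le> d * 1" using False d0 by (intro mult_left_mono) auto
    then have "d \<le> sqrt d" by (intro real_le_rsqrt) (simp add: power2_eq_square)
    have "\<bar>u (sum_diff_vec P (\<phi> (\<Theta> R))) t - u (sum_diff_vec P' (\<phi> (\<Theta> R'))) t\<bar> \<le> K * (\<bar>P - P'\<bar> + 2 * \<bar>\<Theta> R - \<Theta> R'\<bar>)"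
      unfolding K_def by (rule u_travel[OF t])
    also have "\<dots> \<le> K * (10 * sqrt d)"
      using PR \<theta> \<open>d \<le> sqrt d\<close> K by (intro mult_left_mono) auto
    also have "\<dots> \<le> (10 * K + 2 * M) * sqrt d" using M_nonneg d0 by (simp add: distrib_right)
    finally show ?thesis by (simp add: \<phi>_\<Theta> P_def R_def P'_def R'_def sum_diff_vec_eq K_def d_def)
  qed
qed

lemma u_holder:
  "\<exists>C>0. \<forall>y y'. \<forall>t\<in>{0..T}. \<forall>t'\<in>{0..T}. \<bar>u y t - u y' t'\<bar> \<le> C * (norm (y - y') powr (1/2) + \<bar>t - t'\<bar>)"
proof (intro exI conjI allI ballI)
  define C where "C = 10 * (1 + L\<^sup>2 + L) + 2 * M"
  have C: "C > 0" "L\<^sup>2 \<le> C" using L M_nonneg by (auto simp: C_def add_pos_nonneg)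
  show "C > 0" by fact
  fix y y' t t' assume t: "t \<in> {0..T}" "t' \<in> {0..T}"
  have "\<bar>u y t - u y' t'\<bar> \<le> \<bar>u y t - u y' t\<bar> + \<bar>u y' t - u y' t'\<bar>" by simp
  also have "\<dots> \<le> C * sqrt (norm (y - y')) + L\<^sup>2 * \<bar>t - t'\<bar>"
    unfolding C_def by (intro add_mono u_space_holder u_time_lipschitz t)
  also have "\<dots> \<le> C * sqrt (norm (y - y')) + C * \<bar>t - t'\<bar>"
    using C by (intro add_left_mono mult_right_mono) auto
  finally show "\<bar>u y t - u y' t'\<bar> \<le> C * (norm (y - y') powr (1/2) + \<bar>t - t'\<bar>)"
    by (simp add: powr_half_sqrt distrib_left)
qed

section \<open>The Hamilton-Jacobi equation at points of differentiability\<close>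

lemma subsolution_inequality:
  assumes t: "t \<in> {0<..<T}"
    and D: "((\<lambda>(x, t). u x t) has_derivative (\<lambda>(h, k). p \<bullet> h + q * k)) (at (x, t))"
  shows "q + 1/2 * ((E x *v p) \<bullet> p) \<le> 0"
proof -
  \<comment> \<open>This \<open>w\<close> minimises |w|^2 / 2 + p . sqrt(E) w, with minimum - (E p .
    p) / 2. The path is a ray with initial control \<open>w\<close>: it is explicit even on the
    diagonal, where solvability for a prescribed control is delicate, and its control is continuous,
    so that its energy is differentiable at 0.\<close>
  define w where "w = - (sqrtE x *v p)"
  define P \<theta> where "P = x $ 1 + x $ 2" and "\<theta> = \<Theta> (x $ 1 - x $ 2)"
  \<comment> \<open>The velocities of P and \<theta> that the control \<open>w\<close> produces at
    \<open>x\<close>.\<close>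
  define v k where "v = sqrt (1 + offdiag x) * (w $ 1 + w $ 2)" and "k = (w $ 1 - w $ 2) / 2"
  define X where "X = ray_path P v \<theta> k"
  define \<alpha> where "\<alpha> = ray_control P v \<theta> k"
  have X0: "X 0 = x" by (simp add: X_def ray_path_def \<theta>_def P_def \<phi>_\<Theta> sum_diff_vec_eq)
  have \<alpha>0: "\<alpha> 0 = w"
    using offdiag[of x] X0 unfolding X_def by (simp add: \<alpha>_def ray_control_def v_def k_def sum_diff_vec_eq diff_divide_distrib)
  define f where "f s = (norm (\<alpha> s))\<^sup>2" for s
  have "continuous_on {0..t} f"
    unfolding f_def \<alpha>_def by (intro continuous_on_power continuous_on_norm continuous_ray_control)
  then have "((\<lambda>h. energy 0 h \<alpha>) has_real_derivative f 0) (at 0 within {0..t})"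
    unfolding energy_def f_def[symmetric] using t by (intro integral_has_real_derivative) auto
  then have 1: "((\<lambda>h. energy 0 h \<alpha> / 2) has_real_derivative f 0 / 2) (at 0 within {0..t})"
    by (rule DERIV_cdivide)
  have "(X has_derivative (\<lambda>h. h *\<^sub>R (sqrtE x *v w))) (at 0)"
    using ray_path_derivative[of P v \<theta> k 0] unfolding has_vector_derivative_def
    by (simp add: X_def[symmetric] \<alpha>_def[symmetric] X0 \<alpha>0)
  then have "((\<lambda>h. (X h, t - h)) has_derivative (\<lambda>h. (h *\<^sub>R (sqrtE x *v w), - h))) (at 0)"
    by (auto intro!: derivative_eq_intros)
  moreover have "((\<lambda>(x, t). u x t) has_derivative (\<lambda>(h, k). p \<bullet> h + q * k)) (at (X 0, t - 0))"
    using D X0 by simp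
  ultimately have "((\<lambda>h. u (X h) (t - h)) has_derivative (\<lambda>h. p \<bullet> (h *\<^sub>R (sqrtE x *v w)) + q * (- h))) (at 0)"
    using diff_chain_at[of "\<lambda>h. (X h, t - h)" "\<lambda>h. (h *\<^sub>R (sqrtE x *v w), - h)" 0] by (fastforce simp: o_def)
  moreover have "(\<lambda>h. p \<bullet> (h *\<^sub>R (sqrtE x *v w)) + q * (- h)) = (*) (p \<bullet> (sqrtE x *v w) - q)"
    by (auto simp: fun_eq_iff algebra_simps)
  ultimately have "((\<lambda>h. u (X h) (t - h)) has_real_derivative (p \<bullet> (sqrtE x *v w) - q)) (at 0)"
    by (simp add: has_field_derivative_def)
  then have 2: "((\<lambda>h. u (X h) (t - h)) has_real_derivative (p \<bullet> (sqrtE x *v w) - q)) (at 0 within {0..t})"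
    by (rule has_field_derivative_at_within)
  \<comment> \<open>Dynamic programming says that \<open>G\<close> has a minimum at 0 on [0, t], so
    its right derivative there is nonnegative.\<close>
  define G where "G h = energy 0 h \<alpha> / 2 + u (X h) (t - h)" for h
  have "(G has_real_derivative (f 0 / 2 + (p \<bullet> (sqrtE x *v w) - q))) (at 0 within {0..t})"
    unfolding G_def by (rule DERIV_add[OF 1 2])
  then have "((\<lambda>h. (G h - G 0) / (h - 0)) \<longlongrightarrow> f 0 / 2 + (p \<bullet> (sqrtE x *v w) - q)) (at 0 within {0..t})"
    by (simp add: has_field_derivative_iff)
  then have lim: "((\<lambda>h. (G h - G 0) / h) \<longlongrightarrow> f 0 / 2 + (p \<bullet> (sqrtE x *v w) - q)) (at_right 0)"
    using t by (simp add: at_within_Icc_at_right)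
  have "G h \<ge> G 0" if "0 < h" "h \<le> t" for h
  proof -
    have "u (X 0) t \<le> energy 0 h \<alpha> / 2 + u (X h) (t - h)"
      using that t unfolding X_def \<alpha>_def by (intro dynamic_programming_le trajectory_ray) auto
    then show ?thesis by (simp add: G_def energy_def)
  qed
  then have "\<forall>\<^sub>F h in at_right 0. 0 \<le> (G h - G 0) / h"
    using t unfolding eventually_at_right_field by (intro exI[of _ t]) auto
  then have "0 \<le> f 0 / 2 + (p \<bullet> (sqrtE x *v w) - q)"
    using lim by (intro tendsto_lowerbound[OF lim]) auto
  moreover have "f 0 = (E x *v p) \<bullet> p" by (simp add: f_def \<alpha>0 w_def norm_sqrtE_mult)
  moreover have "p \<bullet> (sqrtE x *v w) = - ((E x *v p) \<bullet> p)"
    by (simp add: w_def linear_neg[OF matrix_vector_mul_linear] sqrtE_sqrtE inner_commute)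
  ultimately show ?thesis by simp
qed

text \<open>Take a path that is optimal up to \<open>h * e\<close> on [0, h]. Boundedness of
  \<open>u\<close> first gives a crude energy bound, which keeps the path within c sqrt h of
  \<open>x\<close>, where the expansion of \<open>u\<close> at (x, t) and the continuity of
  \<open>E\<close> apply. That error is only o(sqrt h) at first. Inserting the expansion into the
  near-optimality improves energy and displacement to O(h), so the error becomes O(e h). Now
  |\<alpha>|^2 / 2 + p . sqrt(E) \<alpha> \<ge> - (E p . p) / 2 is integrated along the path, and
  the result is divided by \<open>h\<close>.\<close>

lemma supersolution_inequality:
  assumes t: "t \<in> {0<..<T}"
    and D: "((\<lambda>(x, t). u x t) has_derivative (\<lambda>(h, k). p \<bullet> h + q * k)) (at (x, t))"
  shows "q + 1/2 * ((E x *v p) \<bullet> p) \<ge> 0"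
proof -
  define Q where "Q = (E x *v p) \<bullet> p"
  \<comment> \<open>None of these constants depends on \<open>e\<close>, so they survive the limit
    at the end. Near-optimality and |u| \<le> M give an energy below 2 (2M + 1) = \<open>B\<close>;
    \<open>c\<close> is the displacement bound with parameter sqrt h.\<close>
  define B where "B = 4 * M + 2"
  define c where "c = sqrt 2 * ((B + 1) / 2)"
  \<comment> \<open>The summand 1 absorbs the displacement part of the error
    \<open>e * (m + h)\<close>. The choice of \<open>\<eta>\<close> makes n sqrt 2 \<eta> / 2 = 1/4,
    so that half of the term A/2 is left; \<open>c1\<close> collects the factors of
    \<open>h\<close>, and \<open>c2\<close> is the resulting displacement bound per unit of
    time.\<close>
  define n where "n = norm p + 1"
  define \<eta> where "\<eta> = 1 / (2 * sqrt 2 * n)"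
  define c1 where "c1 = n * (sqrt 2 / (2 * \<eta>)) + \<bar>q\<bar> + 2"
  define c2 where "c2 = sqrt 2 * (\<eta> / 2 * (4 * c1) + 1 / (2 * \<eta>))"
  have n: "n > 0" by (simp add: n_def add_nonneg_pos)
  have \<eta>: "\<eta> > 0" using n by (simp add: \<eta>_def)
  have B: "B > 0" using M_nonneg by (simp add: B_def)
  have c: "c > 0" using B by (simp add: c_def)
  have main: "- (e * (c2 + 3)) \<le> q + Q / 2" if e: "0 < e" "e \<le> 1" for e
  proof -
    obtain \<delta>1 where \<delta>1: "\<delta>1 > 0" "\<And>z. norm (z - (x, t)) < \<delta>1 \<Longrightarrow> 
        norm ((\<lambda>(x, t). u x t) z - (\<lambda>(x, t). u x t) (x, t) - (\<lambda>(h, k). p \<bullet> h + q * k) (z - (x, t))) \<le> e * norm (z - (x, t))"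
      using D e(1) unfolding has_derivative_at_alt by blast
    have approx: "\<bar>u z s - u x t - (p \<bullet> (z - x) + q * (s - t))\<bar> \<le> e * (norm (z - x) + \<bar>s - t\<bar>)"
      if "norm (z - x) + \<bar>s - t\<bar> < \<delta>1" for z s
    proof -
      have n: "norm ((z, s) - (x, t)) \<le> norm (z - x) + \<bar>s - t\<bar>"
        using norm_Pair_le[of "z - x" "s - t"] by simp
      then have "\<bar>u z s - u x t - (p \<bullet> (z - x) + q * (s - t))\<bar> \<le> e * norm ((z, s) - (x, t))"
        using \<delta>1(2)[of "(z, s)"] that by simp
      also have "\<dots> \<le> e * (norm (z - x) + \<bar>s - t\<bar>)" using n e by (intro mult_left_mono) auto
      finally show ?thesis .
    qed
    have "continuous (at x) (\<lambda>x. (E x *v p) \<bullet> p)"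
      using continuous_E_quadratic[of UNIV p] by (simp add: continuous_on_eq_continuous_at)
    then obtain \<delta>2 where \<delta>2: "\<delta>2 > 0" "\<And>z. dist z x < \<delta>2 \<Longrightarrow> dist ((E z *v p) \<bullet> p) Q < e"
      unfolding continuous_at_eps_delta Q_def using e(1) by blast
    define \<delta> where "\<delta> = min \<delta>1 \<delta>2"
    have \<delta>: "\<delta> > 0" using \<delta>1 \<delta>2 by (simp add: \<delta>_def)
    \<comment> \<open>Ensures c sqrt h + h \<le> (c + 1) sqrt h < \<delta>, using h \<le> 1.\<close>
    define h where "h = min (t / 2) (min 1 ((\<delta> / (2 * (c + 1)))\<^sup>2))"
    have h: "0 < h" "h < t" "h \<le> 1" using t \<delta> c by (auto simp: h_def)
    have "sqrt h \<le> \<delta> / (2 * (c + 1))"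
      using \<delta> c by (intro real_le_lsqrt) (auto simp: h_def)
    then have "sqrt h * (c + 1) \<le> \<delta> / 2" using c by (simp add: field_simps)
    then have sh: "sqrt h * (c + 1) < \<delta>" using \<delta> by linarith
    have "h * h \<le> h * 1" using h by (intro mult_left_mono) auto
    then have hs: "h \<le> sqrt h" by (intro real_le_rsqrt) (simp add: power2_eq_square)
    have "h * e > 0" using h e by simp
    then obtain \<alpha> z where tr: "trajectory 0 h \<alpha> z" and z0: "z 0 = x" 
      and zh: "energy 0 h \<alpha> / 2 + u (z h) (t - h) < u x t + h * e"
      using dynamic_programming_approx[of h t "h * e" x] h t by auto
    define A where "A = energy 0 h \<alpha>"
    have A0: "A \<ge> 0" by (simp add: A_def energy_nonneg)
    have "h * e \<le> 1" using h e by (simp add: mult_le_one)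
    then have AB: "A \<le> B"
      using zh u_bounded[of "t - h" "z h"] u_bounded[of t x] t h by (auto simp: A_def B_def abs_le_iff)
    have near: "norm (z s - x) \<le> c * sqrt h" if s: "s \<in> {0..h}" for s
    proof -
      have "trajectory 0 s \<alpha> z" using s by (intro trajectory_subinterval[OF tr]) auto
      then have "norm (z s - z 0) \<le> sqrt 2 * (sqrt h / 2 * energy 0 s \<alpha> + (s - 0) / (2 * sqrt h))"
        using s h by (intro trajectory_displacement) auto
      also have "\<dots> \<le> sqrt 2 * (sqrt h / 2 * B + sqrt h / 2)"
      proof -
        have "energy 0 s \<alpha> \<le> B"
          using energy_combine[OF tr, of s] energy_nonneg[of s h \<alpha>] s AB by (simp add: A_def)
        then have "sqrt h / 2 * energy 0 s \<alpha> \<le> sqrt h / 2 * B" using h by (intro mult_left_mono) auto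
        moreover have "(s - 0) / (2 * sqrt h) \<le> h / (2 * sqrt h)"
          using s h by (intro divide_right_mono) auto
        moreover have "h / (2 * sqrt h) = sqrt h / 2"
          using h by (simp add: field_simps)
        ultimately have "sqrt h / 2 * energy 0 s \<alpha> + (s - 0) / (2 * sqrt h) \<le> sqrt h / 2 * B + sqrt h / 2"
          by linarith
        then show ?thesis by (rule mult_left_mono) simp
      qed
      also have "\<dots> = c * sqrt h" by (simp add: c_def field_simps)
      finally show ?thesis using z0 by simp
    qed
    have near2: "norm (z s - x) + h < \<delta>" if "s \<in> {0..h}" for s
      using near[OF that] hs sh by (simp add: algebra_simps)
    define m where "m = norm (z h - x)"
    have "norm (z h - x) + \<bar>(t - h) - t\<bar> < \<delta>1" using near2[of h] h by (simp add: \<delta>_def)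
    from approx[OF this] have ap: "\<bar>u (z h) (t - h) - u x t - (p \<bullet> (z h - x) + q * (- h))\<bar> \<le> e * (m + h)"
      using h by (simp add: m_def)
    have disp: "m \<le> sqrt 2 * (\<eta> / 2 * A + h / (2 * \<eta>))"
      using trajectory_displacement[OF tr _ \<eta>] h z0 by (simp add: m_def A_def)
    have A_le: "A \<le> 4 * (c1 * h)"
    proof -
      have "\<bar>p \<bullet> (z h - x)\<bar> \<le> norm p * m" by (simp add: m_def Cauchy_Schwarz_ineq2)
      moreover have "e * (m + h) \<le> 1 * (m + h)" using e h by (intro mult_right_mono) (auto simp: m_def)
      moreover have "h * e \<le> h * 1" using e h by (intro mult_left_mono) auto
      moreover have "q * (- h) \<ge> - (\<bar>q\<bar> * h)" using h by (simp add: mult_right_mono)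
      ultimately have "A / 2 \<le> n * m + (\<bar>q\<bar> + 2) * h"
        using ap zh unfolding A_def[symmetric] n_def by (simp add: algebra_simps abs_le_iff)
      also have "n * m \<le> n * (sqrt 2 * (\<eta> / 2 * A + h / (2 * \<eta>)))"
        using disp n by (intro mult_left_mono) auto
      also have "\<dots> = n * (sqrt 2 * (\<eta> / 2)) * A + n * (sqrt 2 / (2 * \<eta>)) * h"
        by (simp add: algebra_simps)
      also have "n * (sqrt 2 * (\<eta> / 2)) = 1 / 4"
        using n by (simp add: \<eta>_def)
      finally have "A / 2 \<le> 1 / 4 * A + n * (sqrt 2 / (2 * \<eta>)) * h + (\<bar>q\<bar> + 2) * h" by simp
      moreover have "c1 * h = n * (sqrt 2 / (2 * \<eta>)) * h + (\<bar>q\<bar> + 2) * h"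
        by (simp add: c1_def distrib_right)
      ultimately show ?thesis by linarith
    qed
    have m_le: "m \<le> c2 * h"
    proof -
      have "\<eta> / 2 * A \<le> \<eta> / 2 * (4 * (c1 * h))" using A_le \<eta> by (intro mult_left_mono) auto
      then have "sqrt 2 * (\<eta> / 2 * A + h / (2 * \<eta>)) \<le> sqrt 2 * (\<eta> / 2 * (4 * (c1 * h)) + h / (2 * \<eta>))"
        by (rule mult_left_mono[OF add_right_mono]) simp
      also have "\<dots> = c2 * h" by (simp add: c2_def algebra_simps)
      finally show ?thesis using disp by linarith
    qed
    have int: "((\<lambda>s. 1/2 * (norm (\<alpha> s))\<^sup>2 + p \<bullet> (sqrtE (z s) *v \<alpha> s)) has_integral (1/2 * A + p \<bullet> (z h - x))) {0..h}"
    proof (rule has_integral_add)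
      show "((\<lambda>s. 1/2 * (norm (\<alpha> s))\<^sup>2) has_integral 1/2 * A) {0..h}"
        unfolding A_def energy_def using tr
        by (intro has_integral_mult_right integrable_integral) (simp add: trajectory_def)
      have "((\<lambda>s. sqrtE (z s) *v \<alpha> s) has_integral (z h - x)) {0..h}"
        using tr h z0 by (auto simp: trajectory_def)
      from has_integral_linear[OF this bounded_linear_inner_right[of p]]
      show "((\<lambda>s. p \<bullet> (sqrtE (z s) *v \<alpha> s)) has_integral p \<bullet> (z h - x)) {0..h}" by (simp add: o_def)
    qed
    have const: "((\<lambda>s. - ((Q + e) / 2)) has_integral (h * - ((Q + e) / 2))) {0..h}"
      using has_integral_const_real[of "- ((Q + e) / 2)" 0 h] h by simp
    have "h * - ((Q + e) / 2) \<le> 1/2 * A + p \<bullet> (z h - x)"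
    proof (rule has_integral_le[OF const int])
      fix s assume "s \<in> {0..h}"
      then have "dist (z s) x < \<delta>2" using near2[of s] h by (simp add: \<delta>_def dist_norm)
      then have "(E (z s) *v p) \<bullet> p \<le> Q + e" using \<delta>2(2)[of "z s"] by (simp add: dist_real_def abs_if split: if_splits)
      moreover have "0 \<le> (norm (\<alpha> s))\<^sup>2 + 2 * (\<alpha> s \<bullet> (sqrtE (z s) *v p)) + (E (z s) *v p) \<bullet> p"
      proof -
        have "(norm (a + b))\<^sup>2 = (norm a)\<^sup>2 + 2 * (a \<bullet> b) + (norm b)\<^sup>2" for a b :: "real^2"
          by (simp add: power2_norm_eq_inner inner_add_left inner_add_right inner_commute[of b a])
        from this[of "\<alpha> s" "sqrtE (z s) *v p"] show ?thesis
          using zero_le_power2[of "norm (\<alpha> s + sqrtE (z s) *v p)"] by (simp only: norm_sqrtE_mult)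
      qed
      moreover have "p \<bullet> (sqrtE (z s) *v \<alpha> s) = \<alpha> s \<bullet> (sqrtE (z s) *v p)"
        by (metis sqrtE_selfadjoint inner_commute)
      ultimately show "- ((Q + e) / 2) \<le> 1/2 * (norm (\<alpha> s))\<^sup>2 + p \<bullet> (sqrtE (z s) *v \<alpha> s)" by argo
    qed
    moreover have "1/2 * A + p \<bullet> (z h - x) \<le> q * h + e * (m + h) + h * e"
      using ap zh unfolding A_def[symmetric] by (simp add: abs_le_iff)
    moreover have "e * (m + h) \<le> e * (c2 * h + h)" using m_le e by (intro mult_left_mono) auto
    ultimately have "h * - ((Q + e) / 2) \<le> h * (q + e * (c2 + 2))" by (simp add: algebra_simps)
    then have "- ((Q + e) / 2) \<le> q + e * (c2 + 2)" using h(1) by (rule mult_left_le_imp_le)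
    then show ?thesis using e by (simp add: algebra_simps add_divide_distrib)
  qed
  have "((\<lambda>e. - (e * (c2 + 3))) \<longlongrightarrow> - (0 * (c2 + 3))) (at_right 0)"
    by (intro tendsto_intros)
  moreover have "\<forall>\<^sub>F e in at_right 0. - (e * (c2 + 3)) \<le> q + Q / 2"
    unfolding eventually_at_right_field using main by (intro exI[of _ 1]) auto
  ultimately have "- (0 * (c2 + 3)) \<le> q + Q / 2"
    by (intro tendsto_upperbound) auto
  then show ?thesis by (simp add: Q_def)
qed

lemma hamilton_jacobi_at_differentiability_points:
  assumes t: "t \<in> {0<..<T}" and diff: "(\<lambda>(x, t). u x t) differentiable (at (x, t))"
  shows "\<exists>p q. GDERIV (\<lambda>x'. u x' t) x :> p \<and> ((\<lambda>t'. u x t') has_real_derivative q) (at t) \<and>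
           q + 1/2 * ((E x *v p) \<bullet> p) = 0"
proof -
  obtain D where D: "((\<lambda>(x, t). u x t) has_derivative D) (at (x, t))"
    using diff by (auto simp: differentiable_def)
  interpret D: bounded_linear D using D by (rule has_derivative_bounded_linear)
  \<comment> \<open>\<open>adjoint\<close> at 1 is the Riesz vector of a linear functional, here of
    the spatial part of \<open>D\<close>.\<close>
  define p q where "p = adjoint (\<lambda>h. D (h, 0)) 1" and "q = D (0, 1)"
  have "linear (\<lambda>h. D (h, 0))"
  proof (rule linearI)
    show "D (h + k, 0) = D (h, 0) + D (k, 0)" for h k using D.add[of "(h, 0)" "(k, 0)"] by simp
    show "D (r *\<^sub>R h, 0) = r *\<^sub>R D (h, 0)" for r h using D.scaleR[of r "(h, 0)"] by simp
  qed
  then have p: "D (h, 0) = p \<bullet> h" for h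
    unfolding p_def by (rule linear_functional_inner)
  have q: "D (0, k) = q * k" for k
    using D.scaleR[of k "(0, 1)"] by (simp add: q_def mult.commute)
  have Dpq: "D = (\<lambda>(h, k). p \<bullet> h + q * k)"
  proof
    fix z :: "(real^2) \<times> real"
    have "z = (fst z, 0) + (0, snd z)" by simp
    then have "D z = D (fst z, 0) + D (0, snd z)" by (metis D.add)
    then show "D z = (case z of (h, k) \<Rightarrow> p \<bullet> h + q * k)" by (simp add: p q case_prod_unfold)
  qed
  have "((\<lambda>x'. (x', t)) has_derivative (\<lambda>h. (h, 0))) (at x)"
    by (auto intro!: derivative_eq_intros)
  from has_derivative_compose[OF this D]
  have "GDERIV (\<lambda>x'. u x' t) x :> p"
    by (simp add: gderiv_def p inner_commute)
  moreover have "((\<lambda>t'. (x, t')) has_derivative (\<lambda>k. (0, k))) (at t)"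
    by (auto intro!: derivative_eq_intros)
  from has_derivative_compose[OF this D]
  have "((\<lambda>t'. u x t') has_real_derivative q) (at t)"
    by (simp add: has_field_derivative_def q)
  moreover have "q + 1/2 * ((E x *v p) \<bullet> p) = 0"
    using subsolution_inequality[OF t D[unfolded Dpq]] supersolution_inequality[OF t D[unfolded Dpq]] by simp
  ultimately show ?thesis by blast
qed

lemma u_differentiable_AE:
  "AE z in lebesgue. z \<in> UNIV \<times> {0..T} \<longrightarrow> (\<lambda>(x, t). u x t) differentiable (at z within UNIV \<times> {0..T})"
proof -
  \<comment> \<open>Clamping the time extends the function to a Lipschitz function on the whole
    space, as Rademacher's theorem requires.\<close>
  define W where "W = (\<lambda>(P, \<theta>, s). u (sum_diff_vec P (\<phi> \<theta>)) (max 0 (min T s)))"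
  define \<Phi> where "\<Phi> = (\<lambda>(P, \<theta>, s::real). (sum_diff_vec P (\<phi> \<theta>), s))"
  define \<Psi> where "\<Psi> = (\<lambda>(x::real^2, s::real). (x $ 1 + x $ 2, \<Theta> (x $ 1 - x $ 2), s))"
  define K where "K = 1 + L\<^sup>2 + L"
  have K: "K \<ge> 0" using L by (simp add: K_def)
  define N where "N = {z. \<not> W differentiable (at z)}"
  have "(3 * K + L\<^sup>2)-lipschitz_on UNIV W"
  proof (rule lipschitz_onI)
    fix z z' :: "real \<times> real \<times> real"
    obtain P \<theta> s P' \<theta>' s' where z: "z = (P, \<theta>, s)" "z' = (P', \<theta>', s')" by (metis prod.exhaust)
    define c c' where "c = max 0 (min T s)" and "c' = max 0 (min T s')"
    have c: "c \<in> {0..T}" "c' \<in> {0..T}" "\<bar>c - c'\<bar> \<le> \<bar>s - s'\<bar>" using T by (auto simp: c_def c'_def)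
    define d where "d = dist z z'"
    have d: "\<bar>P - P'\<bar> \<le> d" "\<bar>\<theta> - \<theta>'\<bar> \<le> d" "\<bar>s - s'\<bar> \<le> d"
      using dist_fst_le[of z z'] dist_snd_le[of z z'] dist_fst_le[of "snd z" "snd z'"] dist_snd_le[of "snd z" "snd z'"]
      by (auto simp: z d_def dist_real_def)
    have "dist (W z) (W z') \<le> \<bar>u (sum_diff_vec P (\<phi> \<theta>)) c - u (sum_diff_vec P' (\<phi> \<theta>')) c\<bar> + \<bar>u (sum_diff_vec P' (\<phi> \<theta>')) c - u (sum_diff_vec P' (\<phi> \<theta>')) c'\<bar>"
      by (simp add: W_def z dist_real_def c_def[symmetric] c'_def[symmetric])
    also have "\<dots> \<le> K * (\<bar>P - P'\<bar> + 2 * \<bar>\<theta> - \<theta>'\<bar>) + L\<^sup>2 * \<bar>c - c'\<bar>"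
      unfolding K_def by (intro add_mono u_travel u_time_lipschitz c)
    also have "\<dots> \<le> K * (3 * d) + L\<^sup>2 * d"
      using d c K by (intro add_mono mult_left_mono) auto
    finally show "dist (W z) (W z') \<le> (3 * K + L\<^sup>2) * dist z z'" by (simp add: d_def algebra_simps)
  qed (use K in auto)
  then have "negligible N" unfolding N_def by (rule Rademacher)
  have "\<Phi> differentiable (at z)" for z
  proof -
    have "(\<lambda>z. fst z / 2 :: real) differentiable (at z)" for z :: "real \<times> real \<times> real"
      by (intro differentiable_divide differentiable_const bounded_linear_imp_differentiable[OF bounded_linear_fst]) simp
    moreover have "(\<lambda>z. \<phi> (fst (snd z)) / 2) differentiable (at z)" for z :: "real \<times> real \<times> real"
    proof -
      have "(\<lambda>z. fst (snd z) :: real) differentiable (at z)" for z :: "real \<times> real \<times> real"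
        by (intro bounded_linear_imp_differentiable bounded_linear_compose[OF bounded_linear_fst bounded_linear_snd])
      moreover have "\<phi> differentiable (at a)" for a using \<phi>_deriv by (auto simp: real_differentiable_def)
      ultimately have "(\<phi> \<circ> (\<lambda>z. fst (snd z))) differentiable (at z)" for z :: "real \<times> real \<times> real"
        by (intro differentiable_chain_at)
      then show ?thesis by (intro differentiable_divide) (auto simp: o_def)
    qed
    moreover have "(\<lambda>z. snd (snd z) :: real) differentiable (at z)" for z :: "real \<times> real \<times> real"
      by (intro bounded_linear_imp_differentiable bounded_linear_compose[OF bounded_linear_snd bounded_linear_snd])
    ultimately have "(\<lambda>z. ((fst z / 2) *\<^sub>R vector [1, 1] + (\<phi> (fst (snd z)) / 2) *\<^sub>R vector [1, -1] :: real^2, snd (snd z) :: real)) differentiable (at z)"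
      by (intro differentiable_Pair differentiable_add differentiable_scaleR) auto
    then show ?thesis by (simp add: \<Phi>_def sum_diff_vec_def case_prod_unfold)
  qed
  then have "negligible (\<Phi> ` N)"
    using \<open>negligible N\<close>
    by (intro negligible_differentiable_image_negligible) (auto simp: differentiable_on_def intro: differentiable_at_withinI)
  \<comment> \<open>The discarded hyperplanes are the diagonal, where \<open>\<Theta>\<close> is
    singular, and the times 0 and T, where no neighbourhood avoids the clamping.\<close>
  moreover have "negligible {z :: (real^2) \<times> real. (vector [1, -1], 0) \<bullet> z = 0}"
    by (rule negligible_hyperplane) (simp add: vec_eq_iff forall_2 zero_prod_def)
  moreover have "negligible {z :: (real^2) \<times> real. (0, 1) \<bullet> z = c}" for c
    by (rule negligible_hyperplane) (simp add: zero_prod_def)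
  ultimately have neg: "negligible (\<Phi> ` N \<union> {z. (vector [1, -1], 0) \<bullet> z = 0} \<union> {z. (0, 1) \<bullet> z = 0} \<union> {z. (0, 1) \<bullet> z = T})" (is "negligible ?B")
    by simp
  have good: "(\<lambda>(x, t). u x t) differentiable (at (x, t))" if z: "(x, t) \<notin> ?B" and t: "t \<in> {0..T}" for x t
  proof -
    have r: "x $ 1 - x $ 2 \<noteq> 0" and t: "t \<in> {0<..<T}"
      using z t by (auto simp: inner_vec_def sum_2)
    have "\<Phi> (\<Psi> (x, t)) = (x, t)" by (simp add: \<Phi>_def \<Psi>_def \<phi>_\<Theta> sum_diff_vec_eq)
    then have "\<Psi> (x, t) \<notin> N" using z by (metis UnI1 image_eqI)
    then have W: "W differentiable (at (\<Psi> (x, t)))" by (simp add: N_def)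
    have "\<Psi> differentiable (at (x, t))"
    proof -
      have comp: "(\<lambda>z. fst z $ i :: real) differentiable (at z)" for i and z :: "(real^2) \<times> real"
        by (intro bounded_linear_imp_differentiable bounded_linear_compose[OF bounded_linear_vec_nth bounded_linear_fst])
      have "(\<lambda>z :: (real^2) \<times> real. fst z $ 1 - fst z $ 2) differentiable (at (x, t))"
        by (intro differentiable_diff comp)
      moreover have "\<Theta> differentiable (at (fst (x, t) $ 1 - fst (x, t) $ 2))" using \<Theta>_differentiable[OF r] by simp
      ultimately have "(\<Theta> \<circ> (\<lambda>z :: (real^2) \<times> real. fst z $ 1 - fst z $ 2)) differentiable (at (x, t))"
        by (intro differentiable_chain_at)
      moreover have "(\<lambda>z :: (real^2) \<times> real. snd z) differentiable (at (x, t))"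
        by (intro bounded_linear_imp_differentiable bounded_linear_snd)
      ultimately have "(\<lambda>z :: (real^2) \<times> real. (fst z $ 1 + fst z $ 2, \<Theta> (fst z $ 1 - fst z $ 2), snd z)) differentiable (at (x, t))"
        by (intro differentiable_Pair differentiable_add comp) (auto simp: o_def)
      then show ?thesis by (simp add: \<Psi>_def case_prod_unfold)
    qed
    then have "(W \<circ> \<Psi>) differentiable (at (x, t))" using W by (rule differentiable_chain_at)
    then obtain D where "((W \<circ> \<Psi>) has_derivative D) (at (x, t))" by (auto simp: differentiable_def)
    then have "((\<lambda>(x, t). u x t) has_derivative D) (at (x, t))"
    proof (rule has_derivative_transform_within_open[of _ _ _ _ "UNIV \<times> {0<..<T}"])
      fix z :: "(real^2) \<times> real" assume "z \<in> UNIV \<times> {0<..<T}"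
      then show "(W \<circ> \<Psi>) z = (\<lambda>(x, t). u x t) z"
        by (auto simp: W_def \<Psi>_def \<phi>_\<Theta> sum_diff_vec_eq)
    qed (use t in \<open>auto intro: open_Times\<close>)
    then show ?thesis by (auto simp: differentiable_def)
  qed
  have "AE z in lebesgue. z \<notin> ?B"
    using neg by (intro AE_not_in) (simp only: negligible_iff_null_sets)
  then show ?thesis
  proof (rule eventually_mono, intro impI)
    fix z :: "(real^2) \<times> real" assume z: "z \<notin> ?B" "z \<in> UNIV \<times> {0..T}"
    obtain x t where xt: "z = (x, t)" by (cases z)
    have "t \<in> {0..T}" using z(2) unfolding xt by blast
    with z(1) have "(\<lambda>(x, t). u x t) differentiable (at (x, t))"
      unfolding xt by (rule good)
    then show "(\<lambda>(x, t). u x t) differentiable (at z within UNIV \<times> {0..T})"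
      unfolding xt by (rule differentiable_at_withinI)
  qed
qed

end

theorem theorem1:
  fixes T :: real and g :: "real^2 \<Rightarrow> real" and u :: "real^2 \<Rightarrow> real \<Rightarrow> real"
  assumes "T > 0"
    and "bounded (range g)"
    and "\<exists>L. L-lipschitz_on UNIV g"
    and "\<And>x t. t \<in> {0..T} \<Longrightarrow> u x t = value_function g T x (T - t)"
  shows "(\<exists>C>0. \<forall>y y'. \<forall>t\<in>{0..T}. \<forall>t'\<in>{0..T}.
            \<bar>u y t - u y' t'\<bar> \<le> C * (norm (y - y') powr (1/2) + \<bar>t - t'\<bar>)) \<and>
         (AE z in lebesgue. z \<in> UNIV \<times> {0..T} \<longrightarrow>
            (\<lambda>(x, t). u x t) differentiable (at z within UNIV \<times> {0..T})) \<and>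
         (\<forall>x. \<forall>t\<in>{0<..<T}. (\<lambda>(x, t). u x t) differentiable (at (x, t)) \<longrightarrow>
            (\<exists>p q. GDERIV (\<lambda>x'. u x' t) x :> p \<and>
                   ((\<lambda>t'. u x t') has_real_derivative q) (at t) \<and>
                   q + 1/2 * ((E x *v p) \<bullet> p) = 0))"
proof -
  obtain M where M: "\<And>x. \<bar>g x\<bar> \<le> M"
    using assms(2) by (auto simp: bounded_iff)
  obtain L where L: "L-lipschitz_on UNIV g" using assms(3) by blast
  \<comment> \<open>A constant \<open>g\<close> may come with \<open>L = 0\<close>, whereas the
    locale asks for a positive constant.\<close>
  have "\<bar>g x - g y\<bar> \<le> (L + 1) * norm (x - y)" for x y
  proof -
    have "\<bar>g x - g y\<bar> \<le> L * norm (x - y)" using lipschitz_onD[OF L, of x y] by (simp add: dist_norm)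
    also have "\<dots> \<le> (L + 1) * norm (x - y)" by (intro mult_right_mono) auto
    finally show ?thesis .
  qed
  then interpret bounded_lipschitz_cost T M "L + 1" g u
    using assms M lipschitz_on_nonneg[OF L] by unfold_locales auto
  show ?thesis
    using u_holder u_differentiable_AE hamilton_jacobi_at_differentiability_points by blast
qed

end
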